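(* There exists $t_0>0$ such that for every $t\in(0,t_0]$ the measure $\sigma_t$ is not $\boxtimes$-strongly log-unimodal.
   Context: $\mathbb{R}_+=(0,\infty)$. Unimodality: a positive Borel measure $\mu$ on $\mathbb{R}$ is unimodal with mode $a\in\mathbb{R}$ if $\mu=c\,\delta_a+f(x)\,dx$ where $c\in[0,\infty]$ and $f:\mathbb{R}\to[0,\infty)$ is non-decreasing on $(-\infty,a)$ and non-increasing on $(a,\infty)$. A positive Borel measure $\mu$ on $\mathbb{R}_+$ is log-unimodal with mode $a\in\mathbb{R}_+$ if its push-forward $\log_*\mu$ under $\log:\mathbb{R}_+\to\mathbb{R}$ is unimodal with mode $\log a$; it is log-unimodal if this holds for some $a\in\mathbb{R}_+$. Free multiplicative convolution: for a probability measure $\mu$ on $\mathbb{R}_+$ put $\psi_\mu(z)=\int_0^\infty\frac{xz}{1-xz}\,d\mu(x)$ for $z\in\mathbb{C}\setminus[0,\infty)$ and $\eta_\mu=\psi_\mu/(1+\psi_\mu)$. The function $\eta_\mu$ has an analytic compositional inverse $\eta_\mu^{-1}$ in a neighborhood of $(-\infty,0)$, and the $\Sigma$-transform is $\Sigma_\mu(z)=\eta_\mu^{-1}(z)/z$; it determines $\mu$ uniquely. For probability measures $\mu,\nu$ on $\mathbb{R}_+$, $\mu\boxtimes\nu$ is the probability measure on $\mathbb{R}_+$ determined by $\Sigma_{\mu\boxtimes\nu}(z)=\Sigma_\mu(z)\Sigma_\nu(z)$ for $z\in(-\infty,0)$ (equivalently, it is the distribution of $X^{1/2}YX^{1/2}$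 for freely independent non-negative self-adjoint operators $X,Y$ affiliated with a finite von Neumann algebra, with distributions $\mu,\nu$). A probability measure $\mu$ on $\mathbb{R}_+$ is $\boxtimes$-strongly log-unimodal if $\mu\boxtimes\nu$ is log-unimodal for every log-unimodal probability measure $\nu$ on $\mathbb{R}_+$. Free positive multiplicative Brownian motion: for $t>0$, $\sigma_t$ is the ($\boxtimes$-infinitely divisible) probability measure on $\mathbb{R}_+$ with $\Sigma_{\sigma_t}(z)=\exp\left(\frac t2\cdot\frac{z+1}{z-1}\right)$. *)

theory Defs
  imports "HOL-Probability.Probability"
begin

text \<open>A Borel measure on the positive half-line is represented as a Borel measure on the whole
  real line that gives the non-positive numbers measure zero.\<close>

definition prob_measure_Rpos :: "real measure \<Rightarrow> bool" where
  "prob_measure_Rpos \<mu> \<longleftrightarrow> prob_space \<mu> \<and> sets \<mu> = sets borel \<and> emeasure \<mu> {..0} = 0"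

text \<open>No measurability condition on \<open>f\<close> is needed: it follows from piecewise monotonicity.
  The weight \<open>c\<close> of the atom may be infinite.\<close>

definition unimodal_with_mode :: "real measure \<Rightarrow> real \<Rightarrow> bool" where
  "unimodal_with_mode \<mu> a \<longleftrightarrow>
     sets \<mu> = sets borel \<and>
     (\<exists>(c :: ennreal) (f :: real \<Rightarrow> real).
        (\<forall>x. 0 \<le> f x) \<and> mono_on {..<a} f \<and> antimono_on {a<..} f \<and>
        (\<forall>A\<in>sets borel.
           emeasure \<mu> A = c * indicator A a + (\<integral>\<^sup>+x\<in>A. ennreal (f x) \<partial>lborel)))"

text \<open>Intended for measures giving the non-positive numbers measure zero, so the
  values of \<^const>\<open>ln\<close> there play no role in the push-forward.\<close>

definition log_unimodal_with_mode :: "real measure \<Rightarrow> real \<Rightarrow> bool" where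
  "log_unimodal_with_mode \<mu> a \<longleftrightarrow> 0 < a \<and> unimodal_with_mode (distr \<mu> borel ln) (ln a)"

definition log_unimodal :: "real measure \<Rightarrow> bool" where
  "log_unimodal \<mu> \<longleftrightarrow> (\<exists>a. log_unimodal_with_mode \<mu> a)"

definition psi_transform :: "real measure \<Rightarrow> complex \<Rightarrow> complex" where
  "psi_transform \<mu> z = (LINT x|\<mu>. of_real x * z / (1 - of_real x * z))"

definition eta_transform :: "real measure \<Rightarrow> complex \<Rightarrow> complex" where
  "eta_transform \<mu> z = psi_transform \<mu> z / (1 + psi_transform \<mu> z)"

text \<open>For a probability measure on the positive half-line, the eta-transform maps the negative
  real axis bijectively onto itself. The inverse of this bijection is the restriction to the
  negative axis of the analytic compositional inverse, and the Sigma-transform below is therefore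
  meaningful for negative real arguments. These values determine its analytic
  continuation to a connected neighbourhood of the negative axis.\<close>

definition eta_inverse :: "real measure \<Rightarrow> complex \<Rightarrow> complex" where
  "eta_inverse \<mu> = inv_into (complex_of_real ` {..<0}) (eta_transform \<mu>)"

definition Sigma_transform :: "real measure \<Rightarrow> complex \<Rightarrow> complex" where
  "Sigma_transform \<mu> z = eta_inverse \<mu> z / z"

definition free_mult_conv :: "real measure \<Rightarrow> real measure \<Rightarrow> real measure" where
  "free_mult_conv \<mu> \<nu> =
     (THE \<rho>. prob_measure_Rpos \<rho> \<and>
        (\<forall>z\<in>complex_of_real ` {..<0}.
           Sigma_transform \<rho> z = Sigma_transform \<mu> z * Sigma_transform \<nu> z))"

definition free_mult_strongly_log_unimodal :: "real measure \<Rightarrow> bool" where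
  "free_mult_strongly_log_unimodal \<mu> \<longleftrightarrow>
     (\<forall>\<nu>. prob_measure_Rpos \<nu> \<longrightarrow> log_unimodal \<nu> \<longrightarrow> log_unimodal (free_mult_conv \<mu> \<nu>))"

text \<open>The marginal law at time \<open>t > 0\<close> of free positive multiplicative Brownian motion.\<close>

definition free_mult_BM :: "real \<Rightarrow> real measure" where
  "free_mult_BM t =
     (THE \<sigma>. prob_measure_Rpos \<sigma> \<and>
        (\<forall>z\<in>complex_of_real ` {..<0}.
           Sigma_transform \<sigma> z = exp (of_real t / 2 * ((z + 1) / (z - 1)))))"

end

theory Submission
  imports Defs "HOL-Complex_Analysis.Complex_Analysis" "HOL-Real_Asymp.Real_Asymp"
begin

text \<open>In the logarithmic variable, \<open>g\<^sub>\<mu> a = \<integral> tanh ((a - y) / 2) d\<mu>(y)\<close> carries the same information as the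
  \<open>\<Sigma>\<close>-transform of \<open>\<mu>\<close> on the negative axis, and \<open>\<rho>\<close> is the convolution of \<open>\<nu>\<close> with \<open>\<sigma>\<^sub>t\<close> iff
  \<open>g\<^sub>\<rho> (b + t/2 g\<^sub>\<nu> b) = g\<^sub>\<nu> b\<close> for all real \<open>b\<close>. Let \<open>G\<^sub>\<nu> w = \<integral> coth ((w - y) / 2) d\<nu>(y)\<close> be the analytic
  extension, with \<open>g\<^sub>\<nu> b = G\<^sub>\<nu> (b + i \<pi>)\<close>, and \<open>\<Phi> w = w + t/2 G\<^sub>\<nu> w\<close>. In the strip \<open>0 < Im w < \<pi>\<close> the ratio
  \<open>Im (\<Phi> w) / Im w\<close> increases with \<open>Im w\<close>, so the level lines of \<open>Im \<circ> \<Phi>\<close> are graphs over the real axis, and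
  \<open>\<Phi>\<close> maps \<open>{w. 0 < Im (\<Phi> w)}\<close> bijectively onto the strip. Cauchy's formula on horizontal lines and
  Helly's theorem turn \<open>G\<^sub>\<nu> \<circ> \<Phi>\<^sup>-\<^sup>1\<close> into \<open>G\<^sub>\<rho>\<close> for a probability measure \<open>\<rho>\<close>; this constructs both \<open>\<sigma>\<^sub>t\<close>
  (from \<open>\<nu> = \<delta>\<^sub>0\<close>) and its convolutions.

  The density of \<open>\<rho>\<close> at the boundary point below \<open>s\<close> is \<open>v s / (\<pi> t)\<close>, where \<open>v s\<close> is the height of
  the curve \<open>Im (\<Phi> w) = 0\<close> above \<open>s\<close>. Hence if \<open>\<rho>\<close> is unimodal then, for each \<open>v\<close>, the points \<open>s\<close> with
  \<open>t sin v / (2 v) \<integral> 1 / (cosh (s - y) - cos v) d\<nu>(y) > 1\<close> essentially form an interval. On the scale \<open>sqrt t\<close>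
  the kernel tends, as \<open>t\<close> tends to \<open>0\<close>, to the Cauchy kernel \<open>1 / ((s - y)\<^sup>2 + v\<^sup>2)\<close>, which is not
  log-concave: its convolution with a unimodal law consisting of an atom and a long flat piece starting
  there has a dip next to the atom.\<close>

section \<open>The kernel and its integral transform\<close>

text \<open>\<open>free_mult_BM\<close> and \<open>free_mult_conv\<close> are definite descriptions,
  so nothing can be said about them until existence and uniqueness of a measure with the prescribed
  transform on the negative axis are proved; a large part of the development serves this. Under
  \<open>z = exp (- w)\<close> the negative axis becomes the line \<open>Im w = pi\<close>, interior
  to the strip of width \<open>2 * pi\<close>. The density is read off elsewhere, at the real
  boundary, and analytic continuation from the line connects the two places. The obstacle to a
  counterexample is that the boundary point belonging to \<open>s\<close> is known only up to
  \<open>sqrt (t + t\<^sup>2 / 4)\<close>, which is of the same order \<open>sqrt t\<close> as the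
  scale on which the kernel has a nontrivial limit. The dip therefore has to be several units of
  \<open>sqrt t\<close> wide, so that the displacement cannot change the order of the three test
  points. After rescaling, the claim rests on three strict inequalities between arctangents.\<close>

definition coth_half :: "complex \<Rightarrow> complex" where
  "coth_half z = (exp z + 1) / (exp z - 1)"

definition coth_half_deriv :: "complex \<Rightarrow> complex" where
  "coth_half_deriv z = - 2 * exp z / (exp z - 1)\<^sup>2"

lemma cos_less_one:
  fixes v :: real
  assumes "0 < v" "v < 2 * pi"
  shows "cos v < 1"
proof -
  have "sin (v / 2) > 0" using assms by (intro sin_gt_zero) auto
  moreover have "cos v = 1 - 2 * (sin (v / 2))\<^sup>2"
    using cos_double_sin[of "v / 2"] by simp
  ultimately show ?thesis by (simp add: zero_less_power)
qed

lemma cosh_minus_cos_ge: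
  fixes u v :: real
  shows "1 - cos v \<le> cosh u - cos v"
  using cosh_real_ge_1[of u] by simp

lemma cosh_minus_cos_pos:
  fixes u v :: real
  assumes "0 < v" "v < 2 * pi"
  shows "0 < cosh u - cos v"
  using cos_less_one[OF assms] cosh_minus_cos_ge[of v u] by linarith

text \<open>Introduces \<open>cosh (Re z) - cos (Im z)\<close>, the denominator in the kernel and in
  all bounds below: up to the factor \<open>2 * exp (Re z)\<close> it is the squared distance of
  \<open>exp z\<close> from \<open>1\<close>, where the poles are.\<close>

lemma norm_exp_minus_one_sq:
  "(cmod (exp z - 1))\<^sup>2 = 2 * exp (Re z) * (cosh (Re z) - cos (Im z))"
proof -
  have "(cmod (exp z - 1))\<^sup>2 = (exp (Re z) * cos (Im z) - 1)\<^sup>2 + (exp (Re z) * sin (Im z))\<^sup>2"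
    by (simp add: cmod_power2 Re_exp Im_exp)
  also have "\<dots> = (exp (Re z))\<^sup>2 * ((sin (Im z))\<^sup>2 + (cos (Im z))\<^sup>2) - 2 * exp (Re z) * cos (Im z) + 1"
    by algebra
  also have "\<dots> = 2 * exp (Re z) * (cosh (Re z) - cos (Im z))"
    by (simp add: cosh_field_def exp_minus field_simps power2_eq_square[of "exp _"])
  finally show ?thesis .
qed

lemma exp_neq_one_strip:
  assumes "0 < Im z" "Im z < 2 * pi"
  shows "exp z \<noteq> 1"
proof
  assume "exp z = 1"
  then have "2 * exp (Re z) * (cosh (Re z) - cos (Im z)) = 0"
    using norm_exp_minus_one_sq[of z] by simp
  then show False using cosh_minus_cos_pos[OF assms, of "Re z"] by simp
qed

lemma coth_half_eq:
  assumes "0 < Im z" "Im z < 2 * pi"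
  shows "coth_half z = Complex (sinh (Re z) / (cosh (Re z) - cos (Im z)))
                              (- sin (Im z) / (cosh (Re z) - cos (Im z)))"
proof -
  define p h c s where "p = exp (Re z)" and "h = sinh (Re z)" and "c = cos (Im z)" and "s = sin (Im z)"
  define D where "D = cosh (Re z) - c"
  have D: "D > 0" using cosh_minus_cos_pos[OF assms] by (simp add: D_def c_def)
  have ph: "p = D + c + h"
    by (simp add: p_def h_def D_def cosh_plus_sinh)
  have pq: "p * (D + c - h) = 1"
    unfolding p_def h_def D_def by (simp add: cosh_minus_sinh flip: exp_add)
  have sc: "s\<^sup>2 = 1 - c\<^sup>2" by (simp add: s_def c_def sin_squared_eq)
  have ez: "exp z = Complex (p * c) (p * s)"
    by (simp add: complex_eq_iff Re_exp Im_exp p_def c_def s_def)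
  have r: "h * (p * c - 1) + s * (p * s) = (p * c + 1) * D"
    using pq sc ph by algebra
  have i: "h * (p * s) - s * (p * c - 1) = p * s * D"
    using pq sc ph by algebra
  have "exp z + 1 = Complex (h / D) (- s / D) * (exp z - 1)"
  proof -
    have "h / D * (p * c - 1) - - s / D * (p * s) = (h * (p * c - 1) + s * (p * s)) / D"
      unfolding add_divide_distrib by simp
    moreover have "h / D * (p * s) + - s / D * (p * c - 1) = (h * (p * s) - s * (p * c - 1)) / D"
      unfolding diff_divide_distrib by simp
    ultimately show ?thesis
      using D unfolding ez complex_eq_iff r i by simp
  qed
  moreover have "exp z - 1 \<noteq> 0" using exp_neq_one_strip[OF assms] by simp
  ultimately show ?thesis
    unfolding coth_half_def D_def s_def h_def c_def by (metis nonzero_mult_div_cancel_right)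
qed

lemma Re_coth_half:
  "0 < Im z \<Longrightarrow> Im z < 2 * pi \<Longrightarrow> Re (coth_half z) = sinh (Re z) / (cosh (Re z) - cos (Im z))"
  by (simp add: coth_half_eq)

lemma Im_coth_half:
  "0 < Im z \<Longrightarrow> Im z < 2 * pi \<Longrightarrow> Im (coth_half z) = - sin (Im z) / (cosh (Re z) - cos (Im z))"
  by (simp add: coth_half_eq)

lemma has_field_derivative_coth_half:
  assumes "exp z \<noteq> 1"
  shows "(coth_half has_field_derivative coth_half_deriv z) (at z within S)"
  unfolding coth_half_def[abs_def] coth_half_deriv_def
  using assms by (auto intro!: derivative_eq_intros simp: power2_eq_square field_simps)

lemma norm_coth_half_deriv:
  assumes "0 < Im z" "Im z < 2 * pi"
  shows "cmod (coth_half_deriv z) = 1 / (cosh (Re z) - cos (Im z))"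
  using cosh_minus_cos_pos[OF assms, of "Re z"]
  by (simp add: coth_half_deriv_def norm_mult norm_divide norm_power norm_exp_minus_one_sq)

lemma Re_coth_half_deriv:
  assumes "0 < Im z" "Im z < 2 * pi"
  shows "Re (coth_half_deriv z) =
    (1 - cosh (Re z) * cos (Im z)) / (cosh (Re z) - cos (Im z))\<^sup>2"
proof -
  define p c s where "p = exp (Re z)" and "c = cos (Im z)" and "s = sin (Im z)"
  define D where "D = cosh (Re z) - c"
  have D: "D > 0" using cosh_minus_cos_pos[OF assms] by (simp add: D_def c_def)
  have p: "p > 0" by (simp add: p_def)
  have pq: "2 * p * (D + c) = p\<^sup>2 + 1"
    by (simp add: D_def p_def cosh_field_def exp_minus field_simps power2_eq_square[of "exp _"])
  have sc: "s\<^sup>2 = 1 - c\<^sup>2" by (simp add: s_def c_def sin_squared_eq)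
  have ez: "exp z = Complex (p * c) (p * s)"
    by (simp add: complex_eq_iff Re_exp Im_exp p_def c_def s_def)
  have ne: "exp z - 1 \<noteq> 0" using exp_neq_one_strip[OF assms] by simp
  \<comment> \<open>Multiplying twice by the conjugate makes the denominator real, so the real part
    can be taken in the numerator.\<close>
  have nn: "(exp z - 1) * cnj (exp z - 1) = of_real (2 * p * D)"
    unfolding complex_norm_square[symmetric] p_def D_def c_def norm_exp_minus_one_sq ..
  have "coth_half_deriv z * of_real ((2 * p * D)\<^sup>2) =
      coth_half_deriv z * (exp z - 1)\<^sup>2 * (cnj (exp z - 1))\<^sup>2"
    unfolding of_real_power nn[symmetric] by (simp only: power_mult_distrib mult.assoc)
  also have "\<dots> = - 2 * exp z * (cnj (exp z - 1))\<^sup>2"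
    using ne by (simp add: coth_half_deriv_def)
  finally have "Re (coth_half_deriv z * of_real ((2 * p * D)\<^sup>2)) = Re (- 2 * exp z * (cnj (exp z - 1))\<^sup>2)"
    by (rule arg_cong)
  also have "\<dots> = - 2 * (p * c * ((p * c - 1)\<^sup>2 - (p * s)\<^sup>2) + 2 * (p * s) * ((p * c - 1) * (p * s)))"
    unfolding ez power2_eq_square by simp
  also have "\<dots> = (1 - (D + c) * c) * (4 * p\<^sup>2)"
    using pq sc by algebra
  finally have "Re (coth_half_deriv z) * D\<^sup>2 * (4 * p\<^sup>2) = (1 - (D + c) * c) * (4 * p\<^sup>2)"
    by (simp add: power_mult_distrib mult.assoc mult.left_commute)
  then have "Re (coth_half_deriv z) * D\<^sup>2 = 1 - cosh (Re z) * c"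
    using p unfolding mult_cancel_right D_def by simp
  then show ?thesis using D unfolding D_def c_def by (simp add: field_simps)
qed

definition coth_transform :: "real measure \<Rightarrow> complex \<Rightarrow> complex" where
  "coth_transform \<mu> z = (LINT y|\<mu>. coth_half (z - of_real y))"

definition tanh_transform :: "real measure \<Rightarrow> real \<Rightarrow> real" where
  "tanh_transform \<mu> a = (LINT y|\<mu>. tanh ((a - y) / 2))"

lemma borel_measurable_tanh [measurable]: "(tanh :: real \<Rightarrow> real) \<in> borel_measurable borel"
  by (intro borel_measurable_continuous_onI continuous_intros) auto

lemma abs_tanh_real_le_1: "\<bar>tanh (x::real)\<bar> \<le> 1"
  using tanh_real_lt_1[of x] tanh_real_gt_neg1[of x] by linarith

lemma cos_le_cos_strip:
  fixes e v :: real
  assumes "0 \<le> e" "e \<le> v" "v \<le> 2 * pi - e"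
  shows "cos v \<le> cos e"
proof (cases "v \<le> pi")
  case True
  then show ?thesis using assms by (intro cos_monotone_0_pi_le) auto
next
  case False
  have "cos v = cos (2 * pi - v)" by (simp add: cos_diff)
  also have "\<dots> \<le> cos e" using assms False by (intro cos_monotone_0_pi_le) auto
  finally show ?thesis .
qed

text \<open>From \<open>sinh\<^sup>2 = cosh\<^sup>2 - 1 \<le> cosh\<^sup>2 - cos\<^sup>2\<close>,
  which factors. The right side is affine in \<open>1 / (cosh u - cos v)\<close>, whose integral is
  under control wherever \<open>Im \<circ> \<Phi>\<close> is nonnegative, even for small
  \<open>v\<close>.\<close>

lemma sinh_sq_div_le:
  fixes u v :: real
  assumes "0 < v" "v < 2 * pi"
  shows "(sinh u / (cosh u - cos v))\<^sup>2 \<le> 1 + 2 * cos v / (cosh u - cos v)"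
proof -
  define D where "D = cosh u - cos v"
  have D: "D > 0" using cosh_minus_cos_pos[OF assms] by (simp add: D_def)
  have "(cos v)\<^sup>2 \<le> 1" by (simp add: abs_square_le_1)
  then have "(sinh u)\<^sup>2 \<le> (cosh u)\<^sup>2 - (cos v)\<^sup>2"
    by (simp add: cosh_square_eq)
  also have "\<dots> = D * (D + 2 * cos v)"
    by (simp add: D_def power2_eq_square algebra_simps)
  finally have "(sinh u)\<^sup>2 / D\<^sup>2 \<le> D * (D + 2 * cos v) / D\<^sup>2"
    by (rule divide_right_mono) simp
  also have "\<dots> = 1 + 2 * cos v / D"
    using D by (simp add: power2_eq_square add_divide_distrib)
  finally show ?thesis by (simp add: D_def power_divide)
qed

text \<open>The bound depends on \<open>Im z\<close> alone, so one constant dominates the kernel for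
  all real shifts \<open>y\<close>.\<close>

lemma norm_coth_half_sq_le:
  assumes "0 < Im z" "Im z < 2 * pi"
  shows "(cmod (coth_half z))\<^sup>2 \<le> 1 + 2 / (1 - cos (Im z))"
proof -
  define D where "D = cosh (Re z) - cos (Im z)"
  have D: "D > 0" using cosh_minus_cos_pos[OF assms] by (simp add: D_def)
  have lt1: "cos (Im z) < 1" using cos_less_one[OF assms] .
  have "(sinh (Re z))\<^sup>2 + (sin (Im z))\<^sup>2 = D * (D + 2 * cos (Im z))"
    by (simp add: D_def power2_eq_square algebra_simps sin_squared_eq[unfolded power2_eq_square]
        cosh_square_eq[unfolded power2_eq_square])
  then have "(cmod (coth_half z))\<^sup>2 = (D * (D + 2 * cos (Im z))) / D\<^sup>2"
    using assms by (simp add: cmod_power2 coth_half_eq D_def[symmetric] power_divide add_divide_distrib[symmetric])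
  also have "\<dots> = 1 + 2 * cos (Im z) / D"
    using D by (simp add: power2_eq_square add_divide_distrib)
  also have "\<dots> \<le> 1 + 2 / D"
    using D by (simp add: divide_right_mono)
  also have "\<dots> \<le> 1 + 2 / (1 - cos (Im z))"
    using D lt1 cosh_minus_cos_ge[of "Im z" "Re z"] by (simp add: D_def frac_le)
  finally show ?thesis .
qed

lemma coth_half_pi: "coth_half (Complex u pi) = of_real (tanh (u / 2))"
proof -
  have "coth_half (Complex u pi) = Complex (sinh u / (cosh u + 1)) 0"
    by (simp add: coth_half_eq)
  moreover have "sinh u / (cosh u + 1) = tanh (u / 2)"
  proof -
    have "sinh u = 2 * sinh (u / 2) * cosh (u / 2)" "cosh u + 1 = 2 * (cosh (u / 2))\<^sup>2"
      using sinh_double[of "u / 2"] cosh_double_cosh[of "u / 2"] by simp_all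
    then show ?thesis
      using cosh_real_pos[of "u / 2"] by (simp add: tanh_def power2_eq_square)
  qed
  ultimately show ?thesis by (simp add: complex_eq_iff)
qed

lemma borel_measurable_coth_half:
  assumes "0 < Im z" "Im z < 2 * pi"
  shows "(\<lambda>y::real. coth_half (z - of_real y)) \<in> borel_measurable borel"
proof (rule borel_measurable_continuous_onI)
  have "exp (z - of_real y) \<noteq> 1" for y
    using exp_neq_one_strip[of "z - of_real y"] assms by simp
  then show "continuous_on UNIV (\<lambda>y::real. coth_half (z - of_real y))"
    unfolding coth_half_def by (intro continuous_intros) auto
qed

lemma borel_measurable_coth_half_deriv:
  assumes "0 < Im z" "Im z < 2 * pi"
  shows "(\<lambda>y::real. coth_half_deriv (z - of_real y)) \<in> borel_measurable borel"
proof (rule borel_measurable_continuous_onI)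
  have "exp (z - of_real y) \<noteq> 1" for y
    using exp_neq_one_strip[of "z - of_real y"] assms by simp
  then show "continuous_on UNIV (\<lambda>y::real. coth_half_deriv (z - of_real y))"
    unfolding coth_half_deriv_def by (intro continuous_intros) auto
qed

context real_distribution
begin

lemma integrable_coth_half:
  assumes "0 < Im z" "Im z < 2 * pi"
  shows "integrable M (\<lambda>y. coth_half (z - of_real y))"
proof (rule integrable_const_bound[where B = "sqrt (1 + 2 / (1 - cos (Im z)))"])
  show "AE y in M. cmod (coth_half (z - of_real y)) \<le> sqrt (1 + 2 / (1 - cos (Im z)))"
    using assms norm_coth_half_sq_le[of "z - of_real y" for y]
    by (intro AE_I2 real_le_rsqrt) simp
  show "(\<lambda>y. coth_half (z - of_real y)) \<in> borel_measurable M"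
    using borel_measurable_coth_half[OF assms] by simp
qed

lemma integrable_coth_half_deriv:
  assumes "0 < Im z" "Im z < 2 * pi"
  shows "integrable M (\<lambda>y. coth_half_deriv (z - of_real y))"
proof (rule integrable_const_bound[where B = "1 / (1 - cos (Im z))"])
  show "AE y in M. cmod (coth_half_deriv (z - of_real y)) \<le> 1 / (1 - cos (Im z))"
    using assms cos_less_one[OF assms] cosh_minus_cos_pos[OF assms]
    by (auto intro!: AE_I2 frac_le cosh_minus_cos_ge simp: norm_coth_half_deriv)
  show "(\<lambda>y. coth_half_deriv (z - of_real y)) \<in> borel_measurable M"
    using borel_measurable_coth_half_deriv[OF assms] by simp
qed

text \<open>Differentiation under the integral: on a closed substrip the derivative of the kernel is
  bounded, so the kernel is Lipschitz there, and its Lipschitz constant dominates the difference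
  quotients for every \<open>y\<close>.\<close>

lemma has_field_derivative_coth_transform:
  assumes z: "0 < Im z" "Im z < 2 * pi"
  shows "(coth_transform M has_field_derivative (LINT y|M. coth_half_deriv (z - of_real y))) (at z)"
proof -
  \<comment> \<open>Half the distance from \<open>z\<close> to the edge of the strip, so that
    \<open>z + h\<close> with \<open>cmod h < e\<close> stays in the closed substrip
    \<open>T\<close>.\<close>
  define e where "e = min (Im z) (2 * pi - Im z) / 2"
  have e: "0 < e" "e < Im z" "Im z < 2 * pi - e" "e < 2 * pi"
    using z by (auto simp: e_def min_def field_simps)
  define T where "T = {w. e \<le> Im w \<and> Im w \<le> 2 * pi - e}"
  have T: "convex T"
    unfolding T_def by (simp only: Collect_conj_eq) (intro convex_Int convex_halfspace_Im_ge convex_halfspace_Im_le)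
  have in_T: "z + h \<in> T" if "cmod h < e" for h
    using that e abs_Im_le_cmod[of h] unfolding T_def e_def
    by (auto simp: min_def field_simps split: if_splits)
  have strip: "0 < Im w \<and> Im w < 2 * pi" if "w \<in> T" for w
    using that e by (auto simp: T_def)
  have ce: "cos e < 1" using cos_less_one e by auto
  have lip: "cmod (coth_half a - coth_half b) \<le> 1 / (1 - cos e) * cmod (a - b)"
    if "a \<in> T" "b \<in> T" for a b
  proof (rule field_differentiable_bound[OF T, where f' = coth_half_deriv])
    show "(coth_half has_field_derivative coth_half_deriv w) (at w within T)" if "w \<in> T" for w
      using exp_neq_one_strip strip[OF that] by (intro has_field_derivative_coth_half) auto
    show "cmod (coth_half_deriv w) \<le> 1 / (1 - cos e)" if "w \<in> T" for w
    proof -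
      have "cos (Im w) \<le> cos e"
        using that e by (intro cos_le_cos_strip) (auto simp: T_def)
      then have "1 - cos e \<le> cosh (Re w) - cos (Im w)"
        using cosh_real_ge_1[of "Re w"] by linarith
      then show ?thesis
        using strip[OF that] ce by (simp add: norm_coth_half_deriv frac_le)
    qed
  qed (use that in auto)
  have diff: "((\<lambda>h. (coth_transform M (z + h) - coth_transform M z) / h) \<longlongrightarrow>
      (LINT y|M. coth_half_deriv (z - of_real y))) (at 0)"
    unfolding tendsto_at_iff_sequentially
  proof (intro allI impI, unfold comp_def)
    fix X :: "nat \<Rightarrow> complex"
    assume X: "\<forall>i. X i \<in> UNIV - {0}" and X0: "X \<longlonglongrightarrow> 0"
    have X1: "\<forall>\<^sub>F i in sequentially. cmod (X i) < e"
      using tendsto_norm[OF X0] e by (auto intro: order_tendstoD)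
    \<comment> \<open>Dominated convergence wants the bound for every index; shifting by
      \<open>N\<close> discards the finitely many increments that may leave
      \<open>T\<close>.\<close>
    then obtain N where N: "\<And>i. i \<ge> N \<Longrightarrow> cmod (X i) < e"
      unfolding eventually_sequentially by auto
    define f where "f i y = (coth_half (z + X (i + N) - of_real y) - coth_half (z - of_real y)) / X (i + N)" for i and y :: real
    have s1: "0 < Im (z + X (i + N))" "Im (z + X (i + N)) < 2 * pi" for i
      using strip[OF in_T[OF N]] by auto
    have inT': "z + X (i + N) - of_real y \<in> T" "z - of_real y \<in> T" for i and y :: real
      using in_T[OF N, of "i + N"] in_T[of 0] e by (auto simp: T_def)
    have nz: "X (i + N) \<noteq> 0" for i using X by auto
    have "(\<lambda>i. LINT y|M. f i y) \<longlonglongrightarrow> (LINT y|M. coth_half_deriv (z - of_real y))"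
    proof (rule integral_dominated_convergence[where w = "\<lambda>_. 1 / (1 - cos e)"])
      show "AE y in M. (\<lambda>i. f i y) \<longlonglongrightarrow> coth_half_deriv (z - of_real y)"
      proof (rule AE_I2)
        fix y
        have "(coth_half has_field_derivative coth_half_deriv (z - of_real y)) (at (z - of_real y))"
          using exp_neq_one_strip[of "z - of_real y"] z by (intro has_field_derivative_coth_half) auto
        then have "((\<lambda>h. (coth_half (z - of_real y + h) - coth_half (z - of_real y)) / h)
            \<longlongrightarrow> coth_half_deriv (z - of_real y)) (at 0)"
          by (simp add: DERIV_def)
        moreover have "(\<lambda>i. X (i + N)) \<longlonglongrightarrow> 0" using X0 by (rule LIMSEQ_ignore_initial_segment)
        ultimately have "(\<lambda>i. (coth_half (z - of_real y + X (i + N)) - coth_half (z - of_real y)) / X (i + N))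
            \<longlonglongrightarrow> coth_half_deriv (z - of_real y)"
          using X unfolding tendsto_at_iff_sequentially comp_def by auto
        then show "(\<lambda>i. f i y) \<longlonglongrightarrow> coth_half_deriv (z - of_real y)"
          by (simp add: f_def algebra_simps)
      qed
      show "AE y in M. cmod (f i y) \<le> 1 / (1 - cos e)" for i
      proof (rule AE_I2)
        fix y
        have "z + X (i + N) - of_real y - (z - of_real y) = X (i + N)" by simp
        then have "cmod (coth_half (z + X (i + N) - of_real y) - coth_half (z - of_real y))
            \<le> 1 / (1 - cos e) * cmod (X (i + N))"
          using lip[OF inT'(1)[of i y] inT'(2)[of y]] by (simp only:)
        then show "cmod (f i y) \<le> 1 / (1 - cos e)"
          using nz[of i] by (simp add: f_def norm_divide pos_divide_le_eq)
      qed
      show "f i \<in> borel_measurable M" for i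
        unfolding f_def using borel_measurable_coth_half[OF s1[of i]] borel_measurable_coth_half[OF z]
        by simp
      show "(\<lambda>y. coth_half_deriv (z - of_real y)) \<in> borel_measurable M"
        using borel_measurable_coth_half_deriv[OF z] by simp
    qed simp
    also have "(\<lambda>i. LINT y|M. f i y) =
        (\<lambda>i. (coth_transform M (z + X (i + N)) - coth_transform M z) / X (i + N))"
      unfolding f_def coth_transform_def
      using integrable_coth_half[OF s1] integrable_coth_half[OF z] by simp
    finally show "(\<lambda>i. (coth_transform M (z + X i) - coth_transform M z) / X i) \<longlonglongrightarrow>
        (LINT y|M. coth_half_deriv (z - of_real y))"
      by (rule LIMSEQ_offset)
  qed
  then show ?thesis by (simp add: DERIV_def)
qed

lemma holomorphic_coth_transform:
  "coth_transform M holomorphic_on {z. 0 < Im z \<and> Im z < 2 * pi}"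
  using has_field_derivative_coth_transform
  by (auto simp: holomorphic_on_def field_differentiable_def intro: has_field_derivative_at_within)

lemma Re_coth_transform:
  assumes "0 < Im z" "Im z < 2 * pi"
  shows "Re (coth_transform M z) = (LINT y|M. sinh (Re z - y) / (cosh (Re z - y) - cos (Im z)))"
  unfolding coth_transform_def
  using integral_Re[OF integrable_coth_half[OF assms]] assms
  by (simp add: Re_coth_half)

lemma Im_coth_transform:
  assumes "0 < Im z" "Im z < 2 * pi"
  shows "Im (coth_transform M z) = - (LINT y|M. sin (Im z) / (cosh (Re z - y) - cos (Im z)))"
proof -
  have "Im (coth_transform M z) = (LINT y|M. Im (coth_half (z - of_real y)))"
    unfolding coth_transform_def using integral_Im[OF integrable_coth_half[OF assms]] by simp
  then show ?thesis using assms by (simp add: Im_coth_half)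
qed

lemma coth_transform_pi: "coth_transform M (Complex a pi) = of_real (tanh_transform M a)"
proof -
  have "coth_half (Complex a pi - of_real y) = of_real (tanh ((a - y) / 2))" for y
  proof -
    have "Complex a pi - of_real y = Complex (a - y) pi" by (simp add: complex_eq_iff)
    then show ?thesis by (simp only: coth_half_pi)
  qed
  then show ?thesis by (simp add: coth_transform_def tanh_transform_def)
qed

end

section \<open>The subordination map\<close>

definition subordination_map :: "real measure \<Rightarrow> real \<Rightarrow> complex \<Rightarrow> complex" where
  "subordination_map \<nu> t w = w + of_real (t / 2) * coth_transform \<nu> w"

lemma sin_minus_x_cos_nonneg:
  fixes v :: real
  assumes "0 \<le> v" "v \<le> pi"
  shows "v * cos v \<le> sin v"
proof -
  have "sin 0 - 0 * cos 0 \<le> sin v - v * cos v"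
  proof (rule DERIV_nonneg_imp_nondecreasing[OF assms(1)])
    fix x assume "0 \<le> x" "x \<le> v"
    then have "x * sin x \<ge> 0" using assms by (intro mult_nonneg_nonneg sin_ge_zero) auto
    moreover have "((\<lambda>x. sin x - x * cos x) has_real_derivative x * sin x) (at x)"
      by (auto intro!: derivative_eq_intros)
    ultimately show "\<exists>y. ((\<lambda>x. sin x - x * cos x) has_real_derivative y) (at x) \<and> y \<ge> 0" by blast
  qed
  then show ?thesis by simp
qed

text \<open>Clearing the denominator leaves \<open>C * (s - v * c) + (v - s * c) \<ge> 0\<close>, a
  sum of nonnegative terms. The inequality is the infinitesimal form of "\<open>Im f / Im z\<close>
  increases upwards"; being linear in \<open>f\<close>, it survives integration over
  \<open>y\<close> and the addition of \<open>z\<close>, for which equality holds.\<close>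

lemma Im_coth_half_le_deriv:
  assumes "0 < Im z" "Im z < pi"
  shows "Im (coth_half z) \<le> Im z * Re (coth_half_deriv z)"
proof -
  define C c s v where "C = cosh (Re z)" and "c = cos (Im z)" and "s = sin (Im z)" and "v = Im z"
  define D where "D = C - c"
  have D: "D > 0" using cosh_minus_cos_pos[of "Im z" "Re z"] assms by (simp add: D_def C_def c_def)
  have C: "C \<ge> 1" by (simp add: C_def cosh_real_ge_1)
  have svc: "v * c \<le> s" using sin_minus_x_cos_nonneg[of v] assms by (simp add: s_def c_def v_def)
  have "0 \<le> C * (s - v * c) - (s - v * c)"
    using mult_right_mono[OF C, of "s - v * c"] svc by simp
  moreover have "s * c \<le> v"
  proof -
    show ?thesis
      using sin_x_le_x[of "2 * v"] assms by (simp add: sin_double s_def c_def v_def)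
  qed
  moreover have "s * c \<le> s * 1"
    using sin_gt_zero[OF assms] unfolding s_def c_def by (intro mult_left_mono) auto
  ultimately have "- (s * D) \<le> v * (1 - C * c)"
    using svc by (simp add: D_def algebra_simps)
  then have "- (s * D) / D\<^sup>2 \<le> v * (1 - C * c) / D\<^sup>2"
    by (rule divide_right_mono) simp
  then have "- s / D \<le> v * ((1 - C * c) / D\<^sup>2)"
    using D by (simp add: power2_eq_square)
  then show ?thesis
    using assms by (simp add: Im_coth_half Re_coth_half_deriv C_def c_def s_def v_def D_def)
qed

lemma (in prob_space) expectation_sq_le:
  fixes f :: "'a \<Rightarrow> real"
  assumes "integrable M f" "integrable M (\<lambda>x. (f x)\<^sup>2)"
  shows "(LINT x|M. f x)\<^sup>2 \<le> (LINT x|M. (f x)\<^sup>2)"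
  using variance_eq[OF assms] variance_positive[of f] by simp

lemma (in prob_space) expectation_pos:
  fixes f :: "'a \<Rightarrow> real"
  assumes f: "integrable M f" "\<And>x. 0 < f x"
  shows "0 < (LINT x|M. f x)"
proof -
  have "(LINT x|M. f x) \<noteq> 0"
  proof
    assume "(LINT x|M. f x) = 0"
    then have "AE x in M. f x = 0"
      using f by (subst (asm) integral_nonneg_eq_0_iff_AE) (auto simp: less_imp_le)
    then have "AE x in M. False"
      using f(2) by (auto elim!: eventually_mono simp: less_imp_neq[THEN not_sym])
    then show False by (simp add: AE_False)
  qed
  moreover have "0 \<le> (LINT x|M. f x)"
    using f(2) by (intro integral_nonneg_AE AE_I2) (auto simp: less_imp_le)
  ultimately show ?thesis by simp
qed

context real_distribution
begin

abbreviation \<Phi> :: "real \<Rightarrow> complex \<Rightarrow> complex" where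
  "\<Phi> \<equiv> subordination_map M"

lemma prob_UNIV: "prob UNIV = 1"
  using prob_space by simp

lemma integrable_Poisson:
  assumes "0 < v" "v < 2 * pi"
  shows "integrable M (\<lambda>y. 1 / (cosh (s - y) - cos v))"
proof (rule integrable_const_bound[where B = "1 / (1 - cos v)"])
  show "AE y in M. norm (1 / (cosh (s - y) - cos v)) \<le> 1 / (1 - cos v)"
    using cos_less_one[OF assms] cosh_minus_cos_pos[OF assms] cosh_minus_cos_ge[of v]
    by (auto intro!: AE_I2 frac_le intro: order_trans[OF _ abs_ge_self])
qed (auto simp: cosh_def)

lemma Im_coth_transform':
  assumes "0 < Im z" "Im z < 2 * pi"
  shows "Im (coth_transform M z) = - sin (Im z) * (LINT y|M. 1 / (cosh (Re z - y) - cos (Im z)))"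
proof -
  have "Im (coth_transform M z) = - (LINT y|M. sin (Im z) * (1 / (cosh (Re z - y) - cos (Im z))))"
    using Im_coth_transform[OF assms] by simp
  then show ?thesis by (simp only: integral_mult_right_zero mult_minus_left)
qed

lemma Poisson_pos:
  assumes "0 < v" "v < 2 * pi"
  shows "0 < (LINT y|M. 1 / (cosh (s - y) - cos v))"
  using cosh_minus_cos_pos[OF assms] by (intro expectation_pos integrable_Poisson assms) simp

lemma Im_coth_transform_neg:
  assumes "0 < Im z" "Im z < pi"
  shows "Im (coth_transform M z) < 0"
  using Im_coth_transform'[of z] Poisson_pos[of "Im z" "Re z"] sin_gt_zero[OF assms] assms
  by simp

lemma subordination_map_DERIV:
  assumes "0 < Im z" "Im z < 2 * pi"
  shows "(\<Phi> t has_field_derivative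
     1 + of_real (t / 2) * (LINT y|M. coth_half_deriv (z - of_real y))) (at z)"
  unfolding subordination_map_def[abs_def]
  using has_field_derivative_coth_transform[OF assms]
  by (auto intro!: derivative_eq_intros)

lemma subordination_map_deriv:
  assumes "0 < Im z" "Im z < 2 * pi"
  shows "(\<Phi> t has_field_derivative deriv (\<Phi> t) z) (at z)"
  using subordination_map_DERIV[OF assms, of t] DERIV_imp_deriv[OF subordination_map_DERIV[OF assms, of t]]
  by simp

lemma isCont_subordination_map:
  assumes "0 < Im z" "Im z < 2 * pi"
  shows "isCont (\<Phi> t) z"
  using subordination_map_DERIV[OF assms] by (rule DERIV_isCont)

lemma Im_subordination_map_le_deriv:
  assumes z: "0 < Im z" "Im z < pi" and t: "0 \<le> t"
  shows "Im (\<Phi> t z) \<le> Im z * Re (deriv (\<Phi> t) z)"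
proof -
  have z2: "Im z < 2 * pi" using z by simp
  have "Im (coth_transform M z) = (LINT y|M. Im (coth_half (z - of_real y)))"
    unfolding coth_transform_def using integral_Im[OF integrable_coth_half[OF z(1) z2]] by simp
  also have "\<dots> \<le> (LINT y|M. Im z * Re (coth_half_deriv (z - of_real y)))"
    using integrable_coth_half[OF z(1) z2] integrable_coth_half_deriv[OF z(1) z2] z
      Im_coth_half_le_deriv[of "z - of_real y" for y]
    by (intro integral_mono integrable_Im integrable_mult_right integrable_Re) auto
  also have "\<dots> = Im z * Re (LINT y|M. coth_half_deriv (z - of_real y))"
    using integral_Re[OF integrable_coth_half_deriv[OF z(1) z2]] by simp
  finally have "t / 2 * Im (coth_transform M z) \<le> t / 2 * (Im z * Re (LINT y|M. coth_half_deriv (z - of_real y)))"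
    using t by (intro mult_left_mono) auto
  then show ?thesis
    unfolding DERIV_imp_deriv[OF subordination_map_DERIV[OF z(1) z2]]
    by (simp add: subordination_map_def algebra_simps)
qed

lemma Im_subordination_map_less:
  assumes "0 < Im z" "Im z < pi" "0 < t"
  shows "Im (\<Phi> t z) < Im z"
  using Im_coth_transform_neg[OF assms(1,2)] assms by (simp add: subordination_map_def mult_pos_neg)

lemma Im_subordination_map_ratio_mono:
  assumes v: "0 < v" "v \<le> v'" "v' < pi" and t: "0 \<le> t"
  shows "Im (\<Phi> t (Complex s v)) / v \<le> Im (\<Phi> t (Complex s v')) / v'"
proof (rule DERIV_nonneg_imp_nondecreasing[OF v(2)])
  fix x assume x: "v \<le> x" "x \<le> v'"
  define d where "d = deriv (\<Phi> t) (Complex s x)"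
  define q where "q x = Im (\<Phi> t (Complex s x))" for x
  have "(\<Phi> t has_field_derivative d) (at (Complex s x))"
    unfolding d_def using v x by (intro subordination_map_deriv) auto
  moreover have "((\<lambda>x. Complex s x) has_vector_derivative \<i>) (at x)"
    unfolding Complex_eq by (auto intro!: derivative_eq_intros)
  \<comment> \<open>Moving vertically multiplies the derivative by \<open>\<i>\<close>, so the
    upward derivative of \<open>Im \<circ> \<Phi>\<close> is \<open>Re d\<close>.\<close>
  ultimately have "(\<Phi> t \<circ> Complex s has_vector_derivative \<i> * d) (at x)"
    by (rule field_vector_diff_chain_at[rotated])
  then have "((\<lambda>x. Im ((\<Phi> t \<circ> Complex s) x)) has_vector_derivative Im (\<i> * d)) (at x)"
    by (rule bounded_linear.has_vector_derivative[OF bounded_linear_Im])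
  then have q: "(q has_real_derivative Re d) (at x)"
    by (simp add: q_def[abs_def] comp_def has_real_derivative_iff_has_vector_derivative)
  have "((\<lambda>x. q x / x) has_real_derivative (Re d * x - q x) / x\<^sup>2) (at x)"
    using q x v by (auto intro!: derivative_eq_intros simp: power2_eq_square)
  moreover have "q x \<le> x * Re d"
    using Im_subordination_map_le_deriv[of "Complex s x" t] x v t by (simp add: q_def d_def)
  then have "(Re d * x - q x) / x\<^sup>2 \<ge> 0" by (simp add: mult.commute)
  ultimately show "\<exists>y. ((\<lambda>x. Im (\<Phi> t (Complex s x)) / x) has_real_derivative y) (at x) \<and> 0 \<le> y"
    unfolding q_def by blast
qed

text \<open>A nondecreasing ratio times the strictly increasing height is strictly increasing where
  the ratio is positive. This is why only level lines with \<open>e > 0\<close> are used.\<close>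

lemma Im_subordination_map_strict_mono:
  assumes v: "0 < v" "v < v'" "v' < pi" and t: "0 \<le> t"
    and pos: "0 < Im (\<Phi> t (Complex s v))"
  shows "Im (\<Phi> t (Complex s v)) < Im (\<Phi> t (Complex s v'))"
proof -
  define q where "q x = Im (\<Phi> t (Complex s x))" for x
  have "q v / v \<le> q v' / v'" unfolding q_def using v t by (intro Im_subordination_map_ratio_mono) auto
  then have "q v * v' \<le> q v' * v" using v by (simp add: field_simps)
  moreover have "q v * v < q v * v'" using v pos by (simp add: q_def)
  ultimately have "q v * v < q v' * v" by linarith
  then show ?thesis using v by (simp add: q_def)
qed

lemma Im_coth_transform_ge:
  assumes z: "0 < Im z" "Im z < pi" and t: "0 < t" and nn: "0 \<le> Im (\<Phi> t z)"
  shows "- Im (coth_transform M z) \<le> 2 * Im z / t"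
  using nn t by (simp add: subordination_map_def field_simps)

text \<open>Cauchy-Schwarz reduces the claim to the integral \<open>I\<close> of
  \<open>1 / (cosh - cos)\<close>. The sign of \<open>Im (\<Phi> t z)\<close> gives
  \<open>sin v * I \<le> 2 * v / t\<close>, and \<open>v * cos v \<le> sin v\<close> cancels the
  height; for \<open>cos v \<le> 0\<close> the term only helps.\<close>

lemma Re_coth_transform_sq_le:
  assumes z: "0 < Im z" "Im z < pi" and t: "0 < t" and nn: "0 \<le> Im (\<Phi> t z)"
  shows "(Re (coth_transform M z))\<^sup>2 \<le> 1 + 4 / t"
proof -
  define v where "v = Im z"
  define I where "I = (LINT y|M. 1 / (cosh (Re z - y) - cos v))"
  have v: "0 < v" "v < 2 * pi" "v < pi" using z by (auto simp: v_def)
  have sv: "sin v > 0" using sin_gt_zero[OF v(1,3)] .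
  have I: "I > 0" unfolding I_def by (rule Poisson_pos[OF v(1,2)])
  have sI: "sin v * I \<le> 2 * v / t"
    using Im_coth_transform_ge[OF z t nn] Im_coth_transform'[of z] z by (simp add: v_def I_def)
  define f where "f y = sinh (Re z - y) / (cosh (Re z - y) - cos v)" for y
  have f: "integrable M f"
    using integrable_Re[OF integrable_coth_half[of z]] z
    by (simp add: f_def[abs_def] v_def Re_coth_half)
  have g: "integrable M (\<lambda>y. 1 + 2 * cos v * (1 / (cosh (Re z - y) - cos v)))"
    using integrable_Poisson[OF v(1,2), of "Re z"] by (intro Bochner_Integration.integrable_add integrable_mult_right) auto
  have fle: "(f y)\<^sup>2 \<le> 1 + 2 * cos v * (1 / (cosh (Re z - y) - cos v))" for y
    using sinh_sq_div_le[OF v(1,2), of "Re z - y"] by (simp add: f_def)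
  have f2: "integrable M (\<lambda>y. (f y)\<^sup>2)"
    using f fle by (intro Bochner_Integration.integrable_bound[OF g] AE_I2)
      (auto intro: order_trans[OF _ abs_ge_self] simp del: times_divide_eq_right)
  have "(Re (coth_transform M z))\<^sup>2 = (LINT y|M. f y)\<^sup>2"
    using z by (simp add: Re_coth_transform f_def v_def)
  also have "\<dots> \<le> (LINT y|M. (f y)\<^sup>2)" using f f2 by (rule expectation_sq_le)
  also have "\<dots> \<le> (LINT y|M. 1 + 2 * cos v * (1 / (cosh (Re z - y) - cos v)))"
    using f2 g fle by (intro integral_mono) auto
  also have "\<dots> = 1 + 2 * cos v * I"
    unfolding I_def using integrable_Poisson[OF v(1,2), of "Re z"]
    by (subst Bochner_Integration.integral_add)
       (auto simp: prob_UNIV simp del: times_divide_eq_right intro!: integrable_mult_right)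
  also have "2 * cos v * I \<le> 4 / t"
  proof (cases "cos v \<le> 0")
    case True
    then have "2 * cos v * I \<le> 0" using I by (simp add: mult_nonpos_nonneg)
    then show ?thesis using t by (meson divide_nonneg_pos order_trans zero_le_numeral)
  next
    case False
    have "v * (cos v * I) \<le> sin v * I"
      using sin_minus_x_cos_nonneg[of v] v I by (simp add: mult.assoc[symmetric] mult_right_mono)
    also have "\<dots> \<le> 2 * v / t" by (rule sI)
    finally have "v * (cos v * I) \<le> v * (2 / t)" by (simp add: mult.commute)
    then have "cos v * I \<le> 2 / t" using v(1) by (simp only: mult_le_cancel_left_pos)
    then show ?thesis by simp
  qed
  finally show ?thesis by simp
qed

text \<open>The horizontal displacement is of order \<open>sqrt t\<close>, uniformly in the point
  and the law. It makes \<open>\<Phi>\<close> surjective, carries the behaviour at infinity over to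
  the inverse, and finally keeps boundary points in order.\<close>

lemma Re_subordination_map_bound:
  assumes z: "0 < Im z" "Im z < pi" and t: "0 < t" and nn: "0 \<le> Im (\<Phi> t z)"
  shows "\<bar>Re (\<Phi> t z) - Re z\<bar> \<le> sqrt (t + t\<^sup>2 / 4)"
proof (rule real_le_rsqrt)
  have "(t / 2 * Re (coth_transform M z))\<^sup>2 \<le> (t / 2)\<^sup>2 * (1 + 4 / t)"
    unfolding power_mult_distrib using Re_coth_transform_sq_le[OF assms] by (rule mult_left_mono) simp
  also have "\<dots> = t + t\<^sup>2 / 4" using t by (simp add: power2_eq_square field_simps)
  finally show "\<bar>Re (\<Phi> t z) - Re z\<bar>\<^sup>2 \<le> t + t\<^sup>2 / 4"
    unfolding power2_abs by (simp add: subordination_map_def)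
qed

end

section \<open>Reflection in the line \<open>Im z = pi\<close>\<close>

abbreviation (input) strip :: "complex set" where
  "strip \<equiv> {z. 0 < Im z \<and> Im z < 2 * pi}"

lemma open_strip: "open strip"
  by (simp only: Collect_conj_eq) (intro open_Int open_halfspace_Im_gt open_halfspace_Im_lt)

lemma convex_strip: "convex strip"
  by (simp only: Collect_conj_eq) (intro convex_Int convex_halfspace_Im_gt convex_halfspace_Im_lt)

text \<open>The kernel is real on \<open>Im z = pi\<close>, so this reflection conjugates all
  transforms. Estimates are then needed only below the line, while the line itself, where the
  convolution is prescribed, lies in the interior of the domain.\<close>

definition strip_reflect :: "complex \<Rightarrow> complex" where
  "strip_reflect z = Complex (Re z) (2 * pi - Im z)"

lemma strip_reflect_simps [simp]:
  "Re (strip_reflect z) = Re z" "Im (strip_reflect z) = 2 * pi - Im z"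
  "strip_reflect (strip_reflect z) = z"
  by (simp_all add: strip_reflect_def)

lemma strip_reflect_inj [simp]: "strip_reflect z = strip_reflect w \<longleftrightarrow> z = w"
  by (auto simp: strip_reflect_def complex_eq_iff)

context real_distribution
begin

lemma coth_transform_reflect:
  assumes "0 < Im z" "Im z < 2 * pi"
  shows "coth_transform M (strip_reflect z) = cnj (coth_transform M z)"
proof -
  have "coth_half (strip_reflect z - of_real y) = cnj (coth_half (z - of_real y))" for y
    using assms by (simp add: coth_half_eq complex_eq_iff cos_diff sin_diff)
  then show ?thesis by (simp add: coth_transform_def integral_cnj)
qed

lemma subordination_map_reflect:
  assumes "0 < Im z" "Im z < 2 * pi"
  shows "\<Phi> t (strip_reflect z) = strip_reflect (\<Phi> t z)"
  using assms by (simp add: subordination_map_def coth_transform_reflect complex_eq_iff)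

lemma subordination_map_pi:
  "\<Phi> t (Complex b pi) = Complex (b + t / 2 * tanh_transform M b) pi"
  by (simp add: subordination_map_def coth_transform_pi complex_eq_iff)

lemma integrable_tanh_scaled: "integrable M (\<lambda>y. tanh (\<kappa> * (a - y) / 2))"
  using abs_tanh_real_le_1 by (intro integrable_const_bound[where B = 1] AE_I2) auto

lemma integrable_tanh: "integrable M (\<lambda>y. tanh ((a - y) / 2))"
  using integrable_tanh_scaled[of 1 a] by simp

lemma abs_tanh_transform_le: "\<bar>tanh_transform M a\<bar> \<le> 1"
proof -
  have "\<bar>tanh_transform M a\<bar> \<le> (LINT y|M. 1)"
    unfolding tanh_transform_def
    using abs_tanh_real_le_1
    by (intro integral_abs_bound[THEN order_trans] integral_mono integrable_abs integrable_tanh) auto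
  then show ?thesis by (simp add: prob_UNIV)
qed

lemma tanh_transform_mono: "a \<le> b \<Longrightarrow> tanh_transform M a \<le> tanh_transform M b"
  unfolding tanh_transform_def by (intro integral_mono integrable_tanh) auto

section \<open>Level lines of the imaginary part\<close>

lemma continuous_Im_subordination_map:
  assumes "0 < v" "v < 2 * pi"
  shows "isCont (\<lambda>s. Im (\<Phi> t (Complex s v))) s"
    and "isCont (\<lambda>v. Im (\<Phi> t (Complex s v))) v"
proof -
  have c: "isCont (\<Phi> t) (Complex s v)"
    using assms by (intro isCont_subordination_map) auto
  have "isCont (\<lambda>s. Complex s v) s" "isCont (\<lambda>v. Complex s v) v"
    unfolding Complex_eq by (intro continuous_intros)+
  from this(1)[THEN isCont_o2, OF c] this(2)[THEN isCont_o2, OF c]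
  show "isCont (\<lambda>s. Im (\<Phi> t (Complex s v))) s"
    and "isCont (\<lambda>v. Im (\<Phi> t (Complex s v))) v"
    by (simp_all add: isCont_Im)
qed

text \<open>Intermediate values between height \<open>e\<close>, where
  \<open>Im \<circ> \<Phi>\<close> is below \<open>e\<close> because \<open>\<Phi>\<close> lowers
  imaginary parts, and height \<open>pi\<close>, which \<open>\<Phi>\<close> preserves.\<close>

lemma level_exists:
  assumes e: "0 < e" "e < pi" and t: "0 < t"
  shows "\<exists>v. 0 < v \<and> v < pi \<and> Im (\<Phi> t (Complex s v)) = e"
proof -
  have "\<exists>v\<ge>e. v \<le> pi \<and> Im (\<Phi> t (Complex s v)) = e"
  proof (rule IVT)
    show "Im (\<Phi> t (Complex s e)) \<le> e"
      using Im_subordination_map_less[of "Complex s e" t] e t by simp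
    show "e \<le> Im (\<Phi> t (Complex s pi))"
      using e by (simp add: subordination_map_pi)
    show "\<forall>x. e \<le> x \<and> x \<le> pi \<longrightarrow> isCont (\<lambda>v. Im (\<Phi> t (Complex s v))) x"
      using e by (intro allI impI continuous_Im_subordination_map) auto
  qed (use e in auto)
  then obtain v where v: "e \<le> v" "v \<le> pi" "Im (\<Phi> t (Complex s v)) = e" by blast
  moreover have "v \<noteq> pi" using v e by (auto simp: subordination_map_pi)
  ultimately show ?thesis using e by (intro exI[of _ v]) auto
qed

definition level :: "real \<Rightarrow> real \<Rightarrow> real \<Rightarrow> real" where
  "level t e s = (SOME v. 0 < v \<and> v < pi \<and> Im (\<Phi> t (Complex s v)) = e)"

lemma level:
  assumes "0 < e" "e < pi" "0 < t"
  shows "0 < level t e s" "level t e s < pi" "Im (\<Phi> t (Complex s (level t e s))) = e"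
  using someI_ex[OF level_exists[OF assms, of s]] unfolding level_def by auto

lemma level_unique:
  assumes "0 < e" "e < pi" "0 < t" "0 < v" "v < pi" "Im (\<Phi> t (Complex s v)) = e"
  shows "v = level t e s"
  using Im_subordination_map_strict_mono[of v "level t e s" t s]
    Im_subordination_map_strict_mono[of "level t e s" v t s] level[OF assms(1-3), of s] assms
  by (cases v "level t e s" rule: linorder_cases) auto

text \<open>At heights \<open>v - d\<close> and \<open>v + d\<close> the values lie strictly on
  either side of \<open>e\<close>, and they still do at nearby real parts; vertical monotonicity
  then traps the level between these heights.\<close>

lemma isCont_level:
  assumes e: "0 < e" "e < pi" and t: "0 < t"
  shows "isCont (level t e) s"
  unfolding continuous_at_real_range
proof (intro allI impI)
  fix d0 :: real assume d0: "0 < d0"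
  define v where "v = level t e s"
  define q where "q s v = Im (\<Phi> t (Complex s v))" for s v
  note lv = level[OF e t]
  have v: "0 < v" "v < pi" "q s v = e" using lv by (auto simp: v_def q_def)
  define d where "d = min d0 (min (v / 2) ((pi - v) / 2))"
  have d: "0 < d" "d \<le> d0" "0 < v - d" "v + d < pi" using d0 v by (auto simp: d_def min_def field_simps)
  have up: "q s (v + d) > e"
    using Im_subordination_map_strict_mono[of v "v + d" t s] v d e t by (auto simp: q_def)
  have lo: "q s (v - d) < e"
    using Im_subordination_map_strict_mono[of "v - d" v t s] v d e t unfolding q_def by force
  have "isCont (\<lambda>s. q s (v + d)) s" "isCont (\<lambda>s. q s (v - d)) s"
    unfolding q_def using v d by (intro continuous_Im_subordination_map; simp)+
  then have "\<forall>\<^sub>F x in at s. q x (v + d) > e" "\<forall>\<^sub>F x in at s. q x (v - d) < e"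
    using up lo unfolding isCont_def by (auto intro: order_tendstoD)
  then have "\<forall>\<^sub>F x in at s. q x (v + d) > e \<and> q x (v - d) < e" by eventually_elim auto
  then obtain r where r: "r > 0" "\<And>x. x \<noteq> s \<Longrightarrow> dist x s < r \<Longrightarrow> q x (v + d) > e \<and> q x (v - d) < e"
    unfolding eventually_at by auto
  have "\<bar>level t e x - level t e s\<bar> < d0" if x: "\<bar>x - s\<bar> < r" for x
  proof (cases "x = s")
    case False
    then have qx: "q x (v + d) > e" "q x (v - d) < e" using r x by (auto simp: dist_real_def)
    note lx = lv[of x]
    have "level t e x < v + d"
    proof (rule ccontr)
      assume "\<not> ?thesis"
      then have "v + d = level t e x \<or> q x (v + d) < q x (level t e x)"
        unfolding q_def using Im_subordination_map_strict_mono[of "v + d" "level t e x" t x] qx v d e t lx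
        by (force simp: q_def)
      then show False using qx lx by (auto simp: q_def)
    qed
    moreover have "v - d < level t e x"
    proof (rule ccontr)
      assume "\<not> ?thesis"
      then have "v - d = level t e x \<or> q x (level t e x) < q x (v - d)"
        unfolding q_def using Im_subordination_map_strict_mono[of "level t e x" "v - d" t x] qx v d e t lx
        by (force simp: q_def)
      then show False using qx lx by (auto simp: q_def)
    qed
    ultimately show ?thesis using d by (auto simp: v_def)
  qed (use d0 in simp)
  then show "\<exists>r>0. \<forall>x. norm (x - s) < r \<longrightarrow> \<bar>level t e x - level t e s\<bar> < d0"
    using r(1) by auto
qed

text \<open>Along a level curve of \<open>Im \<circ> \<Phi>\<close> the increments of \<open>\<Phi>\<close> are real, so \<open>Re \<circ> \<Phi>\<close> has derivative
  \<open>1 / Re (1 / \<Phi>')\<close> with respect to the real part.\<close>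

lemma level_curve_DERIV:
  assumes e: "0 < e" "e < pi" and t: "0 < t"
  shows "\<exists>d>0. ((\<lambda>s. Re (\<Phi> t (Complex s (level t e s)))) has_real_derivative d) (at s0)"
proof -
  define W where "W s = Complex s (level t e s)" for s
  define X where "X s = Re (\<Phi> t (W s))" for s
  define c where "c = deriv (\<Phi> t) (W s0)"
  note lv = level[OF e t]
  have W0: "0 < Im (W s0)" "Im (W s0) < pi" using lv by (auto simp: W_def)
  have "(\<Phi> t has_field_derivative c) (at (W s0))"
    unfolding c_def using W0 by (intro subordination_map_deriv) auto
  \<comment> \<open>Caratheodory's form factors the increments exactly, so continuity of
    \<open>level\<close> is enough; its differentiability is not known at this point.\<close>
  then obtain g where g: "\<And>w. \<Phi> t w - \<Phi> t (W s0) = g w * (w - W s0)"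
    and gc: "isCont g (W s0)" "g (W s0) = c"
    unfolding CARAT_DERIV by blast
  have "0 < Im (W s0) * Re c"
    using Im_subordination_map_le_deriv[OF W0, of t] lv(3)[of s0] e t by (simp add: c_def W_def)
  then have Rec: "Re c > 0" using W0 by (simp add: zero_less_mult_iff)
  then have c0: "c \<noteq> 0" by auto
  have Rinv: "Re (1 / c) > 0" using Rec c0 by (simp add: Re_divide cmod_power2[symmetric])
  have contW: "isCont W s0"
    unfolding W_def Complex_eq by (intro continuous_intros isCont_level e t)
  have gW: "((\<lambda>s. g (W s)) \<longlongrightarrow> c) (at s0)"
    using isCont_o2[OF contW gc(1)] gc(2) by (simp add: isCont_def)
  have real_incr: "of_real (X s - X s0) = g (W s) * (W s - W s0)" for s
    using g[of "W s"] lv(3) by (simp add: X_def complex_eq_iff W_def)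
  have ev: "\<forall>\<^sub>F s in at s0. 1 / Re (1 / g (W s)) = (X s - X s0) / (s - s0)"
  proof -
    have "\<forall>\<^sub>F s in at s0. g (W s) \<noteq> 0" using gW c0 by (rule tendsto_imp_eventually_ne)
    moreover have "\<forall>\<^sub>F s in at s0. s \<noteq> s0" by (simp add: eventually_at_filter)
    ultimately show ?thesis
    proof eventually_elim
      case (elim s)
      have "W s - W s0 = of_real (X s - X s0) * (1 / g (W s))"
        using real_incr[of s] elim by simp
      then have "Re (W s - W s0) = Re (of_real (X s - X s0) * (1 / g (W s)))"
        by (rule arg_cong)
      moreover have "Re (of_real r * z) = r * Re z" for r z by simp
      ultimately have d: "s - s0 = (X s - X s0) * Re (1 / g (W s))"
        by (simp only: W_def minus_complex.sel complex.sel)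
      then have "X s - X s0 \<noteq> 0" using elim by auto
      then show ?case unfolding d by simp
    qed
  qed
  have "((\<lambda>s. 1 / Re (1 / g (W s))) \<longlongrightarrow> 1 / Re (1 / c)) (at s0)"
    using gW c0 Rinv by (intro tendsto_intros) auto
  then have "((\<lambda>s. (X s - X s0) / (s - s0)) \<longlongrightarrow> 1 / Re (1 / c)) (at s0)"
    by (rule Lim_transform_eventually[OF _ ev])
  then have "(X has_real_derivative 1 / Re (1 / c)) (at s0)"
    by (simp add: has_field_derivative_iff)
  then show ?thesis using Rinv unfolding X_def W_def by (intro exI[of _ "1 / Re (1 / c)"]) auto
qed

lemma level_curve_strict_mono:
  assumes e: "0 < e" "e < pi" and t: "0 < t" and s: "s < s'"
  shows "Re (\<Phi> t (Complex s (level t e s))) < Re (\<Phi> t (Complex s' (level t e s')))"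
  using level_curve_DERIV[OF e t] by (intro DERIV_pos_imp_increasing[OF s]) blast

text \<open>The real part moves by at most \<open>r\<close> along \<open>\<Phi>\<close>, so the
  interval of radius \<open>r\<close> around \<open>x\<close> brackets the value
  \<open>x\<close>.\<close>

lemma level_curve_surj:
  assumes e: "0 < e" "e < pi" and t: "0 < t"
  shows "\<exists>s. Re (\<Phi> t (Complex s (level t e s))) = x"
proof -
  define X where "X s = Re (\<Phi> t (Complex s (level t e s)))" for s
  define r where "r = sqrt (t + t\<^sup>2 / 4)"
  have r: "r \<ge> 0" using t by (simp add: r_def)
  have X: "\<bar>X s - s\<bar> \<le> r" for s
    using Re_subordination_map_bound[of "Complex s (level t e s)" t] level[OF e t, of s] e t
    by (simp add: X_def r_def)
  have "\<exists>s\<ge>x - r. s \<le> x + r \<and> X s = x"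
  proof (rule IVT)
    show "\<forall>s. x - r \<le> s \<and> s \<le> x + r \<longrightarrow> isCont X s"
      using level_curve_DERIV[OF e t] DERIV_isCont unfolding X_def by blast
  qed (use X[of "x - r"] X[of "x + r"] r in auto)
  then show ?thesis unfolding X_def by auto
qed

end

section \<open>Behaviour at infinity\<close>

lemma norm_coth_half_minus_one_le:
  assumes "0 < Re z"
  shows "cmod (coth_half z - 1) \<le> 2 / (exp (Re z) - 1)"
proof -
  have e: "1 < exp (Re z)" using assms by simp
  have n: "exp (Re z) - 1 \<le> cmod (exp z - 1)"
    using norm_triangle_ineq2[of "exp z" 1] by simp
  then have ne: "exp z - 1 \<noteq> 0" using e by auto
  have "coth_half z - 1 = 2 / (exp z - 1)"
    using ne by (simp add: coth_half_def divide_simps)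
  then have "cmod (coth_half z - 1) = 2 / cmod (exp z - 1)" by (simp add: norm_divide)
  also have "\<dots> \<le> 2 / (exp (Re z) - 1)" using n e by (intro divide_left_mono) (auto simp: ne intro!: mult_pos_pos)
  finally show ?thesis .
qed

lemma coth_half_minus: "coth_half (- z) = - coth_half z"
proof (cases "exp z = 1")
  case True
  then show ?thesis by (simp add: coth_half_def exp_minus)
next
  case False
  have "exp z \<noteq> 0" by simp
  then show ?thesis using False
    by (simp add: coth_half_def exp_minus divide_simps) (auto simp: algebra_simps)
qed

text \<open>The sign \<open>s\<close> treats both ends of the strip at once, here and in all later
  estimates at infinity.\<close>

lemma norm_coth_half_minus_sign_le:
  assumes s: "s = 1 \<or> s = - 1" and z: "0 < s * Re z"
  shows "cmod (coth_half z - of_real s) \<le> 2 / (exp (s * Re z) - 1)"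
  using s
proof
  assume "s = - 1"
  moreover have "cmod (coth_half z + 1) = cmod (coth_half (- z) - 1)"
    unfolding coth_half_minus by (metis minus_add_distrib norm_minus_cancel uminus_add_conv_diff add.commute)
  ultimately show ?thesis using norm_coth_half_minus_one_le[of "- z"] z by simp
qed (use norm_coth_half_minus_one_le[of z] z in simp)

context real_distribution
begin

text \<open>Bounded support keeps \<open>z - y\<close> far out as soon as \<open>z\<close> is. The
  bound is uniform in \<open>Im z\<close>, as the vertical sides of the contours require.\<close>

lemma coth_transform_at_infinity:
  assumes z: "0 < Im z" "Im z < 2 * pi" and B: "AE y in M. \<bar>y\<bar> \<le> B"
    and s: "s = 1 \<or> s = - 1" and Re: "B < s * Re z"
  shows "cmod (coth_transform M z - of_real s) \<le> 2 / (exp (s * Re z - B) - 1)" (is "_ \<le> ?b")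
proof -
  have i: "integrable M (\<lambda>y. coth_half (z - of_real y) - of_real s)"
    by (intro Bochner_Integration.integrable_diff integrable_coth_half z) simp
  have "coth_transform M z - of_real s = (LINT y|M. coth_half (z - of_real y) - of_real s)"
    unfolding coth_transform_def using integrable_coth_half[OF z]
    by (subst Bochner_Integration.integral_diff) (auto simp: prob_UNIV)
  also have "cmod \<dots> \<le> (LINT y|M. cmod (coth_half (z - of_real y) - of_real s))"
    by (rule integral_norm_bound)
  also have "\<dots> \<le> (LINT y|M. ?b)"
  proof (rule integral_mono_AE)
    show "AE y in M. cmod (coth_half (z - of_real y) - of_real s) \<le> ?b"
      using B
    proof eventually_elim
      case (elim y)
      have y: "s * Re z - B \<le> s * Re (z - of_real y)"
        using s elim by (auto simp: algebra_simps)
      have "cmod (coth_half (z - of_real y) - of_real s) \<le> 2 / (exp (s * Re (z - of_real y)) - 1)"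
        using y Re by (intro norm_coth_half_minus_sign_le s) linarith
      also have "\<dots> \<le> ?b"
      proof -
        have "exp (s * Re z - B) \<le> exp (s * Re (z - of_real y))" using y by (simp only: exp_le_cancel_iff)
        moreover have "1 < exp (s * Re z - B)" using Re by simp
        ultimately show ?thesis by (intro divide_left_mono mult_pos_pos) linarith+
      qed
      finally show ?case .
    qed
  qed (use i in auto)
  also have "\<dots> = ?b" by (simp add: prob_UNIV)
  finally show ?thesis .
qed

section \<open>Invertibility of the subordination map\<close>

lemma Im_subordination_map_less_pi:
  assumes t: "0 < t" and w: "0 < Im w" "Im w < 2 * pi"
  shows "Im (\<Phi> t w) < pi \<longleftrightarrow> Im w < pi"
    and "Im (\<Phi> t w) = pi \<longleftrightarrow> Im w = pi"
proof -
  have 1: "Im (\<Phi> t w) < pi" if "0 < Im w" "Im w < pi" for w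
    using Im_subordination_map_less[OF that t] that by simp
  have 2: "Im (\<Phi> t w) = pi" if "Im w = pi" for w
    using subordination_map_pi[of t "Re w"] that by (metis complex.sel(2) complex_surj)
  have 3: "Im (\<Phi> t w) > pi" if "pi < Im w" "Im w < 2 * pi" for w
    using 1[of "strip_reflect w"] subordination_map_reflect[of w t] that by simp
  show "Im (\<Phi> t w) < pi \<longleftrightarrow> Im w < pi"
    and "Im (\<Phi> t w) = pi \<longleftrightarrow> Im w = pi"
    using 1[of w] 2[of w] 3[of w] w by (cases "Im w" pi rule: linorder_cases; force)+
qed

lemma Re_subordination_map_bound':
  assumes t: "0 < t" and w: "0 < Im w" "Im w < 2 * pi"
    and Pw: "0 < Im (\<Phi> t w)" "Im (\<Phi> t w) < 2 * pi"
  shows "\<bar>Re (\<Phi> t w) - Re w\<bar> \<le> sqrt (t + t\<^sup>2 / 4)"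
proof (cases "Im w" pi rule: linorder_cases)
  case less
  then show ?thesis using Re_subordination_map_bound[of w t] assms by simp
next
  case equal
  have "\<Phi> t w = Complex (Re w + t / 2 * tanh_transform M (Re w)) pi"
    using subordination_map_pi[of t "Re w"] equal by (metis complex_surj)
  then have "\<bar>Re (\<Phi> t w) - Re w\<bar> = t / 2 * \<bar>tanh_transform M (Re w)\<bar>"
    using t by (simp add: abs_mult)
  also have "\<dots> \<le> t / 2" using abs_tanh_transform_le t by (simp add: mult_left_le)
  also have "\<dots> \<le> sqrt (t + t\<^sup>2 / 4)"
    using t by (intro real_le_rsqrt) (simp add: power_divide)
  finally show ?thesis .
next
  case greater
  then show ?thesis
    using Re_subordination_map_bound[of "strip_reflect w" t] assms subordination_map_reflect[of w t] by simp
qed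

lemma strict_mono_subordination_map_pi:
  assumes "0 < t" "b < b'"
  shows "b + t / 2 * tanh_transform M b < b' + t / 2 * tanh_transform M b'"
  using tanh_transform_mono[of b b'] assms by (intro add_less_le_mono mult_left_mono) auto

lemma isCont_tanh_transform: "isCont (tanh_transform M) a"
proof -
  have "isCont (coth_transform M) (Complex a pi)"
    using has_field_derivative_coth_transform[of "Complex a pi"] DERIV_isCont by fastforce
  moreover have "isCont (\<lambda>a. Complex a pi) a"
    unfolding Complex_eq by (intro continuous_intros)
  ultimately have "isCont (\<lambda>a. coth_transform M (Complex a pi)) a"
    by (rule isCont_o2[rotated])
  then have "isCont (\<lambda>a. Re (coth_transform M (Complex a pi))) a" by (rule isCont_Re)
  then show ?thesis by (simp add: coth_transform_pi)
qed

text \<open>Points below \<open>Im = pi\<close> with equal images lie on one level line, along which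
  \<open>Re \<circ> \<Phi>\<close> is strictly increasing. The line \<open>Im = pi\<close> is
  treated by monotonicity of the tanh transform and the upper half by reflection.\<close>

lemma subordination_map_inj:
  assumes t: "0 < t"
    and w: "0 < Im w" "Im w < 2 * pi" and w': "0 < Im w'" "Im w' < 2 * pi"
    and P: "0 < Im (\<Phi> t w)" "Im (\<Phi> t w) < 2 * pi"
    and eq: "\<Phi> t w = \<Phi> t w'"
  shows "w = w'"
proof -
  have lower: "w = w'" if w: "0 < Im w" "Im w < pi" and w': "0 < Im w'" "Im w' < pi"
    and P: "0 < Im (\<Phi> t w)"
    and eq: "\<Phi> t w = \<Phi> t w'" for w w'
  proof -
    define e where "e = Im (\<Phi> t w)"
    have e: "0 < e" "e < pi" using P Im_subordination_map_less[OF w t] w by (auto simp: e_def)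
    have "Im w = level t e (Re w)" "Im w' = level t e (Re w')"
      using w w' eq level_unique[OF e t, where v = "Im w" and s = "Re w"]
        level_unique[OF e t, where v = "Im w'" and s = "Re w'"] by (auto simp: e_def)
    then have W: "w = Complex (Re w) (level t e (Re w))" "w' = Complex (Re w') (level t e (Re w'))"
      by (simp_all add: complex_eq_iff)
    have "Re w = Re w'"
      using level_curve_strict_mono[OF e t, of "Re w" "Re w'"] level_curve_strict_mono[OF e t, of "Re w'" "Re w"]
        eq W by (cases "Re w" "Re w'" rule: linorder_cases) auto
    then show ?thesis using W by simp
  qed
  show ?thesis
  proof (cases "Im w" pi rule: linorder_cases)
    case less
    then have "Im w' < pi" using Im_subordination_map_less_pi(1)[OF t] w w' eq by metis
    then show ?thesis using lower[of w w'] less w w' P eq by simp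
  next
    case equal
    then have eq': "Im w' = pi" using Im_subordination_map_less_pi(2)[OF t] w w' eq by metis
    have W: "w = Complex (Re w) pi" "w' = Complex (Re w') pi" using equal eq' by (simp_all add: complex_eq_iff)
    then have "Re w + t / 2 * tanh_transform M (Re w) = Re w' + t / 2 * tanh_transform M (Re w')"
      using eq subordination_map_pi by (metis complex.sel(1))
    then have "Re w = Re w'"
      using strict_mono_subordination_map_pi[OF t, of "Re w" "Re w'"]
        strict_mono_subordination_map_pi[OF t, of "Re w'" "Re w"]
      by (cases "Re w" "Re w'" rule: linorder_cases) auto
    then show ?thesis using W by simp
  next
    case greater
    have "Im (\<Phi> t w) > pi"
      using Im_subordination_map_less_pi[OF t w] greater by linarith
    then have "Im w' > pi" using Im_subordination_map_less_pi[OF t w'] eq by auto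
    have "strip_reflect w = strip_reflect w'"
    proof (rule lower)
      show "\<Phi> t (strip_reflect w) = \<Phi> t (strip_reflect w')"
        unfolding subordination_map_reflect[OF w] subordination_map_reflect[OF w'] eq ..
      show "0 < Im (\<Phi> t (strip_reflect w))"
        unfolding subordination_map_reflect[OF w] using P by simp
    qed (use w w' greater \<open>Im w' > pi\<close> in simp_all)
    then show ?thesis by simp
  qed
qed

lemma subordination_map_surj:
  assumes t: "0 < t" and z: "0 < Im z" "Im z < 2 * pi"
  shows "\<exists>w. 0 < Im w \<and> Im w < 2 * pi \<and> \<Phi> t w = z"
proof -
  have lower: "\<exists>w. 0 < Im w \<and> Im w < 2 * pi \<and> \<Phi> t w = z" if z: "0 < Im z" "Im z < pi" for z
  proof -
    obtain s where s: "Re (\<Phi> t (Complex s (level t (Im z) s))) = Re z"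
      using level_curve_surj[OF z t] by blast
    note l = level[OF z t, of s]
    have "\<Phi> t (Complex s (level t (Im z) s)) = z"
      using s l by (simp add: complex_eq_iff)
    then show ?thesis using l by (intro exI[of _ "Complex s (level t (Im z) s)"]) auto
  qed
  show ?thesis
  proof (cases "Im z" pi rule: linorder_cases)
    case less
    then show ?thesis using lower z by blast
  next
    case equal
    have "\<exists>b\<ge>Re z - t / 2. b \<le> Re z + t / 2 \<and> b + t / 2 * tanh_transform M b = Re z"
    proof (rule IVT)
      have "t / 2 * tanh_transform M b \<le> t / 2 * 1" "t / 2 * (- 1) \<le> t / 2 * tanh_transform M b" for b
        using abs_tanh_transform_le[of b] t by (intro mult_left_mono; simp add: abs_le_iff)+
      then show "Re z - t / 2 + t / 2 * tanh_transform M (Re z - t / 2) \<le> Re z"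
        "Re z \<le> Re z + t / 2 + t / 2 * tanh_transform M (Re z + t / 2)"
        by (smt (verit))+
    qed (use t in \<open>auto intro!: continuous_intros isCont_tanh_transform\<close>)
    then obtain b where "b + t / 2 * tanh_transform M b = Re z" by blast
    then have "\<Phi> t (Complex b pi) = z"
      using equal by (simp add: subordination_map_pi complex_eq_iff)
    then show ?thesis by (intro exI[of _ "Complex b pi"]) auto
  next
    case greater
    then obtain w where w: "0 < Im w" "Im w < 2 * pi" "\<Phi> t w = strip_reflect z"
      using lower[of "strip_reflect z"] z by auto
    then show ?thesis
      using subordination_map_reflect[OF w(1,2), of t] by (intro exI[of _ "strip_reflect w"]) auto
  qed
qed

lemma holomorphic_subordination_map: "\<Phi> t holomorphic_on strip"
  unfolding subordination_map_def[abs_def]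
  by (intro holomorphic_intros holomorphic_coth_transform)

lemma open_subordination_domain: "open {w \<in> strip. \<Phi> t w \<in> strip}"
proof -
  have "{w \<in> strip. \<Phi> t w \<in> strip} = strip \<inter> \<Phi> t -` strip" by auto
  then show ?thesis
    using holomorphic_on_imp_continuous_on[OF holomorphic_subordination_map, of t] open_strip
    by (simp only:) (rule continuous_open_preimage)
qed

text \<open>The inverse \<open>\<omega>\<close> of \<open>\<Phi>\<close> is the subordination
  function of free probability: composing the transform of the given law with it yields the
  transform of the convolution.\<close>

lemma subordination_function:
  assumes t: "0 < t"
  obtains \<omega> where "\<omega> holomorphic_on strip"
    "\<And>z. z \<in> strip \<Longrightarrow> \<omega> z \<in> strip" "\<And>z. z \<in> strip \<Longrightarrow> \<Phi> t (\<omega> z) = z"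
    "\<And>w. w \<in> strip \<Longrightarrow> \<Phi> t w \<in> strip \<Longrightarrow> \<omega> (\<Phi> t w) = w"
proof -
  define D where "D = {w \<in> strip. \<Phi> t w \<in> strip}"
  have hol: "\<Phi> t holomorphic_on D"
    using holomorphic_subordination_map by (rule holomorphic_on_subset) (auto simp: D_def)
  have inj: "inj_on (\<Phi> t) D"
    using subordination_map_inj[OF t] by (intro inj_onI) (auto simp: D_def)
  obtain g where g: "g holomorphic_on \<Phi> t ` D" "\<And>w. w \<in> D \<Longrightarrow> g (\<Phi> t w) = w"
    by (rule holomorphic_has_inverse[OF hol _ inj]) (auto simp only: D_def open_subordination_domain)
  have im: "z \<in> \<Phi> t ` D" if "z \<in> strip" for z
    using subordination_map_surj[OF t, of z] that by (auto simp: D_def image_iff)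
  show ?thesis
  proof (rule that[of g])
    show "g holomorphic_on strip" using g(1) im by (auto intro: holomorphic_on_subset)
    show "g z \<in> strip" "\<Phi> t (g z) = z" if "z \<in> strip" for z
      using im[OF that] g(2) by (auto simp: D_def)
    show "g (\<Phi> t w) = w" if "w \<in> strip" "\<Phi> t w \<in> strip" for w
      using g(2) that by (simp add: D_def)
  qed
qed

text \<open>\<open>F = coth_transform M \<circ> \<omega>\<close> is the candidate transform of the
  convolution. Since \<open>\<omega>\<close> moves real parts by at most \<open>r\<close>, the
  behaviour at infinity persists with \<open>K = B + r\<close>.\<close>

lemma subordinated_transform:
  assumes t: "0 < t" and B: "AE y in M. \<bar>y\<bar> \<le> B"
  obtains F K where "F holomorphic_on strip"
    "\<And>z. z \<in> strip \<Longrightarrow> F (strip_reflect z) = cnj (F z)"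
    "\<And>z. 0 < Im z \<Longrightarrow> Im z < pi \<Longrightarrow> Im (F z) \<le> 0"
    "\<And>z s. z \<in> strip \<Longrightarrow> s = 1 \<or> s = - 1 \<Longrightarrow> K < s * Re z \<Longrightarrow>
      cmod (F z - of_real s) \<le> 2 / (exp (s * Re z - K) - 1)"
    "\<And>b. F (Complex (b + t / 2 * tanh_transform M b) pi) = of_real (tanh_transform M b)"
proof -
  obtain \<omega> where \<omega>: "\<omega> holomorphic_on strip"
    "\<And>z. z \<in> strip \<Longrightarrow> \<omega> z \<in> strip" "\<And>z. z \<in> strip \<Longrightarrow> \<Phi> t (\<omega> z) = z"
    "\<And>w. w \<in> strip \<Longrightarrow> \<Phi> t w \<in> strip \<Longrightarrow> \<omega> (\<Phi> t w) = w"
    by (rule subordination_function[OF t]) blast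
  define r where "r = sqrt (t + t\<^sup>2 / 4)"
  define F where "F = coth_transform M \<circ> \<omega>"
  have Re: "\<bar>Re z - Re (\<omega> z)\<bar> \<le> r" if "z \<in> strip" for z
    using Re_subordination_map_bound'[OF t, of "\<omega> z"] \<omega>(2,3)[OF that] that by (simp add: r_def)
  show ?thesis
  proof (rule that[of F "B + r"])
    show "F holomorphic_on strip"
      unfolding F_def using \<omega>(2) by (intro holomorphic_on_compose_gen[OF \<omega>(1) holomorphic_coth_transform]) auto
    show "F (strip_reflect z) = cnj (F z)" if z: "z \<in> strip" for z
    proof -
      have "\<Phi> t (strip_reflect (\<omega> z)) = strip_reflect z"
        using subordination_map_reflect[of "\<omega> z" t] \<omega>(2,3)[OF z] by simp
      then have "\<omega> (strip_reflect z) = strip_reflect (\<omega> z)"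
        using \<omega>(4)[of "strip_reflect (\<omega> z)"] \<omega>(2)[OF z] z by simp
      then show ?thesis using coth_transform_reflect[of "\<omega> z"] \<omega>(2)[OF z] by (simp add: F_def)
    qed
    show "Im (F z) \<le> 0" if "0 < Im z" "Im z < pi" for z
    proof -
      have z: "z \<in> strip" using that by simp
      have "Im (\<omega> z) < pi" using Im_subordination_map_less_pi(1)[OF t, of "\<omega> z"] \<omega>(2,3)[OF z] that by simp
      then show ?thesis using Im_coth_transform_neg[of "\<omega> z"] \<omega>(2)[OF z] by (simp add: F_def)
    qed
    show "cmod (F z - of_real s) \<le> 2 / (exp (s * Re z - (B + r)) - 1)"
      if z: "z \<in> strip" and s: "s = 1 \<or> s = - 1" and "B + r < s * Re z" for z s
    proof -
      have \<omega>z: "s * Re z - (B + r) \<le> s * Re (\<omega> z) - B" using Re[OF z] s by auto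
      then have "cmod (F z - of_real s) \<le> 2 / (exp (s * Re (\<omega> z) - B) - 1)"
        unfolding F_def comp_def using \<omega>(2)[OF z] that(3) by (intro coth_transform_at_infinity B s) auto
      also have "\<dots> \<le> 2 / (exp (s * Re z - (B + r)) - 1)"
        using \<omega>z that(3) by (intro divide_left_mono mult_pos_pos) auto
      finally show ?thesis .
    qed
    show "F (Complex (b + t / 2 * tanh_transform M b) pi) = of_real (tanh_transform M b)" for b
    proof -
      have "\<omega> (\<Phi> t (Complex b pi)) = Complex b pi"
        by (rule \<omega>(4)) (auto simp: subordination_map_pi)
      then show ?thesis by (simp add: F_def subordination_map_pi coth_transform_pi)
    qed
  qed
qed

end

section \<open>Herglotz representation on the strip\<close>

lemma contour_integral_linepath_same_Im:
  assumes "a < b"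
  shows "contour_integral (linepath (Complex a c) (Complex b c)) f = integral {a..b} (\<lambda>x. f (Complex x c))"
proof -
  have "contour_integral (linepath (Complex a c) (Complex b c)) f =
      (Complex b c - Complex a c) * integral {0..1} (\<lambda>x. f (linepath (Complex a c) (Complex b c) x))"
    by (simp add: contour_integral_integral)
  also have "Complex b c - Complex a c = of_real (b - a)"
    by (simp add: complex_eq_iff)
  also have "integral {0..1} (\<lambda>x. f (linepath (Complex a c) (Complex b c) x)) =
      integral {0..1} (\<lambda>x. f (Complex (a + (b - a) * x) c))"
  proof (intro integral_cong arg_cong[of _ _ f])
    show "linepath (Complex a c) (Complex b c) x = Complex (a + (b - a) * x) c" for x
      by (simp add: linepath_def complex_eq_iff algebra_simps)
  qed
  also have "{0..1} = (\<lambda>x. x / (b - a)) ` {0..b - a}"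
    using assms by simp
  also have "integral \<dots> (\<lambda>x. f (Complex (a + (b - a) * x) c)) =
      integral {a-a..b-a} (\<lambda>x. f (Complex (x + a) c)) / of_real (b - a)"
    using assms by (subst integral_stretch_real) (auto simp: scaleR_conv_of_real add_ac)
  also have "\<dots> = integral {a..b} (\<lambda>x. f (Complex x c)) / of_real (b - a)"
    by (subst integral_shift_real_ivl) simp_all
  finally show ?thesis using assms by simp
qed

text \<open>The horizontal sides of a rectangle that is symmetric about \<open>Im z = pi\<close> combine to twice the
  integral of the imaginary part.\<close>

lemma symmetric_rectangle_limit:
  fixes f :: "complex \<Rightarrow> complex" and e :: real
  assumes e: "0 < e" "e < pi" and c: "Im c = pi"
    and cont: "continuous_on (strip - {c}) f"
    and sym: "\<And>z. z \<in> strip \<Longrightarrow> z \<noteq> c \<Longrightarrow> f (strip_reflect z) = cnj (f z)"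
    and I: "\<And>n::nat. n > N \<Longrightarrow> contour_integral (rectpath (Complex (- real n) e) (Complex (real n) (2 * pi - e))) f = I"
    and right: "\<And>(n::nat) y. n > N \<Longrightarrow> e \<le> y \<Longrightarrow> y \<le> 2 * pi - e \<Longrightarrow> cmod (f (Complex (real n) y) - l1) \<le> E n"
    and left: "\<And>(n::nat) y. n > N \<Longrightarrow> e \<le> y \<Longrightarrow> y \<le> 2 * pi - e \<Longrightarrow> cmod (f (Complex (- real n) y) - l2) \<le> E n"
    and N: "\<bar>Re c\<bar> < real N"
    and E: "E \<longlonglongrightarrow> 0"
  shows "(\<lambda>n. integral {- real n..real n} (\<lambda>x. Im (f (Complex x e)))) \<longlonglongrightarrow> Re (I / (2 * \<i>) - (l1 - l2) * of_real (pi - e))"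
proof -
  have contC: "continuous_on A (\<lambda>x. f (Complex (p x) (q x)))"
    if "continuous_on A p" "continuous_on A q" "\<And>x. x \<in> A \<Longrightarrow> 0 < q x \<and> q x < 2 * pi \<and> Complex (p x) (q x) \<noteq> c"
    for A :: "real set" and p q :: "real \<Rightarrow> real"
    by (rule continuous_on_compose2[OF cont]) (use that in \<open>auto simp: Complex_eq intro!: continuous_intros\<close>)
  define S1 where "S1 n = integral {e..2 * pi - e} (\<lambda>y. f (Complex (real n) y))" for n
  define S2 where "S2 n = integral {e..2 * pi - e} (\<lambda>y. f (Complex (- real n) y))" for n
  define J where "J n = integral {- real n..real n} (\<lambda>x. Im (f (Complex x e)))" for n
  have main: "of_real (J n) = I / (2 * \<i>) - (S1 n - S2 n) / 2" if n: "n > N" for n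
  proof -
    define R where "R = real n"
    have R: "R > 0" using n by (simp add: R_def)
    have Rc: "\<bar>Re c\<bar> < R" using n N by (simp add: R_def)
    define a1 a3 where "a1 = Complex (- R) e" and "a3 = Complex R (2 * pi - e)"
    have c0: "Complex x e \<noteq> c" "Complex x (2 * pi - e) \<noteq> c" for x using e c by auto
    have sub: "path_image (rectpath a1 a3) \<subseteq> strip - {c}"
    proof
      fix z assume "z \<in> path_image (rectpath a1 a3)"
      then have z: "z \<in> cbox a1 a3" "z \<notin> box a1 a3" using R e
        by (auto simp: path_image_rectpath_cbox_minus_box a1_def a3_def)
      have "c \<in> box a1 a3" using Rc e c by (auto simp: in_box_complex_iff a1_def a3_def abs_less_iff)
      then show "z \<in> strip - {c}" using z e by (auto simp: in_cbox_complex_iff a1_def a3_def)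
    qed
    define a2 a4 where "a2 = Complex R e" and "a4 = Complex (- R) (2 * pi - e)"
    have rp: "rectpath a1 a3 = linepath a1 a2 +++ linepath a2 a3 +++ linepath a3 a4 +++ linepath a4 a1"
      by (simp add: rectpath_def Let_def a1_def a2_def a3_def a4_def)
    have segs: "closed_segment a1 a2 \<subseteq> strip - {c}" "closed_segment a2 a3 \<subseteq> strip - {c}"
      "closed_segment a3 a4 \<subseteq> strip - {c}" "closed_segment a4 a1 \<subseteq> strip - {c}"
      using sub unfolding rp by (simp_all add: path_image_join)
    have ci: "f contour_integrable_on (linepath a1 a2)" "f contour_integrable_on (linepath a2 a3)"
      "f contour_integrable_on (linepath a3 a4)" "f contour_integrable_on (linepath a4 a1)"
      using segs by (auto intro!: contour_integrable_continuous_linepath continuous_on_subset[OF cont])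
    have "I = contour_integral (rectpath a1 a3) f"
      using I[OF n] by (simp add: a1_def a3_def R_def)
    also have "\<dots> = contour_integral (linepath a1 a2) f + (contour_integral (linepath a2 a3) f +
        (contour_integral (linepath a3 a4) f + contour_integral (linepath a4 a1) f))"
      unfolding rp using ci by (simp add: contour_integrable_joinI)
    also have "contour_integral (linepath a3 a4) f = - contour_integral (linepath a4 a3) f"
      by (rule contour_integral_reverse_linepath)
         (use segs in \<open>auto intro!: continuous_on_subset[OF cont] simp: closed_segment_commute\<close>)
    also have "contour_integral (linepath a4 a1) f = - contour_integral (linepath a1 a4) f"
      by (rule contour_integral_reverse_linepath)
         (use segs in \<open>auto intro!: continuous_on_subset[OF cont] simp: closed_segment_commute\<close>)
    also have "contour_integral (linepath a1 a2) f = integral {- R..R} (\<lambda>x. f (Complex x e))"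
      unfolding a1_def a2_def using R by (intro contour_integral_linepath_same_Im) auto
    also have "contour_integral (linepath a4 a3) f = integral {- R..R} (\<lambda>x. f (Complex x (2 * pi - e)))"
      unfolding a3_def a4_def using R by (intro contour_integral_linepath_same_Im) auto
    also have "contour_integral (linepath a2 a3) f = \<i> * S1 n"
      unfolding a2_def a3_def S1_def R_def[symmetric] using e by (intro contour_integral_linepath_same_Re) auto
    also have "contour_integral (linepath a1 a4) f = \<i> * S2 n"
      unfolding a1_def a4_def S2_def R_def[symmetric] using e by (intro contour_integral_linepath_same_Re) auto
    finally have I': "I = integral {- R..R} (\<lambda>x. f (Complex x e)) - integral {- R..R} (\<lambda>x. f (Complex x (2 * pi - e)))
        + \<i> * (S1 n - S2 n)" by (simp add: algebra_simps)
    have int: "(\<lambda>x. f (Complex x e)) integrable_on {- R..R}" "(\<lambda>x. f (Complex x (2 * pi - e))) integrable_on {- R..R}"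
      using e c0 by (intro integrable_continuous_real contC; simp)+
    have "integral {- R..R} (\<lambda>x. f (Complex x e)) - integral {- R..R} (\<lambda>x. f (Complex x (2 * pi - e))) =
        integral {- R..R} (\<lambda>x. f (Complex x e) - f (Complex x (2 * pi - e)))"
      using int by (simp add: integral_diff)
    also have "\<dots> = integral {- R..R} (\<lambda>x. 2 * \<i> * of_real (Im (f (Complex x e))))"
    proof (rule integral_cong)
      fix x
      have "f (Complex x (2 * pi - e)) = cnj (f (Complex x e))"
        using sym[of "Complex x e"] c0 e by (simp add: strip_reflect_def)
      then show "f (Complex x e) - f (Complex x (2 * pi - e)) = 2 * \<i> * of_real (Im (f (Complex x e)))"
        by (simp add: complex_eq_iff)
    qed
    also have "\<dots> = 2 * \<i> * integral {- R..R} (\<lambda>x. of_real (Im (f (Complex x e))))"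
      by (rule integral_mult_right)
    also have "integral {- R..R} (\<lambda>x. complex_of_real (Im (f (Complex x e)))) = of_real (J n)"
    proof -
      have "(\<lambda>x. Im (f (Complex x e))) integrable_on {- R..R}"
        using integrable_linear[OF int(1) bounded_linear_Im] by (simp add: comp_def)
      from integral_linear[OF this bounded_linear_of_real[where ?'a = complex]]
      show ?thesis by (simp add: comp_def J_def R_def)
    qed
    finally have J: "I = 2 * \<i> * of_real (J n) + \<i> * (S1 n - S2 n)" using I' by simp
    define X where "X = (S1 n - S2 n) / 2"
    have SX: "S1 n - S2 n = 2 * X" by (simp add: X_def)
    have "I = 2 * \<i> * (of_real (J n) + X)" unfolding J SX by (simp add: algebra_simps)
    then show ?thesis unfolding SX by simp
  qed
  \<comment> \<open>The vertical sides have the fixed length \<open>2 * pi - 2 * e\<close>, so a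
    uniform error \<open>E n\<close> on them suffices.\<close>
  have side: "(\<lambda>n. integral {e..2 * pi - e} (\<lambda>y. f (Complex (r n) y))) \<longlonglongrightarrow> l * of_real (2 * pi - 2 * e)"
    if b: "\<And>n y. n > N \<Longrightarrow> e \<le> y \<Longrightarrow> y \<le> 2 * pi - e \<Longrightarrow> cmod (f (Complex (r n) y) - l) \<le> E n"
      and r: "\<And>n. n > N \<Longrightarrow> r n \<noteq> Re c" for l and r :: "nat \<Rightarrow> real"
  proof (rule Lim_transform_bound[THEN LIM_zero_cancel])
    show "(\<lambda>n. E n * (2 * pi - 2 * e)) \<longlonglongrightarrow> 0" using tendsto_mult_right[OF E] by simp
    show "\<forall>\<^sub>F n in sequentially. norm (integral {e..2 * pi - e} (\<lambda>y. f (Complex (r n) y)) - l * of_real (2 * pi - 2 * e))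
        \<le> norm (E n * (2 * pi - 2 * e))"
      using eventually_gt_at_top[of N]
    proof eventually_elim
      case (elim n)
      have En: "E n \<ge> 0" using order_trans[OF norm_ge_zero b[OF elim, of e]] e by simp
      have int: "(\<lambda>y. f (Complex (r n) y)) integrable_on {e..2 * pi - e}"
        using e r[OF elim] by (intro integrable_continuous_real contC) auto
      have "integral {e..2 * pi - e} (\<lambda>y. l) = l * of_real (2 * pi - 2 * e)"
        using e by (simp add: scaleR_conv_of_real algebra_simps)
      then have "integral {e..2 * pi - e} (\<lambda>y. f (Complex (r n) y)) - l * of_real (2 * pi - 2 * e) =
          integral {e..2 * pi - e} (\<lambda>y. f (Complex (r n) y) - l)"
        using int by (simp add: integral_diff integrable_const_ivl)
      also have "norm \<dots> \<le> E n * (2 * pi - e - e)"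
        using b[OF elim] e r[OF elim] by (intro integral_bound continuous_intros contC) auto
      finally show ?case using En e by (simp add: algebra_simps)
    qed
  qed
  have "S1 \<longlonglongrightarrow> l1 * of_real (2 * pi - 2 * e)" unfolding S1_def
    using N by (intro side right) auto
  moreover have "S2 \<longlonglongrightarrow> l2 * of_real (2 * pi - 2 * e)" unfolding S2_def
    using N by (intro side left) auto
  ultimately have "(\<lambda>n. Re (I / (2 * \<i>) - (S1 n - S2 n) / 2)) \<longlonglongrightarrow>
      Re (I / (2 * \<i>) - (l1 * of_real (2 * pi - 2 * e) - l2 * of_real (2 * pi - 2 * e)) / 2)"
    by (intro tendsto_intros) auto
  also have "(l1 * of_real (2 * pi - 2 * e) - l2 * of_real (2 * pi - 2 * e)) / 2 = (l1 - l2) * of_real (pi - e)"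
    by (simp add: field_simps)
  finally have "(\<lambda>n. Re (I / (2 * \<i>) - (S1 n - S2 n) / 2)) \<longlonglongrightarrow> Re (I / (2 * \<i>) - (l1 - l2) * of_real (pi - e))" .
  moreover have "\<forall>\<^sub>F n in sequentially. Re (I / (2 * \<i>) - (S1 n - S2 n) / 2) = J n"
    using eventually_gt_at_top[of N]
  proof eventually_elim
    case (elim n)
    show ?case using main[OF elim] by (metis Re_complex_of_real)
  qed
  ultimately show ?thesis unfolding J_def by (rule Lim_transform_eventually)
qed

text \<open>The poles of \<open>coth_half (\<kappa> * (z - c))\<close> are spaced by
  \<open>2 * pi / \<kappa> \<ge> pi\<close> on the vertical line through \<open>c\<close>; as
  \<open>Im c = pi\<close>, only \<open>c\<close> itself falls into the open strip.\<close>

lemma exp_scaled_neq_one: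
  assumes k: "0 < \<kappa>" "\<kappa> \<le> 2" and c: "Im c = pi" and z: "z \<in> strip" "z \<noteq> c"
  shows "exp (of_real \<kappa> * (z - c)) \<noteq> 1"
proof
  assume "exp (of_real \<kappa> * (z - c)) = 1"
  then obtain n :: int where n: "\<kappa> * (Re z - Re c) = 0" "of_int (2 * n) * pi = \<kappa> * (Im z - pi)"
    unfolding exp_eq_1 using c by auto
  have "\<bar>of_int (2 * n) * pi\<bar> = \<kappa> * \<bar>Im z - pi\<bar>"
    unfolding n(2) abs_mult using k by simp
  also have "\<dots> \<le> 2 * \<bar>Im z - pi\<bar>" using k by (intro mult_right_mono) auto
  also have "\<dots> < 2 * pi" using z by auto
  finally have "\<bar>real_of_int n\<bar> < 1" by (simp add: abs_mult)
  then have "n = 0" by linarith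
  then have "z = c" using n k c by (simp add: complex_eq_iff)
  then show False using z by simp
qed

text \<open>The integrand has a single simple pole, at \<open>c\<close>, with residue
  \<open>F c * 2 / \<kappa>\<close>. Here \<open>d\<close> is the difference quotient of
  \<open>g\<close> with its removable singularity filled in; it has no zero in the strip, so the
  integrand is \<open>H z / (z - c)\<close> with \<open>H\<close> holomorphic and Cauchy's formula
  applies.\<close>

lemma Cauchy_coth_half_rectpath:
  fixes F :: "complex \<Rightarrow> complex" and \<kappa> e R :: real
  assumes F: "F holomorphic_on strip" and k: "0 < \<kappa>" "\<kappa> \<le> 2" and e: "0 < e" "e < pi"
    and c: "Im c = pi" "\<bar>Re c\<bar> < R"
  shows "contour_integral (rectpath (Complex (- R) e) (Complex R (2 * pi - e)))
     (\<lambda>z. F z * coth_half (of_real \<kappa> * (z - c))) = 2 * of_real pi * \<i> * (F c * 2 / of_real \<kappa>)"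
proof -
  define g where "g z = exp (of_real \<kappa> * (z - c)) - 1" for z
  define d where "d z = (if z = c then deriv g c else (g z - g c) / (z - c))" for z
  define H where "H z = F z * (exp (of_real \<kappa> * (z - c)) + 1) / d z" for z
  define P where "P = rectpath (Complex (- R) e) (Complex R (2 * pi - e))"
  have gc: "g c = 0" by (simp add: g_def)
  have g_hol: "g holomorphic_on UNIV" unfolding g_def[abs_def] by (intro holomorphic_intros)
  have "d holomorphic_on UNIV" unfolding d_def[abs_def] using g_hol by (intro pole_lemma_open) auto
  have dg: "deriv g c = of_real \<kappa>"
    unfolding g_def[abs_def] by (rule DERIV_imp_deriv) (auto intro!: derivative_eq_intros)
  have dnz: "d z \<noteq> 0" if z: "z \<in> strip" for z
  proof (cases "z = c")
    case True
    then show ?thesis using k by (simp add: d_def dg)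
  next
    case False
    have "exp (of_real \<kappa> * (z - c)) \<noteq> 1"
      using exp_scaled_neq_one[OF k c(1) z False] .
    then show ?thesis using False by (simp add: d_def gc) (simp add: g_def)
  qed
  have Hhol: "H holomorphic_on strip"
    unfolding H_def using \<open>d holomorphic_on UNIV\<close> dnz
    by (intro holomorphic_intros F) (auto intro: holomorphic_on_subset)
  have cbox: "c \<in> box (Complex (- R) e) (Complex R (2 * pi - e))"
    using c e by (auto simp: in_box_complex_iff abs_less_iff)
  have Rpos: "R > 0" using c by auto
  have sub: "path_image P \<subseteq> strip - {c}"
  proof
    fix z assume "z \<in> path_image P"
    then have "z \<in> cbox (Complex (- R) e) (Complex R (2 * pi - e))" "z \<notin> box (Complex (- R) e) (Complex R (2 * pi - e))"
      using Rpos e by (auto simp: P_def path_image_rectpath_cbox_minus_box)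
    then show "z \<in> strip - {c}" using cbox e by (auto simp: in_cbox_complex_iff)
  qed
  have "((\<lambda>w. H w / (w - c)) has_contour_integral (2 * pi * \<i> * winding_number P c * H c)) P"
    using c sub by (intro Cauchy_integral_formula_convex_simple[OF convex_strip Hhol])
      (auto simp: interior_open[OF open_strip] P_def)
  moreover have "winding_number P c = 1"
    unfolding P_def by (rule winding_number_rectpath[OF cbox])
  moreover have "H c = F c * 2 / of_real \<kappa>" by (simp add: H_def d_def dg)
  ultimately have "((\<lambda>w. H w / (w - c)) has_contour_integral (2 * of_real pi * \<i> * (F c * 2 / of_real \<kappa>))) P"
    by simp
  moreover have "H z / (z - c) = F z * coth_half (of_real \<kappa> * (z - c))" if "z \<in> path_image P" for z
  proof -
    have "z \<noteq> c" "z \<in> strip" using that sub by auto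
    then show ?thesis using dnz[of z] by (simp add: H_def d_def gc coth_half_def) (simp add: g_def)
  qed
  ultimately have "((\<lambda>z. F z * coth_half (of_real \<kappa> * (z - c))) has_contour_integral (2 * of_real pi * \<i> * (F c * 2 / of_real \<kappa>))) P"
    by (rule has_contour_integral_eq)
  then show ?thesis unfolding P_def by (rule contour_integral_unique)
qed

text \<open>An abstract description of the transforms of probability measures with good decay. The
  sign of \<open>Im F\<close> will give positivity of the measure; the limits \<open>1\<close> and
  \<open>- 1\<close> at the two ends give total mass one and also tightness.\<close>

locale strip_Herglotz =
  fixes F :: "complex \<Rightarrow> complex" and K :: real
  assumes hol: "F holomorphic_on strip"
    and reflect: "\<And>z. z \<in> strip \<Longrightarrow> F (strip_reflect z) = cnj (F z)"
    and Im_nonpos: "\<And>z. 0 < Im z \<Longrightarrow> Im z < pi \<Longrightarrow> Im (F z) \<le> 0"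
    and at_infinity: "\<And>z s. z \<in> strip \<Longrightarrow> s = 1 \<or> s = - 1 \<Longrightarrow> K < s * Re z \<Longrightarrow>
      cmod (F z - of_real s) \<le> 2 / (exp (s * Re z - K) - 1)"
begin

lemma cont: "continuous_on strip F"
  using hol by (rule holomorphic_on_imp_continuous_on)

lemma mass_limit:
  assumes e: "0 < e" "e < pi"
  shows "(\<lambda>n::nat. integral {- real n..real n} (\<lambda>x. Im (F (Complex x e)))) \<longlonglongrightarrow> - (2 * (pi - e))"
proof -
  define N where "N = nat \<lceil>\<bar>K\<bar>\<rceil> + 1"
  have N: "\<bar>K\<bar> < real N" unfolding N_def by linarith
  have "(\<lambda>n::nat. integral {- real n..real n} (\<lambda>x. Im (F (Complex x e)))) \<longlonglongrightarrow>
      Re (0 / (2 * \<i>) - (1 - (- 1)) * of_real (pi - e))"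
  \<comment> \<open>There is no pole in this application: \<open>c\<close> is an arbitrary point of
    the middle line and the contour integrals vanish.\<close>
  proof (rule symmetric_rectangle_limit[OF e, where c = "Complex 0 pi" and N = N
        and E = "\<lambda>n. 2 / (exp (real n - K) - 1)"])
    fix n :: nat assume n: "n > N"
    have "(F has_contour_integral 0) (rectpath (Complex (- real n) e) (Complex (real n) (2 * pi - e)))"
    proof (rule Cauchy_theorem_convex_simple[OF hol convex_strip])
      show "path_image (rectpath (Complex (- real n) e) (Complex (real n) (2 * pi - e))) \<subseteq> strip"
        using path_image_rectpath_subset_cbox[of "Complex (- real n) e" "Complex (real n) (2 * pi - e)"] e
        by (force simp: in_cbox_complex_iff)
    qed auto
    then show "contour_integral (rectpath (Complex (- real n) e) (Complex (real n) (2 * pi - e))) F = 0"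
      by (rule contour_integral_unique)
    fix y assume y: "e \<le> y" "y \<le> 2 * pi - e"
    show "cmod (F (Complex (real n) y) - 1) \<le> 2 / (exp (real n - K) - 1)"
      using at_infinity[of "Complex (real n) y" 1] n N y e by auto
    show "cmod (F (Complex (- real n) y) - (- 1)) \<le> 2 / (exp (real n - K) - 1)"
      using at_infinity[of "Complex (- real n) y" "- 1"] n N y e by auto
  next
    show "continuous_on (strip - {Complex 0 pi}) F" using cont by (rule continuous_on_subset) auto
    show "(\<lambda>n. 2 / (exp (real n - K) - 1)) \<longlonglongrightarrow> 0" by real_asymp
  qed (use N reflect in auto)
  then show ?thesis by simp
qed

text \<open>The scale \<open>pi / (pi - e)\<close> is chosen so that on \<open>Im z = e\<close> the
  argument \<open>\<kappa> * (z - c)\<close> has imaginary part \<open>- pi\<close>, where the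
  kernel is a real tanh; hence only \<open>Im F\<close> enters. The condition
  \<open>e \<le> pi / 2\<close> gives \<open>\<kappa> \<le> 2\<close>. The product tends to
  \<open>1\<close> at both ends, so the vertical sides cancel in the limit.\<close>

lemma kernel_limit:
  assumes e: "0 < e" "e \<le> pi / 2"
  shows "(\<lambda>n::nat. integral {- real n..real n} (\<lambda>x. tanh (pi / (pi - e) * (x - a) / 2) * Im (F (Complex x e))))
     \<longlonglongrightarrow> 2 * (pi - e) * Re (F (Complex a pi))"
proof -
  define \<kappa> where "\<kappa> = pi / (pi - e)"
  have k: "0 < \<kappa>" "\<kappa> \<le> 2" "\<kappa> * (pi - e) = pi" "1 \<le> \<kappa>"
    using e by (auto simp: \<kappa>_def field_simps)
  define c where "c = Complex a pi"
  define f where "f z = F z * coth_half (of_real \<kappa> * (z - c))" for z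
  define e1 where "e1 n = 2 / (exp (real n - K) - 1)" for n
  define e2 where "e2 n = 2 / (exp (\<kappa> * (real n - \<bar>a\<bar>)) - 1)" for n
  define N where "N = nat \<lceil>\<bar>K\<bar> + \<bar>a\<bar>\<rceil> + 1"
  have N: "\<bar>K\<bar> + \<bar>a\<bar> < real N" unfolding N_def by linarith
  have expnz: "exp (of_real \<kappa> * (z - c)) \<noteq> 1" if "z \<in> strip - {c}" for z
    using exp_scaled_neq_one[OF k(1,2), of c z] that by (simp add: c_def)
  \<comment> \<open>As \<open>s * s = 1\<close>, two factors close to the same sign \<open>s\<close>
    have a product close to \<open>1\<close>.\<close>
  have bnd: "cmod (u * v - 1) \<le> p * (1 + q) + q" if "cmod (u - s) \<le> p" "cmod (v - s) \<le> q" "s = 1 \<or> s = - 1"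
    for u v s :: complex and p q
  proof -
    have s: "s * s = 1" "cmod s = 1" using that(3) by auto
    have "u * v - 1 = (u - s) * v + s * (v - s)" using s by (simp add: algebra_simps)
    then have "cmod (u * v - 1) \<le> cmod (u - s) * cmod v + cmod (v - s)"
      using norm_triangle_ineq[of "(u - s) * v" "s * (v - s)"] s by (simp add: norm_mult)
    moreover have "cmod v \<le> 1 + q" using norm_triangle_ineq[of "v - s" s] that(2) s by simp
    then have "cmod (u - s) * cmod v \<le> p * (1 + q)"
      using that(1) by (intro mult_mono) (auto intro: order_trans[OF norm_ge_zero])
    ultimately show ?thesis using that(2) by linarith
  qed
  have Reuv: "Re (of_real \<kappa> * (z - c)) = \<kappa> * (Re z - a)" for z by (simp add: c_def)
  have "(\<lambda>n::nat. integral {- real n..real n} (\<lambda>x. Im (f (Complex x e)))) \<longlonglongrightarrow>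
      Re (2 * of_real pi * \<i> * (F c * 2 / of_real \<kappa>) / (2 * \<i>) - (1 - 1) * of_real (pi - e))"
  proof (rule symmetric_rectangle_limit[where c = c and N = N and E = "\<lambda>n. e1 n * (1 + e2 n) + e2 n"])
    show "continuous_on (strip - {c}) f"
      unfolding f_def coth_half_def using expnz
      by (intro continuous_intros continuous_on_subset[OF cont]) auto
    show "f (strip_reflect z) = cnj (f z)" if "z \<in> strip" "z \<noteq> c" for z
    proof -
      have *: "of_real \<kappa> * (strip_reflect z - c) = cnj (of_real \<kappa> * (z - c))"
        by (simp add: complex_eq_iff c_def algebra_simps)
      have cj: "coth_half (cnj w) = cnj (coth_half w)" for w
        by (simp add: coth_half_def exp_cnj)
      show ?thesis unfolding f_def * cj reflect[OF that(1)] by (rule complex_cnj_mult[symmetric])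
    qed
    fix n :: nat assume n: "n > N"
    show "contour_integral (rectpath (Complex (- real n) e) (Complex (real n) (2 * pi - e))) f =
      2 * of_real pi * \<i> * (F c * 2 / of_real \<kappa>)"
      unfolding f_def using e k n N by (intro Cauchy_coth_half_rectpath hol) (auto simp: c_def)
    fix y assume y: "e \<le> y" "y \<le> 2 * pi - e"
    have na: "0 < \<kappa> * (real n - \<bar>a\<bar>)" using n N k by simp
    have "cmod (f (Complex (s * real n) y) - 1) \<le> e1 n * (1 + e2 n) + e2 n" if s: "s = 1 \<or> s = - 1" for s
      unfolding f_def
    proof (rule bnd[where s = "of_real s"])
      define w where "w = of_real \<kappa> * (Complex (s * real n) y - c)"
      show "cmod (F (Complex (s * real n) y) - of_real s) \<le> e1 n"
        using at_infinity[of "Complex (s * real n) y" s] s n N y e by (auto simp: e1_def)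
      have "\<kappa> * (real n - \<bar>a\<bar>) \<le> \<kappa> * (s * (s * real n - a))"
        using k s by (intro mult_left_mono) auto
      then have le: "\<kappa> * (real n - \<bar>a\<bar>) \<le> s * Re w" 
        unfolding w_def Reuv by (simp add: mult.left_commute)
      have "cmod (coth_half w - of_real s) \<le> 2 / (exp (s * Re w) - 1)"
        using na le by (intro norm_coth_half_minus_sign_le s) linarith
      also have "\<dots> \<le> e2 n"
        unfolding e2_def using na le by (intro divide_left_mono mult_pos_pos) (auto intro: less_le_trans)
      finally show "cmod (coth_half (of_real \<kappa> * (Complex (s * real n) y - c)) - of_real s) \<le> e2 n"
        unfolding w_def .
    qed (use s in auto)
    from this[of 1] this[of "- 1"]
    show "cmod (f (Complex (real n) y) - 1) \<le> e1 n * (1 + e2 n) + e2 n"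
      "cmod (f (Complex (- real n) y) - 1) \<le> e1 n * (1 + e2 n) + e2 n" by simp_all
  next
    show "(\<lambda>n. e1 n * (1 + e2 n) + e2 n) \<longlonglongrightarrow> 0"
    proof -
      have "e1 \<longlonglongrightarrow> 0" unfolding e1_def by real_asymp
      moreover have "e2 \<longlonglongrightarrow> 0" unfolding e2_def using k by real_asymp
      ultimately have "(\<lambda>n. e1 n * (1 + e2 n) + e2 n) \<longlonglongrightarrow> 0 * (1 + 0) + 0" by (intro tendsto_intros)
      then show ?thesis by simp
    qed
  qed (use e N in \<open>auto simp: c_def\<close>)
  moreover have "Re (2 * of_real pi * \<i> * (F c * 2 / of_real \<kappa>) / (2 * \<i>) - (1 - 1) * of_real (pi - e)) =
      2 * (pi - e) * Re (F c)"
  proof -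
    have "2 * of_real pi * \<i> * (F c * 2 / of_real \<kappa>) / (2 * \<i>) = of_real (2 * (pi / \<kappa>)) * F c"
      by (simp add: field_simps)
    moreover have "pi / \<kappa> = pi - e" using k by (simp add: field_simps)
    ultimately show ?thesis by (simp del: of_real_mult of_real_diff)
  qed
  moreover have "Im (f (Complex x e)) = tanh (pi / (pi - e) * (x - a) / 2) * Im (F (Complex x e))" for x
  proof -
    have "of_real \<kappa> * (Complex x e - c) = - Complex (- (\<kappa> * (x - a))) pi"
      using k by (simp add: complex_eq_iff c_def algebra_simps)
    moreover have "coth_half (Complex (- (\<kappa> * (x - a))) pi) = of_real (tanh (- (\<kappa> * (x - a)) / 2))"
      by (rule coth_half_pi)
    ultimately have "coth_half (of_real \<kappa> * (Complex x e - c)) = of_real (tanh (\<kappa> * (x - a) / 2))"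
      by (simp add: coth_half_minus)
    then show ?thesis by (simp add: f_def \<kappa>_def mult.commute)
  qed
  ultimately show ?thesis by (simp add: c_def)
qed

end

text \<open>For \<open>u \<ge> 0\<close> a derivative comparison gives
  \<open>tanh (\<kappa> * u) \<le> \<kappa> * tanh u\<close>, so the difference is at most
  \<open>(\<kappa> - 1) * tanh u\<close>. Uniformity in \<open>u\<close> allows the scale to be
  removed after integration against varying measures.\<close>

lemma tanh_scale_diff_le:
  fixes \<kappa> u :: real
  assumes k: "1 \<le> \<kappa>"
  shows "\<bar>tanh (\<kappa> * u) - tanh u\<bar> \<le> \<kappa> - 1"
proof -
  have pos: "\<bar>tanh (\<kappa> * u) - tanh u\<bar> \<le> \<kappa> - 1" if u: "0 \<le> u" for u
  proof -
    have "\<kappa> * tanh 0 - tanh (\<kappa> * 0) \<le> \<kappa> * tanh u - tanh (\<kappa> * u)"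
    proof (rule DERIV_nonneg_imp_nondecreasing[OF u])
      fix x assume x: "0 \<le> x" "x \<le> u"
      have "((\<lambda>x. \<kappa> * tanh x - tanh (\<kappa> * x)) has_real_derivative \<kappa> * (1 - (tanh x)\<^sup>2) - (1 - (tanh (\<kappa> * x))\<^sup>2) * \<kappa>) (at x)"
        by (auto intro!: derivative_eq_intros)
      moreover have "tanh x \<le> tanh (\<kappa> * x)" using x k by (simp add: mult_le_cancel_right1)
      then have "(tanh x)\<^sup>2 \<le> (tanh (\<kappa> * x))\<^sup>2" using x by (intro power_mono) auto
      then have "0 \<le> \<kappa> * ((tanh (\<kappa> * x))\<^sup>2 - (tanh x)\<^sup>2)" using k by simp
      then have "0 \<le> \<kappa> * (1 - (tanh x)\<^sup>2) - (1 - (tanh (\<kappa> * x))\<^sup>2) * \<kappa>"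
        by (simp add: algebra_simps)
      ultimately show "\<exists>y. ((\<lambda>x. \<kappa> * tanh x - tanh (\<kappa> * x)) has_real_derivative y) (at x) \<and> 0 \<le> y" by blast
    qed
    moreover have "tanh u \<le> tanh (\<kappa> * u)" using u k by (simp add: mult_le_cancel_right1)
    moreover have "(\<kappa> - 1) * tanh u \<le> (\<kappa> - 1) * 1"
      using k tanh_real_lt_1[of u] by (intro mult_left_mono) auto
    ultimately show ?thesis by (simp add: algebra_simps)
  qed
  show ?thesis
  proof (cases "0 \<le> u")
    case False
    then show ?thesis using pos[of "- u"] by simp
  qed (rule pos)
qed

context strip_Herglotz
begin

text \<open>The density is \<open>- Im F / (2 * (pi - e))\<close> on the line
  \<open>Im z = e\<close>: \<open>mass_limit\<close> normalises it and \<open>kernel_limit\<close>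
  evaluates its scaled tanh transform.\<close>

lemma level_measure:
  assumes e: "0 < e" "e \<le> pi / 2"
  shows "\<exists>\<mu>. real_distribution \<mu> \<and> (\<forall>a. (LINT x|\<mu>. tanh (pi / (pi - e) * (a - x) / 2)) = Re (F (Complex a pi)))"
proof -
  have e': "e < pi" using e by simp
  define p where "p x = - Im (F (Complex x e))" for x
  have p0: "p x \<ge> 0" for x using Im_nonpos[of "Complex x e"] e e' by (simp add: p_def)
  have cp: "continuous_on UNIV p"
    unfolding p_def using e e'
    by (intro continuous_intros continuous_on_compose2[OF cont]) (auto simp: Complex_eq intro!: continuous_intros)
  then have mp[measurable]: "p \<in> borel_measurable borel" by (rule borel_measurable_continuous_onI)
  have trunc: "set_integrable lborel {- real n..real n} q"
    "(LINT x:{- real n..real n}|lborel. q x) = integral {- real n..real n} q"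
    if "continuous_on UNIV q" for q :: "real \<Rightarrow> real" and n
  proof -
    show 1: "set_integrable lborel {- real n..real n} q"
      using that by (intro borel_integrable_atLeastAtMost') (auto intro: continuous_on_subset)
    then show "(LINT x:{- real n..real n}|lborel. q x) = integral {- real n..real n} q"
      by (rule set_borel_integral_eq_integral)
  qed
  have ind: "(\<lambda>n. indicator {- real n..real n} x *\<^sub>R q x) \<longlonglongrightarrow> q x" for x and q :: "real \<Rightarrow> real"
  proof (rule tendsto_eventually)
    show "\<forall>\<^sub>F n in sequentially. indicator {- real n..real n} x *\<^sub>R q x = q x"
      using eventually_ge_at_top[of "nat \<lceil>\<bar>x\<bar>\<rceil>"]
    proof eventually_elim
      case (elim n)
      then have "\<bar>x\<bar> \<le> real n" by linarith
      then show ?case by (auto simp: indicator_def)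
    qed
  qed
  have "(\<lambda>n. integral {- real n..real n} p) \<longlonglongrightarrow> 2 * (pi - e)"
    using tendsto_minus[OF mass_limit[OF e(1) e']] by (simp add: p_def[abs_def])
  then have lim_p: "(\<lambda>n. LINT x|lborel. indicator {- real n..real n} x *\<^sub>R p x) \<longlonglongrightarrow> 2 * (pi - e)"
    using trunc(2)[OF cp] by (simp add: set_lebesgue_integral_def)
  have int_n: "integrable lborel (\<lambda>x. indicator {- real n..real n} x *\<^sub>R p x)" for n
    using trunc(1)[OF cp] by (simp add: set_integrable_def)
  have mono_n: "mono (\<lambda>n. indicator {- real n..real n} x *\<^sub>R p x)" for x
    using p0 by (intro monoI) (auto simp: indicator_def)
  \<comment> \<open>So far the integrals are only limits over symmetric intervals. Nonnegativity of
    \<open>p\<close> turns this into integrability, and \<open>p\<close> then dominates the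
    integrand with \<open>T\<close>.\<close>
  have ip: "integrable lborel p" and p_mass: "integral\<^sup>L lborel p = 2 * (pi - e)"
    using integral_monotone_convergence_nonneg[OF int_n _ _ _ lim_p, of p] mono_n ind p0
    by (auto simp: indicator_def)
  define d where "d x = p x / (2 * (pi - e))" for x
  have d0: "d x \<ge> 0" for x using p0 e' by (simp add: d_def)
  have md[measurable]: "d \<in> borel_measurable borel" unfolding d_def by measurable
  have id: "integrable lborel d" unfolding d_def using ip by simp
  have d_mass: "integral\<^sup>L lborel d = 1" unfolding d_def using p_mass e' by simp
  define \<mu> where "\<mu> = density lborel (\<lambda>x. ennreal (d x))"
  have "prob_space \<mu>"
    unfolding \<mu>_def using d0 id d_mass
    by (intro prob_spaceI) (simp add: emeasure_density nn_integral_eq_integral)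
  then have "real_distribution \<mu>"
    by (simp add: real_distribution_def real_distribution_axioms_def \<mu>_def)
  moreover have "(LINT x|\<mu>. tanh (pi / (pi - e) * (a - x) / 2)) = Re (F (Complex a pi))" for a
  proof -
    define T where "T x = tanh (pi / (pi - e) * (a - x) / 2)" for x
    have cT: "continuous_on UNIV T" unfolding T_def by (intro continuous_intros) auto
    then have mT[measurable]: "T \<in> borel_measurable borel" by (rule borel_measurable_continuous_onI)
    have T1: "\<bar>T x\<bar> \<le> 1" for x
      unfolding T_def by (rule abs_tanh_real_le_1)
    have Tm: "tanh (pi / (pi - e) * (x - a) / 2) = - T x" for x
    proof -
      have "pi / (pi - e) * (x - a) / 2 = - (pi / (pi - e) * (a - x) / 2)"
        by (simp only: minus_divide_left mult_minus_right[symmetric] minus_diff_eq)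
      then show ?thesis unfolding T_def by (simp only: tanh_minus)
    qed
    have "(\<lambda>n. integral {- real n..real n} (\<lambda>x. T x * p x)) \<longlonglongrightarrow> 2 * (pi - e) * Re (F (Complex a pi))"
      using kernel_limit[OF e, of a] unfolding Tm by (simp add: p_def)
    then have "(\<lambda>n. LINT x|lborel. indicator {- real n..real n} x *\<^sub>R (T x * p x)) \<longlonglongrightarrow> 2 * (pi - e) * Re (F (Complex a pi))"
      using trunc(2)[OF continuous_on_mult[OF cT cp]] by (simp add: set_lebesgue_integral_def)
    moreover have "(\<lambda>n. LINT x|lborel. indicator {- real n..real n} x *\<^sub>R (T x * p x)) \<longlonglongrightarrow> (LINT x|lborel. T x * p x)"
    proof (rule integral_dominated_convergence[where w = p])
      show "AE x in lborel. (\<lambda>n. indicator {- real n..real n} x *\<^sub>R (T x * p x)) \<longlonglongrightarrow> T x * p x"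
        by (intro AE_I2 ind)
      show "AE x in lborel. norm (indicator {- real n..real n} x *\<^sub>R (T x * p x)) \<le> p x" for n
      proof (rule AE_I2)
        fix x
        have "\<bar>T x\<bar> * p x \<le> 1 * p x" using T1 p0 by (intro mult_right_mono) auto
        then show "norm (indicator {- real n..real n} x *\<^sub>R (T x * p x)) \<le> p x"
          using p0[of x] by (auto simp: indicator_def abs_mult)
      qed
      show "(\<lambda>x. indicator {- real n..real n} x *\<^sub>R (T x * p x)) \<in> borel_measurable lborel" for n
        by measurable
      show "(\<lambda>x. T x * p x) \<in> borel_measurable lborel" by measurable
      show "integrable lborel p" by (rule ip)
    qed
    ultimately have "(LINT x|lborel. T x * p x) = 2 * (pi - e) * Re (F (Complex a pi))"
      using LIMSEQ_unique by blast
    moreover have "(LINT x|\<mu>. T x) = (LINT x|lborel. d x *\<^sub>R T x)"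
      unfolding \<mu>_def using d0 by (intro integral_density) auto
    moreover have "(LINT x|lborel. d x *\<^sub>R T x) = (LINT x|lborel. T x * p x) / (2 * (pi - e))"
      by (simp add: d_def mult.commute)
    ultimately show ?thesis using e' by (simp add: T_def)
  qed
  ultimately show ?thesis by blast
qed

text \<open>The right-hand side in \<open>level_measure\<close> is the same for every
  \<open>e\<close>, so a weak limit as \<open>e\<close> tends to \<open>0\<close>, when the scale
  tends to \<open>1\<close>, has the required transform.\<close>

theorem representing_measure:
  "\<exists>\<mu>. real_distribution \<mu> \<and> (\<forall>a. tanh_transform \<mu> a = Re (F (Complex a pi)))"
proof -
  define e where "e n = 1 / (real n + 1)" for n
  have e: "0 < e n" "e n \<le> pi / 2" for n
  proof -
    have "e n \<le> 1" by (simp add: e_def)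
    then show "e n \<le> pi / 2" using pi_gt3 by linarith
  qed (simp add: e_def)
  define \<kappa> where "\<kappa> n = pi / (pi - e n)" for n
  have "\<exists>\<mu>. \<forall>n. real_distribution (\<mu> n) \<and> (\<forall>a. (LINT x|\<mu> n. tanh (\<kappa> n * (a - x) / 2)) = Re (F (Complex a pi)))"
    unfolding \<kappa>_def by (intro choice allI level_measure e)
  then obtain \<mu> where rd: "\<And>n. real_distribution (\<mu> n)"
    and \<mu>: "\<And>n a. (LINT x|\<mu> n. tanh (\<kappa> n * (a - x) / 2)) = Re (F (Complex a pi))"
    by blast
  have k1: "1 \<le> \<kappa> n" for n using e[of n] by (auto simp: \<kappa>_def field_simps)
  have "tight \<mu>"
    unfolding tight_def
  proof (intro conjI allI impI)
    show "real_distribution (\<mu> n)" for n by (rule rd)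
    fix h :: real assume h: "0 < h"
    have "((\<lambda>A. 2 / (exp (A - K) - 1)) \<longlongrightarrow> 0) at_top" by real_asymp
    then have "\<forall>\<^sub>F A in at_top. 2 / (exp (A - K) - 1) < h / 2"
      using h by (intro order_tendstoD) auto
    moreover have "\<forall>\<^sub>F A in at_top. K < A" by (rule eventually_gt_at_top)
    moreover have "\<forall>\<^sub>F A in at_top. 0 < (A::real)" by (rule eventually_gt_at_top)
    ultimately have "\<forall>\<^sub>F A in at_top. 2 / (exp (A - K) - 1) < h / 2 \<and> K < A \<and> 0 < A"
      by eventually_elim auto
    then obtain A where A: "2 / (exp (A - K) - 1) < h / 2" "K < A" "0 < A"
      by (auto dest: eventually_happens)
    have "measure (\<mu> n) {- A<..A} > 1 - h" for n
    proof -
      interpret real_distribution "\<mu> n" by (rule rd)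
      define T where "T a x = tanh (\<kappa> n * (a - x) / 2)" for a x
      have iT: "integrable (\<mu> n) (T a)" for a unfolding T_def by (rule integrable_tanh_scaled)
      have Tb: "- 1 \<le> T a x" "T a x \<le> 1" for a x
        unfolding T_def using tanh_real_lt_1 tanh_real_gt_neg1 by (simp_all add: less_imp_le)
      have ET: "(LINT x|\<mu> n. T a x) = Re (F (Complex a pi))" for a
        unfolding T_def by (rule \<mu>)
      \<comment> \<open>Where \<open>A \<le> s * x\<close> the kernel \<open>s * T (s * A) x\<close>
        is at most \<open>0\<close>, so the indicator lies below \<open>1 - s * T (s * A) x\<close>.
        The integral of the latter is small by \<open>at_infinity\<close>, uniformly in
        \<open>n\<close>.\<close>
      have tail: "prob {x. A \<le> s * x} < h / 2" if s: "s = 1 \<or> s = - 1" for s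
      proof -
        have "prob {x. A \<le> s * x} = (LINT x|\<mu> n. indicator {x. A \<le> s * x} x)" by simp
        also have "\<dots> \<le> (LINT x|\<mu> n. 1 - s * T (s * A) x)"
        proof (rule integral_mono)
          fix x
          have "s * T (s * A) x \<le> 0" if "A \<le> s * x"
            unfolding T_def using s that k1[of n] by (auto simp: mult_nonneg_nonpos)
          then show "indicator {x. A \<le> s * x} x \<le> 1 - s * T (s * A) x"
            using Tb[of "s * A" x] s by (auto simp: indicator_def)
        qed (use iT in \<open>auto simp: integrable_indicator_iff emeasure_eq_measure\<close>)
        also have "\<dots> = 1 - s * Re (F (Complex (s * A) pi))"
          using iT by (simp add: ET prob_UNIV)
        also have "\<dots> \<le> cmod (F (Complex (s * A) pi) - of_real s)"
          using s abs_Re_le_cmod[of "F (Complex (s * A) pi) - of_real s"] by auto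
        also have "\<dots> < h / 2" using at_infinity[of "Complex (s * A) pi" s] A s by auto
        finally show ?thesis .
      qed
      have "UNIV = {x. A \<le> - 1 * x} \<union> {- A<..A} \<union> {x. A \<le> 1 * x}" by auto
      then have "1 = prob ({x. A \<le> - 1 * x} \<union> {- A<..A} \<union> {x. A \<le> 1 * x})"
        by (simp only: prob_UNIV)
      also have "\<dots> \<le> prob {x. A \<le> - 1 * x} + prob {- A<..A} + prob {x. A \<le> 1 * x}"
        by (intro order_trans[OF measure_Un_le] add_mono measure_Un_le) auto
      finally show ?thesis using tail[of 1] tail[of "- 1"] by linarith
    qed
    then show "\<exists>a b. a < b \<and> (\<forall>n. 1 - h < measure (\<mu> n) {a<..b})"
      using A by (intro exI[of _ "- A"] exI[of _ A]) auto
  qed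
  then obtain r M where r: "strict_mono (r :: nat \<Rightarrow> nat)" and M: "real_distribution M"
    and wc: "weak_conv_m (\<mu> \<circ> id \<circ> r) M"
    using tight_imp_convergent_subsubsequence[of \<mu> id] by (auto simp: strict_mono_id)
  have "tanh_transform M a = Re (F (Complex a pi))" for a
  proof -
    have "(\<lambda>n. LINT x|(\<mu> \<circ> id \<circ> r) n. tanh ((a - x) / 2)) \<longlonglongrightarrow> (LINT x|M. tanh ((a - x) / 2))"
    proof (rule weak_conv_imp_integral_bdd_continuous_conv[OF _ M wc, where B = 1])
      show "isCont (\<lambda>x. tanh ((a - x) / 2)) x" for x by (intro continuous_intros) auto
      show "norm (tanh ((a - x) / 2)) \<le> 1" for x
        using abs_tanh_real_le_1 by simp
    qed (simp add: rd)
    moreover have "(\<lambda>n. LINT x|(\<mu> \<circ> id \<circ> r) n. tanh ((a - x) / 2)) \<longlonglongrightarrow> Re (F (Complex a pi))"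
    proof (rule Lim_transform_bound[THEN LIM_zero_cancel])
      have "(\<lambda>n. \<kappa> n - 1) \<longlonglongrightarrow> 0" unfolding \<kappa>_def e_def by real_asymp
      then show "(\<lambda>n. \<kappa> (r n) - 1) \<longlonglongrightarrow> 0" using LIMSEQ_subseq_LIMSEQ[OF _ r, of "\<lambda>n. \<kappa> n - 1" 0] by (simp add: comp_def)
      show "\<forall>\<^sub>F n in sequentially. norm ((LINT x|(\<mu> \<circ> id \<circ> r) n. tanh ((a - x) / 2)) - Re (F (Complex a pi)))
          \<le> norm (\<kappa> (r n) - 1)"
      proof (intro always_eventually allI)
        fix n
        define k where "k = r n"
        interpret real_distribution "\<mu> k" by (rule rd)
        have "(LINT x|\<mu> k. tanh ((a - x) / 2)) - Re (F (Complex a pi)) =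
            (LINT x|\<mu> k. tanh ((a - x) / 2) - tanh (\<kappa> k * (a - x) / 2))"
          unfolding \<mu>[of k a, symmetric] by (simp add: integrable_tanh integrable_tanh_scaled)
        also have "\<bar>\<dots>\<bar> \<le> (LINT x|\<mu> k. \<kappa> k - 1)"
        proof (intro order_trans[OF integral_abs_bound] integral_mono)
          show "\<bar>tanh ((a - x) / 2) - tanh (\<kappa> k * (a - x) / 2)\<bar> \<le> \<kappa> k - 1" for x
            using tanh_scale_diff_le[OF k1[of k], of "(a - x) / 2"] by (simp add: abs_minus_commute)
        qed (auto intro!: integrable_abs integrable_tanh integrable_tanh_scaled)
        also have "(LINT x|\<mu> k. \<kappa> k - 1) = \<kappa> k - 1" by (simp add: prob_UNIV)
        finally show "norm ((LINT x|(\<mu> \<circ> id \<circ> r) n. tanh ((a - x) / 2)) - Re (F (Complex a pi))) \<le> norm (\<kappa> (r n) - 1)"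
          using k1[of k] by (simp add: k_def)
      qed
    qed
    ultimately show ?thesis unfolding tanh_transform_def using LIMSEQ_unique by blast
  qed
  then show ?thesis using M by blast
qed

end

theorem (in real_distribution) subordinated_measure_exists:
  assumes t: "0 < t" and B: "AE y in M. \<bar>y\<bar> \<le> B"
  shows "\<exists>\<mu>. real_distribution \<mu> \<and>
    (\<forall>b. tanh_transform \<mu> (b + t / 2 * tanh_transform M b) = tanh_transform M b)"
proof -
  obtain F K where F: "strip_Herglotz F K"
    and line: "\<And>b. F (Complex (b + t / 2 * tanh_transform M b) pi) = of_real (tanh_transform M b)"
    by (rule subordinated_transform[OF t B], rule that, rule strip_Herglotz.intro) (assumption | blast)+
  then show ?thesis using strip_Herglotz.representing_measure[OF F] by force
qed

section \<open>The Sigma-transform in the logarithmic variable\<close>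

lemma tanh_half_eq: "tanh (u / 2) = 2 / (1 + exp (- u)) - (1::real)"
proof -
  have "1 + exp (- u) \<noteq> 0" using exp_gt_zero[of "- u"] by linarith
  then show ?thesis by (simp add: tanh_real_altdef field_simps)
qed

context real_distribution
begin

lemma tanh_transform_strict_mono:
  assumes "a < b"
  shows "tanh_transform M a < tanh_transform M b"
proof -
  have "0 < (LINT y|M. tanh ((b - y) / 2) - tanh ((a - y) / 2))"
    using assms by (intro expectation_pos Bochner_Integration.integrable_diff integrable_tanh) simp
  then show ?thesis by (simp add: tanh_transform_def integrable_tanh)
qed

lemma tanh_transform_inj: "tanh_transform M a = tanh_transform M b \<longleftrightarrow> a = b"
  using tanh_transform_strict_mono[of a b] tanh_transform_strict_mono[of b a]
  by (cases a b rule: linorder_cases) auto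

lemma tanh_transform_bounds: "- 1 < tanh_transform M a" "tanh_transform M a < 1"
  using abs_tanh_transform_le[of "a - 1"] abs_tanh_transform_le[of "a + 1"]
    tanh_transform_strict_mono[of "a - 1" a] tanh_transform_strict_mono[of a "a + 1"] by auto

lemma tanh_transform_limits:
  "(\<lambda>n. tanh_transform M (real n)) \<longlonglongrightarrow> 1" "(\<lambda>n. tanh_transform M (- real n)) \<longlonglongrightarrow> - 1"
proof -
  have *: "(\<lambda>n. LINT y|M. tanh ((f n - y) / 2)) \<longlonglongrightarrow> (LINT y|M. c)"
    if "\<And>y. (\<lambda>n. tanh ((f n - y) / 2)) \<longlonglongrightarrow> c" for f :: "nat \<Rightarrow> real" and c
  proof (rule integral_dominated_convergence[where w = "\<lambda>_. 1"])
    show "AE y in M. norm (tanh ((f n - y) / 2)) \<le> 1" for n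
      using abs_tanh_real_le_1 by simp
    show "(\<lambda>y. tanh ((f n - y) / 2)) \<in> borel_measurable M" for n
      using integrable_tanh[of "f n"] by (rule borel_measurable_integrable)
  qed (use that in auto)
  have "(\<lambda>n. tanh ((real n - y) / 2)) \<longlonglongrightarrow> 1" "(\<lambda>n. tanh ((- real n - y) / 2)) \<longlonglongrightarrow> - 1" for y :: real
    unfolding tanh_half_eq by real_asymp+
  from *[OF this(1)] *[OF this(2)]
  show "(\<lambda>n. tanh_transform M (real n)) \<longlonglongrightarrow> 1" "(\<lambda>n. tanh_transform M (- real n)) \<longlonglongrightarrow> - 1"
    by (simp_all add: tanh_transform_def prob_UNIV)
qed

lemma tanh_transform_surj:
  assumes "- 1 < y" "y < 1"
  shows "\<exists>a. tanh_transform M a = y"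
proof -
  obtain n where n: "y < tanh_transform M (real n)"
    using order_tendstoD(1)[OF tanh_transform_limits(1) assms(2)] by (auto dest: eventually_happens)
  obtain m where m: "tanh_transform M (- real m) < y"
    using order_tendstoD(2)[OF tanh_transform_limits(2) assms(1)] by (auto dest: eventually_happens)
  have "\<exists>a\<ge>- real m. a \<le> real n \<and> tanh_transform M a = y"
    using n m by (intro IVT allI impI isCont_tanh_transform) auto
  then show ?thesis by blast
qed

end

lemma prob_measure_Rpos_real_distribution:
  "prob_measure_Rpos \<mu> \<Longrightarrow> real_distribution \<mu>"
  by (simp add: prob_measure_Rpos_def real_distribution_def real_distribution_axioms_def)

lemma prob_measure_Rpos_AE_pos:
  assumes "prob_measure_Rpos \<mu>"
  shows "AE x in \<mu>. 0 < x"
proof (rule AE_I[where N = "{..0}"])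
  interpret real_distribution \<mu> by (rule prob_measure_Rpos_real_distribution[OF assms])
  show "emeasure \<mu> {..0} = 0" "{..0} \<in> sets \<mu>" using assms by (auto simp: prob_measure_Rpos_def)
  show "{x \<in> space \<mu>. \<not> 0 < x} \<subseteq> {..0}" by auto
qed

lemma real_distribution_ln:
  assumes "prob_measure_Rpos \<mu>"
  shows "real_distribution (distr \<mu> borel ln)"
proof -
  interpret real_distribution \<mu> by (rule prob_measure_Rpos_real_distribution[OF assms])
  show ?thesis by (rule real_distribution_distr) simp
qed

lemma prob_measure_Rpos_exp:
  assumes "real_distribution M"
  shows "prob_measure_Rpos (distr M borel exp)" and "distr (distr M borel exp) borel ln = M"
proof -
  interpret real_distribution M by (rule assms)
  have "exp -` {..0::real} \<inter> space M = {}" by (auto simp: not_le)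
  then have "emeasure (distr M borel exp) {..0::real} = 0"
    by (subst emeasure_distr) auto
  then show "prob_measure_Rpos (distr M borel exp)"
    by (simp add: prob_measure_Rpos_def prob_space_distr)
  have "distr (distr M borel exp) borel ln = distr M borel (ln \<circ> exp)"
    by (rule distr_distr) auto
  also have "\<dots> = distr M M (\<lambda>x. x)" by (rule distr_cong) auto
  finally show "distr (distr M borel exp) borel ln = M" by simp
qed

lemma distr_exp_ln:
  assumes "prob_measure_Rpos \<mu>"
  shows "distr (distr \<mu> borel ln) borel exp = \<mu>"
proof -
  interpret real_distribution \<mu> by (rule prob_measure_Rpos_real_distribution[OF assms])
  have "distr (distr \<mu> borel ln) borel exp = distr \<mu> borel (exp \<circ> ln)"
    by (rule distr_distr) auto
  also have "\<dots> = distr \<mu> \<mu> (\<lambda>x. x)"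
    using prob_measure_Rpos_AE_pos[OF assms] by (intro distr_cong_AE) auto
  finally show ?thesis by simp
qed

text \<open>For \<open>z = - exp (- a)\<close> and \<open>x = exp y\<close> the integrand
  \<open>x * z / (1 - x * z)\<close> equals \<open>(tanh ((a - y) / 2) - 1) / 2\<close>.\<close>

lemma psi_transform_neg:
  assumes "prob_measure_Rpos \<mu>"
  shows "psi_transform \<mu> (of_real (- exp (- a))) =
    of_real ((tanh_transform (distr \<mu> borel ln) a - 1) / 2)"
proof -
  interpret real_distribution \<mu> by (rule prob_measure_Rpos_real_distribution[OF assms])
  interpret L: real_distribution "distr \<mu> borel ln" by (rule real_distribution_ln[OF assms])
  have int: "integrable \<mu> (\<lambda>x. tanh ((a - ln x) / 2))"
    using L.integrable_tanh[of a] by (subst (asm) integrable_distr_eq) auto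
  have "psi_transform \<mu> (of_real (- exp (- a))) = (LINT x|\<mu>. complex_of_real ((tanh ((a - ln x) / 2) - 1) / 2))"
    unfolding psi_transform_def
  proof (rule integral_cong_AE)
    show "AE x in \<mu>. of_real x * of_real (- exp (- a)) / (1 - of_real x * of_real (- exp (- a))) =
        complex_of_real ((tanh ((a - ln x) / 2) - 1) / 2)"
      using prob_measure_Rpos_AE_pos[OF assms]
    proof eventually_elim
      case (elim x)
      have "exp (- (a - ln x)) = x * exp (- a)" using elim by (simp add: exp_diff exp_minus divide_simps)
      moreover have "0 < 1 + x * exp (- a)" using elim by (simp add: add_pos_pos)
      ultimately have "(tanh ((a - ln x) / 2) - 1) / 2 = x * - exp (- a) / (1 - x * - exp (- a))"
        unfolding tanh_half_eq by (simp add: field_simps)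
      then show ?case by (simp only: of_real_mult of_real_divide of_real_diff of_real_1)
    qed
  qed (use int in \<open>auto simp del: of_real_divide of_real_diff\<close>)
  also have "\<dots> = of_real (LINT x|\<mu>. (tanh ((a - ln x) / 2) - 1) / 2)"
    by (rule integral_complex_of_real)
  also have "(LINT x|\<mu>. (tanh ((a - ln x) / 2) - 1) / 2) = (tanh_transform (distr \<mu> borel ln) a - 1) / 2"
    using int by (simp add: tanh_transform_def integral_distr prob_UNIV)
  finally show ?thesis .
qed

lemma eta_transform_neg:
  assumes "prob_measure_Rpos \<mu>"
  defines "g \<equiv> tanh_transform (distr \<mu> borel ln)"
  shows "eta_transform \<mu> (of_real (- exp (- a))) = of_real ((g a - 1) / (g a + 1))"
proof -
  interpret L: real_distribution "distr \<mu> borel ln" by (rule real_distribution_ln[OF assms(1)])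
  have "g a + 1 \<noteq> 0" using L.tanh_transform_bounds[of a] by (simp add: g_def)
  then have "(g a - 1) / 2 / (1 + (g a - 1) / 2) = (g a - 1) / (g a + 1)"
    by (simp add: field_simps)
  then show ?thesis
    unfolding eta_transform_def psi_transform_neg[OF assms(1)] g_def[symmetric]
    by (metis of_real_1 of_real_add of_real_divide)
qed

lemma Cayley_inj:
  fixes x y :: real
  assumes "- 1 < x" "- 1 < y"
  shows "(x - 1) / (x + 1) = (y - 1) / (y + 1) \<longleftrightarrow> x = y"
  using assms by (auto simp: divide_simps) (simp add: algebra_simps)

lemma eta_inverse_neg:
  assumes \<mu>: "prob_measure_Rpos \<mu>"
  defines "g \<equiv> tanh_transform (distr \<mu> borel ln)"
  shows "eta_inverse \<mu> (of_real ((g a - 1) / (g a + 1))) = of_real (- exp (- a))"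
  unfolding eta_inverse_def
proof (rule inv_into_f_eq)
  interpret L: real_distribution "distr \<mu> borel ln" by (rule real_distribution_ln[OF \<mu>])
  have ex: "\<exists>b. x = complex_of_real (- exp (- b))" if x: "x \<in> complex_of_real ` {..<0}" for x
  proof -
    obtain r where "r < 0" "x = of_real r" using x by auto
    then show ?thesis by (intro exI[of _ "- ln (- r)"]) simp
  qed
  show "inj_on (eta_transform \<mu>) (complex_of_real ` {..<0})"
  proof (rule inj_onI)
    fix x y assume "x \<in> complex_of_real ` {..<0}" "y \<in> complex_of_real ` {..<0}"
      and eq: "eta_transform \<mu> x = eta_transform \<mu> y"
    then obtain b c where b: "x = complex_of_real (- exp (- b))" and c: "y = complex_of_real (- exp (- c))"
      using ex by metis
    have "(g b - 1) / (g b + 1) = (g c - 1) / (g c + 1)"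
      using eq unfolding b c eta_transform_neg[OF \<mu>] g_def of_real_eq_iff .
    then have "g b = g c" using Cayley_inj L.tanh_transform_bounds(1) unfolding g_def by blast
    then show "x = y" using L.tanh_transform_inj by (simp add: g_def b c)
  qed
  show "complex_of_real (- exp (- a)) \<in> complex_of_real ` {..<0}" by (rule imageI) simp
  show "eta_transform \<mu> (complex_of_real (- exp (- a))) = complex_of_real ((g a - 1) / (g a + 1))"
    unfolding g_def by (rule eta_transform_neg[OF \<mu>])
qed

lemma neg_real_eq_Cayley:
  assumes "real_distribution M" "z < 0"
  obtains a where "z = (tanh_transform M a - 1) / (tanh_transform M a + 1)"
proof -
  interpret real_distribution M by (rule assms)
  have "- 1 < (1 + z) / (1 - z)" "(1 + z) / (1 - z) < 1" using assms(2) by (auto simp: field_simps)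
  then obtain a where a: "tanh_transform M a = (1 + z) / (1 - z)" using tanh_transform_surj by blast
  have "z = (tanh_transform M a - 1) / (tanh_transform M a + 1)"
    unfolding a using assms(2) by (simp add: field_simps)
  then show ?thesis by (rule that)
qed

text \<open>In the coordinate \<open>z = (g - 1) / (g + 1)\<close> one has
  \<open>(z + 1) / (z - 1) = - g\<close>. The exponential factor therefore changes
  \<open>- exp (- b)\<close> into \<open>- exp (- (b + t / 2 * g))\<close>, which is exactly the
  shift of \<open>b\<close> in the hypothesis.\<close>

lemma Sigma_transform_subordinated:
  assumes \<rho>: "prob_measure_Rpos \<rho>" and \<nu>: "prob_measure_Rpos \<nu>"
    and line: "\<And>b. tanh_transform (distr \<rho> borel ln) (b + t / 2 * tanh_transform (distr \<nu> borel ln) b)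
      = tanh_transform (distr \<nu> borel ln) b"
    and z: "z \<in> complex_of_real ` {..<0}"
  shows "Sigma_transform \<rho> z = exp (of_real t / 2 * ((z + 1) / (z - 1))) * Sigma_transform \<nu> z"
proof -
  interpret L: real_distribution "distr \<nu> borel ln" by (rule real_distribution_ln[OF \<nu>])
  obtain r where r: "r < 0" "z = of_real r" using z by auto
  define g where "g = tanh_transform (distr \<nu> borel ln)"
  obtain b where b: "r = (g b - 1) / (g b + 1)"
    using neg_real_eq_Cayley[OF L.real_distribution_axioms r(1)] unfolding g_def by blast
  have z': "z = of_real ((g b - 1) / (g b + 1))" using r b by simp
  have gb: "g b > - 1" using L.tanh_transform_bounds by (simp add: g_def)
  have "(r + 1) / (r - 1) = - g b"
  proof -
    have "r + 1 = 2 * g b / (g b + 1)" "r - 1 = - 2 / (g b + 1)" using gb unfolding b by (simp_all add: field_simps)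
    then show ?thesis using gb by simp
  qed
  then have "of_real t / 2 * ((z + 1) / (z - 1)) = complex_of_real (t / 2 * (- g b))"
  proof -
    assume "(r + 1) / (r - 1) = - g b"
    moreover have "(z + 1) / (z - 1) = complex_of_real ((r + 1) / (r - 1))" unfolding r(2) by simp
    ultimately show ?thesis by (simp only: of_real_mult of_real_divide of_real_numeral)
  qed
  then have ex: "exp (of_real t / 2 * ((z + 1) / (z - 1))) = complex_of_real (exp (t / 2 * (- g b)))"
    by (simp only: exp_of_real)
  have \<nu>z: "eta_inverse \<nu> z = of_real (- exp (- b))"
    unfolding z' g_def by (rule eta_inverse_neg[OF \<nu>])
  have "eta_inverse \<rho> z = of_real (- exp (- (b + t / 2 * g b)))"
    unfolding z' using eta_inverse_neg[OF \<rho>, of "b + t / 2 * g b"] line[of b] by (simp only: g_def)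
  also have "- exp (- (b + t / 2 * g b)) = exp (t / 2 * (- g b)) * (- exp (- b))"
    by (simp flip: exp_add)
  finally show ?thesis
    unfolding Sigma_transform_def ex \<nu>z by (simp only: of_real_mult times_divide_eq_right)
qed

text \<open>Up to an affine map, the transform at \<open>- ln (1 - r)\<close> is a generating
  function in \<open>r\<close> with coefficients \<open>\<integral> (1 - Q) * Q ^ N\<close>. Letting
  \<open>r\<close> tend to \<open>0\<close> peels these off one at a time, and they are the
  differences of consecutive moments of \<open>Q\<close>.\<close>

lemma logistic_moments_eq:
  fixes r :: real
  assumes "real_distribution M1" "real_distribution M2"
    and eq: "\<And>a. tanh_transform M1 a = tanh_transform M2 a"
  defines "Q \<equiv> \<lambda>y::real. 1 - 1 / (1 + exp y)"
  shows "(LINT y|M1. Q y ^ n) = (LINT y|M2. Q y ^ n)"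
proof -
  have Q: "0 < Q y" "Q y < 1" for y by (simp_all add: Q_def add_pos_pos)
  have [measurable]: "Q \<in> borel_measurable borel" unfolding Q_def by measurable
  \<comment> \<open>The tail of that power series after \<open>N\<close> terms, divided by
    \<open>r ^ N\<close>.\<close>
  define D where "D M N r = (LINT y|M. (1 - Q y) * Q y ^ N / (1 - r * Q y))" for M N and r :: real
  define m where "m M N = (LINT y|M. (1 - Q y) * Q y ^ N)" for M N
  have rQ: "0 < 1 - r * Q y" if "0 \<le> r" "r < 1" for r y
  proof -
    have "r * Q y \<le> r * 1" using Q[of y] that by (intro mult_left_mono) auto
    then show ?thesis using that by simp
  qed
  have QN: "0 \<le> (1 - Q y) * Q y ^ N" "(1 - Q y) * Q y ^ N \<le> 1" for y N
    using Q[of y] by (auto intro!: mult_le_one power_le_one simp: less_imp_le)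
  have intD: "integrable M (\<lambda>y. (1 - Q y) * Q y ^ N / (1 - r * Q y))"
    if "real_distribution M" "0 \<le> r" "r < 1" for M N r
  proof -
    interpret real_distribution M by fact
    show ?thesis
    proof (rule integrable_const_bound[where B = "1 / (1 - r)"])
      show "AE y in M. norm ((1 - Q y) * Q y ^ N / (1 - r * Q y)) \<le> 1 / (1 - r)"
      proof (rule AE_I2)
        fix y
        have "r * Q y \<le> r * 1" using Q[of y] that by (intro mult_left_mono) auto
        then have "(1 - Q y) * Q y ^ N / (1 - r * Q y) \<le> 1 / (1 - r)"
          using QN[of y N] that by (intro frac_le) auto
        then show "norm ((1 - Q y) * Q y ^ N / (1 - r * Q y)) \<le> 1 / (1 - r)"
          using QN[of y N] rQ[OF that(2,3), of y] by simp
      qed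
    qed measurable
  qed
  have intm: "integrable M (\<lambda>y. (1 - Q y) * Q y ^ N)" if "real_distribution M" for M N
    using intD[OF that, of 0 N] by simp
  have step: "D M N r = m M N + r * D M (Suc N) r" if M: "real_distribution M" and r: "0 \<le> r" "r < 1" for M N r
  proof -
    have "(1 - Q y) * Q y ^ N / (1 - r * Q y) =
        (1 - Q y) * Q y ^ N + r * ((1 - Q y) * Q y ^ Suc N / (1 - r * Q y))" for y
      using rQ[OF r, of y] by (simp add: field_simps)
    then have "D M N r = (LINT y|M. (1 - Q y) * Q y ^ N + r * ((1 - Q y) * Q y ^ Suc N / (1 - r * Q y)))"
      by (simp only: D_def)
    also have "\<dots> = m M N + (LINT y|M. r * ((1 - Q y) * Q y ^ Suc N / (1 - r * Q y)))"
      unfolding m_def by (rule Bochner_Integration.integral_add[OF intm[OF M] integrable_mult_right[OF intD[OF M r]]])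
    also have "(LINT y|M. r * ((1 - Q y) * Q y ^ Suc N / (1 - r * Q y))) = r * D M (Suc N) r"
      unfolding D_def by (rule integral_mult_right_zero)
    finally show ?thesis .
  qed
  have Dbound: "\<bar>D M N r\<bar> \<le> 2" if M: "real_distribution M" and r: "0 \<le> r" "r \<le> 1 / 2" for M N r
  proof -
    interpret real_distribution M by (rule M)
    have "\<bar>D M N r\<bar> \<le> (LINT y|M. 2)"
      unfolding D_def
    proof (intro order_trans[OF integral_abs_bound] integral_mono)
      show "\<bar>(1 - Q y) * Q y ^ N / (1 - r * Q y)\<bar> \<le> 2" for y
      proof -
        have "r * Q y \<le> 1 / 2 * 1" using Q[of y] r by (intro mult_mono) auto
        then have "(1 - Q y) * Q y ^ N / (1 - r * Q y) \<le> 1 / (1 / 2)"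
          using QN[of y N] by (intro frac_le) auto
        then show ?thesis using QN[of y N] rQ[of r y] r by simp
      qed
      show "integrable M (\<lambda>y. \<bar>(1 - Q y) * Q y ^ N / (1 - r * Q y)\<bar>)"
        using r by (intro integrable_abs intD M) auto
    qed auto
    then show ?thesis by (simp add: prob_UNIV)
  qed
  have D0: "D M 0 r = (1 + tanh_transform M (- ln (1 - r))) / 2"
    if M: "real_distribution M" and r: "0 < r" "r < 1" for M r
  proof -
    interpret real_distribution M by (rule M)
    have "(1 - Q y) / (1 - r * Q y) = (1 + tanh ((- ln (1 - r) - y) / 2)) / 2" for y
    proof -
      have e: "exp (- (- ln (1 - r) - y)) = (1 - r) * exp y" using r by (simp add: exp_add)
      have "0 < 1 + (1 - r) * exp y" using r by (simp add: add_pos_pos)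
      moreover have ne: "1 + exp y \<noteq> 0" using exp_gt_zero[of y] by linarith
      moreover have Qe: "Q y * (1 + exp y) = exp y" using ne by (simp add: Q_def left_diff_distrib)
      have "(1 - r * Q y) * (1 + exp y) = (1 + exp y) - r * (Q y * (1 + exp y))" by (simp only: left_diff_distrib mult.assoc mult_1)
      then have "(1 - r * Q y) * (1 + exp y) = 1 + (1 - r) * exp y" unfolding Qe by (simp add: left_diff_distrib)
      moreover have "(1 - Q y) * (1 + exp y) = 1" using Qe by (simp add: left_diff_distrib)
      ultimately have "(1 - Q y) / (1 - r * Q y) = 1 / (1 + (1 - r) * exp y)"
        by (metis mult_divide_mult_cancel_right)
      moreover have "1 / d = (1 + (2 / d - 1)) / 2" for d :: real by simp
      ultimately show ?thesis unfolding tanh_half_eq e by (simp only:)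
    qed
    then have "D M 0 r = (LINT y|M. (1 + tanh ((- ln (1 - r) - y) / 2)) / 2)"
      by (simp only: D_def power_0 mult_1_right)
    then show ?thesis
      using integrable_tanh[of "- ln (1 - r)"]
      by (simp add: tanh_transform_def prob_UNIV)
  qed
  have mlim: "((\<lambda>r. D M N r) \<longlongrightarrow> m M N) (at_right 0)" if M: "real_distribution M" for M N
  proof (rule Lim_transform_bound[THEN LIM_zero_cancel])
    show "((\<lambda>r::real. r * 2) \<longlongrightarrow> 0) (at_right 0)" by (intro tendsto_mult_left_zero tendsto_ident_at)
    have "\<forall>\<^sub>F r in at_right (0::real). r \<in> {0<..<1/2}" by (rule eventually_at_right_real) simp
    then show "\<forall>\<^sub>F r in at_right 0. norm (D M N r - m M N) \<le> norm (r * 2)"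
    proof eventually_elim
      case (elim r)
      have "D M N r - m M N = r * D M (Suc N) r" using step[OF M, of r N] elim by simp
      then show ?case using Dbound[OF M, of r "Suc N"] elim by (simp add: abs_mult)
    qed
  qed
  have Dm: "(\<forall>r. 0 < r \<and> r < 1 \<longrightarrow> D M1 N r = D M2 N r) \<and> m M1 N = m M2 N" for N
  proof (induction N)
    case 0
    have *: "D M1 0 r = D M2 0 r" if "0 < r" "r < 1" for r
      using D0[OF assms(1) that] D0[OF assms(2) that] eq by simp
    have "\<forall>\<^sub>F r in at_right (0::real). r \<in> {0<..<1}" by (rule eventually_at_right_real) simp
    then have "\<forall>\<^sub>F r in at_right 0. D M1 0 r = D M2 0 r" by eventually_elim (use * in auto)
    then have "((\<lambda>r. D M2 0 r) \<longlongrightarrow> m M1 0) (at_right 0)" by (rule Lim_transform_eventually[OF mlim[OF assms(1)]])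
    then have "m M1 0 = m M2 0" using mlim[OF assms(2)] tendsto_unique trivial_limit_at_right_real by blast
    then show ?case using * by blast
  next
    case (Suc N)
    have *: "D M1 (Suc N) r = D M2 (Suc N) r" if "0 < r" "r < 1" for r
      using step[OF assms(1), of r N] step[OF assms(2), of r N] Suc that by auto
    have "\<forall>\<^sub>F r in at_right (0::real). r \<in> {0<..<1}" by (rule eventually_at_right_real) simp
    then have "\<forall>\<^sub>F r in at_right 0. D M1 (Suc N) r = D M2 (Suc N) r" by eventually_elim (use * in auto)
    then have "((\<lambda>r. D M2 (Suc N) r) \<longlongrightarrow> m M1 (Suc N)) (at_right 0)" by (rule Lim_transform_eventually[OF mlim[OF assms(1)]])
    then have "m M1 (Suc N) = m M2 (Suc N)" using mlim[OF assms(2)] tendsto_unique trivial_limit_at_right_real by blast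
    then show ?case using * by blast
  qed
  have intQ: "integrable M (\<lambda>y. Q y ^ k)" if "real_distribution M" for M k
  proof -
    interpret real_distribution M by fact
    show ?thesis using Q
      by (intro integrable_const_bound[where B = 1]) (auto intro!: power_le_one AE_I2 simp: less_imp_le power_abs)
  qed
  have rec: "(LINT y|M. Q y ^ Suc k) = (LINT y|M. Q y ^ k) - m M k" if "real_distribution M" for M k
  proof -
    have "m M k = (LINT y|M. Q y ^ k - Q y ^ Suc k)" by (simp add: m_def algebra_simps)
    then show ?thesis using intQ[OF that, of k] intQ[OF that, of "Suc k"] by simp
  qed
  show ?thesis
  proof (induction n)
    case 0
    interpret M1: real_distribution M1 by fact
    interpret M2: real_distribution M2 by fact
    show ?case by (simp add: M1.prob_UNIV M2.prob_UNIV)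
  next
    case (Suc n)
    then show ?case using rec[OF assms(1)] rec[OF assms(2)] Dm by simp
  qed
qed

text \<open>On \<open>[- 1, 1]\<close> the Taylor polynomials of the characteristic function have
  error at most \<open>2 * \<bar>t\<bar> ^ n / fact n\<close>, so the moments determine it.\<close>

lemma real_distribution_eq_moments:
  assumes "real_distribution M1" "real_distribution M2"
    and b: "AE x in M1. \<bar>x\<bar> \<le> 1" "AE x in M2. \<bar>x\<bar> \<le> 1"
    and eq: "\<And>n::nat. (LINT x|M1. x ^ n) = (LINT x|M2. x ^ n)"
  shows "M1 = M2"
proof (rule Levy_uniqueness[OF assms(1,2)], rule ext)
  fix t :: real
  define S where "S n = (\<Sum>k\<le>n. ((\<i> * t)^k / fact k) * complex_of_real (LINT x|M1. x ^ k))" for n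
  have *: "S \<longlonglongrightarrow> char M t" if M: "real_distribution M" "AE x in M. \<bar>x\<bar> \<le> 1"
    "\<And>n. (LINT x|M. x ^ n) = (LINT x|M1. x ^ n)" for M
  proof (rule Lim_transform_bound[THEN LIM_zero_cancel])
    interpret real_distribution M by fact
    have ae: "AE x in M. norm (x ^ k) \<le> 1" for k
      using M(2) by eventually_elim (auto simp: power_abs power_le_one)
    have i: "integrable M (\<lambda>x. x ^ k)" for k
      by (rule integrable_const_bound[OF ae]) simp
    have "(LINT x|M. \<bar>x\<bar> ^ n) \<le> (LINT x|M. 1)" for n
      using integrable_abs[OF i[of n]] ae[of n] by (intro integral_mono_AE) (auto simp: power_abs)
    then have E1: "(LINT x|M. \<bar>x\<bar> ^ n) \<le> 1" for n by (simp add: prob_UNIV)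
    show "\<forall>\<^sub>F n in sequentially. norm (S n - char M t) \<le> norm (2 * \<bar>t\<bar>^n / fact n)"
    proof (intro always_eventually allI)
      fix n
      have "norm (S n - char M t) \<le> (2 * \<bar>t\<bar>^n / fact n) * (LINT x|M. \<bar>x\<bar> ^ n)"
        using char_approx1[of n t] i M(3) by (simp add: S_def norm_minus_commute)
      also have "\<dots> \<le> (2 * \<bar>t\<bar>^n / fact n) * 1" using E1 by (intro mult_left_mono) auto
      finally show "norm (S n - char M t) \<le> norm (2 * \<bar>t\<bar>^n / fact n)" by simp
    qed
    have "(\<lambda>n. 2 * (\<bar>t\<bar>^n / fact n)) \<longlonglongrightarrow> 2 * 0"
      using summable_LIMSEQ_zero[OF summable_exp[of "\<bar>t\<bar>"]] by (intro tendsto_mult_left) (simp add: field_simps)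
    then show "(\<lambda>n. 2 * \<bar>t\<bar>^n / fact n) \<longlonglongrightarrow> 0" by simp
  qed
  show "char M1 t = char M2 t"
    using *[OF assms(1) b(1)] *[OF assms(2) b(2)] eq LIMSEQ_unique by metis
qed

text \<open>The logistic map \<open>Q\<close> sends the line into \<open>(0, 1)\<close>, where
  moments are decisive; its inverse, the logit, recovers the measure.\<close>

lemma tanh_transform_unique:
  assumes "real_distribution M1" "real_distribution M2"
    and eq: "\<And>a. tanh_transform M1 a = tanh_transform M2 a"
  shows "M1 = M2"
proof -
  define Q where "Q y = 1 - 1 / (1 + exp y)" for y :: real
  have Q: "0 < Q y" "Q y < 1" for y by (simp_all add: Q_def add_pos_pos)
  have mQ[measurable]: "Q \<in> borel_measurable borel" unfolding Q_def by measurable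
  have inv: "ln (Q y / (1 - Q y)) = y" for y
  proof -
    have "1 + exp y \<noteq> 0" using exp_gt_zero[of y] by linarith
    then have "Q y / (1 - Q y) = exp y" by (simp add: Q_def field_simps)
    then show ?thesis by simp
  qed
  have undo: "distr (distr M borel Q) borel (\<lambda>q. ln (q / (1 - q))) = M" if "real_distribution M" for M
  proof -
    interpret real_distribution M by fact
    have "distr (distr M borel Q) borel (\<lambda>q. ln (q / (1 - q))) = distr M borel ((\<lambda>q. ln (q / (1 - q))) \<circ> Q)"
      by (rule distr_distr) auto
    also have "\<dots> = distr M M (\<lambda>x. x)" by (rule distr_cong) (auto simp: inv)
    finally show ?thesis by simp
  qed
  have rd: "real_distribution (distr M borel Q)" "AE x in distr M borel Q. \<bar>x\<bar> \<le> 1"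
    "(LINT x|distr M borel Q. x ^ n) = (LINT y|M. Q y ^ n)" if "real_distribution M" for M n
  proof -
    interpret real_distribution M by fact
    show "real_distribution (distr M borel Q)" by (rule real_distribution_distr) simp
    show "AE x in distr M borel Q. \<bar>x\<bar> \<le> 1"
      using Q by (subst AE_distr_iff) (auto simp: abs_le_iff less_imp_le intro!: AE_I2 order_trans[of "- Q _" 0 1])
    show "(LINT x|distr M borel Q. x ^ n) = (LINT y|M. Q y ^ n)" by (rule integral_distr) auto
  qed
  have "distr M1 borel Q = distr M2 borel Q"
    using rd[OF assms(1)] rd[OF assms(2)] logistic_moments_eq[OF assms] unfolding Q_def[abs_def]
    by (intro real_distribution_eq_moments) auto
  then show ?thesis using undo[OF assms(1)] undo[OF assms(2)] by metis
qed

text \<open>Justifies the definite descriptions. Equal transforms have equal inverses of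
  \<open>eta_transform\<close>, so the two tanh transforms attain each value at the same
  point.\<close>

lemma Sigma_transform_unique:
  assumes \<mu>: "prob_measure_Rpos \<mu>" and \<nu>: "prob_measure_Rpos \<nu>"
    and eq: "\<And>z. z \<in> complex_of_real ` {..<0} \<Longrightarrow> Sigma_transform \<mu> z = Sigma_transform \<nu> z"
  shows "\<mu> = \<nu>"
proof -
  interpret L: real_distribution "distr \<mu> borel ln" by (rule real_distribution_ln[OF \<mu>])
  interpret N: real_distribution "distr \<nu> borel ln" by (rule real_distribution_ln[OF \<nu>])
  have "tanh_transform (distr \<mu> borel ln) a = tanh_transform (distr \<nu> borel ln) a" for a
  proof -
    define x where "x = tanh_transform (distr \<mu> borel ln) a"
    have x: "- 1 < x" "x < 1" using L.tanh_transform_bounds by (auto simp: x_def)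
    then obtain b where b: "tanh_transform (distr \<nu> borel ln) b = x" using N.tanh_transform_surj by blast
    define z where "z = complex_of_real ((x - 1) / (x + 1))"
    have neg: "(x - 1) / (x + 1) < 0" using x by (simp add: divide_neg_pos)
    then have "z \<in> complex_of_real ` {..<0}" "z \<noteq> 0" unfolding z_def by (auto simp del: of_real_divide)
    then have "eta_inverse \<mu> z = eta_inverse \<nu> z"
      using eq[of z] by (simp add: Sigma_transform_def)
    moreover have "eta_inverse \<mu> z = of_real (- exp (- a))"
      using eta_inverse_neg[OF \<mu>, of a] by (simp only: z_def x_def)
    moreover have "eta_inverse \<nu> z = of_real (- exp (- b))"
      using eta_inverse_neg[OF \<nu>, of b] by (simp only: z_def b)
    ultimately have "a = b" by simp
    then show ?thesis using b x_def by simp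
  qed
  then have ln_eq: "distr \<mu> borel ln = distr \<nu> borel ln"
    by (rule tanh_transform_unique[OF L.real_distribution_axioms N.real_distribution_axioms])
  have "\<mu> = distr (distr \<mu> borel ln) borel exp" by (rule distr_exp_ln[OF \<mu>, symmetric])
  also have "\<dots> = \<nu>" unfolding ln_eq by (rule distr_exp_ln[OF \<nu>])
  finally show ?thesis .
qed

section \<open>Boundary values and unimodality\<close>

text \<open>Since \<open>cot (v / 2)\<close> tends to infinity with \<open>v\<close> to
  \<open>0\<close>, this antiderivative shows that the kernel concentrates with total mass
  \<open>2 * pi\<close>; hence the constant in the boundary estimates.\<close>

lemma Poisson_antideriv:
  fixes u v y :: real
  assumes v: "0 < v" "v < pi"
  shows "((\<lambda>y. 2 * arctan (cot (v / 2) * tanh ((y - u) / 2))) has_real_derivative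
    sin v / (cosh (u - y) - cos v)) (at y)"
proof -
  define c s C S where "c = cos (v / 2)" and "s = sin (v / 2)" and "C = cosh ((y - u) / 2)" and "S = sinh ((y - u) / 2)"
  have s: "s > 0" unfolding s_def using v by (intro sin_gt_zero) auto
  have C: "C > 0" unfolding C_def by (rule cosh_real_pos)
  have sc: "s\<^sup>2 + c\<^sup>2 = 1" by (simp add: s_def c_def)
  have CS: "C\<^sup>2 = S\<^sup>2 + 1" by (simp add: C_def S_def cosh_square_eq)
  have ch: "cosh (u - y) = C\<^sup>2 + S\<^sup>2"
  proof -
    have "cosh (u - y) = cosh (- (u - y))" by (rule cosh_minus[symmetric])
    also have "- (u - y) = 2 * ((y - u) / 2)" by simp
    finally show ?thesis unfolding C_def S_def cosh_double .
  qed
  have cv: "cos v = c\<^sup>2 - s\<^sup>2" using cos_double[of "v / 2"] by (simp add: c_def s_def)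
  have sv: "sin v = 2 * s * c" using sin_double[of "v / 2"] by (simp add: c_def s_def)
  have D: "cosh (u - y) - cos v = 2 * (s\<^sup>2 * C\<^sup>2 + c\<^sup>2 * S\<^sup>2)"
    unfolding ch cv using CS sc by algebra
  have Dpos: "s\<^sup>2 * C\<^sup>2 + c\<^sup>2 * S\<^sup>2 > 0"
    using s C by (intro add_pos_nonneg mult_pos_pos) auto
  have "((\<lambda>y. 2 * arctan (cot (v / 2) * tanh ((y - u) / 2))) has_real_derivative
      2 * (inverse (1 + (cot (v / 2) * tanh ((y - u) / 2))\<^sup>2) * (cot (v / 2) * ((1 - (tanh ((y - u) / 2))\<^sup>2) * (1 / 2))))) (at y)"
    by (auto intro!: derivative_eq_intros simp: power2_eq_square)
  also have "2 * (inverse (1 + (cot (v / 2) * tanh ((y - u) / 2))\<^sup>2) * (cot (v / 2) * ((1 - (tanh ((y - u) / 2))\<^sup>2) * (1 / 2)))) =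
      inverse (1 + (c / s * (S / C))\<^sup>2) * (c / s * (1 - (S / C)\<^sup>2))"
    by (simp add: cot_def tanh_def c_def s_def C_def S_def)
  also have "1 + (c / s * (S / C))\<^sup>2 = (s\<^sup>2 * C\<^sup>2 + c\<^sup>2 * S\<^sup>2) / (s\<^sup>2 * C\<^sup>2)"
    using s C by (simp add: power_mult_distrib power_divide add_divide_distrib)
  also have "1 - (S / C)\<^sup>2 = 1 / C\<^sup>2"
  proof -
    have "C\<^sup>2 - S\<^sup>2 = 1" using CS by simp
    moreover have "1 - (S / C)\<^sup>2 = (C\<^sup>2 - S\<^sup>2) / C\<^sup>2" using C by (simp add: power_divide diff_divide_distrib)
    ultimately show ?thesis by simp
  qed
  also have "inverse ((s\<^sup>2 * C\<^sup>2 + c\<^sup>2 * S\<^sup>2) / (s\<^sup>2 * C\<^sup>2)) * (c / s * (1 / C\<^sup>2)) = sin v / (cosh (u - y) - cos v)"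
    unfolding D sv using s C Dpos by (simp add: field_simps power2_eq_square)
  finally show ?thesis .
qed

lemma Poisson_nn_integral:
  fixes u v a b :: real
  assumes v: "0 < v" "v < pi" and "a \<le> b"
  shows "(\<integral>\<^sup>+y. ennreal (sin v / (cosh (u - y) - cos v)) * indicator {a..b} y \<partial>lborel) =
    ennreal (2 * arctan (cot (v / 2) * tanh ((b - u) / 2)) - 2 * arctan (cot (v / 2) * tanh ((a - u) / 2)))"
proof (rule nn_integral_FTC_Icc[where F = "\<lambda>y. 2 * arctan (cot (v / 2) * tanh ((y - u) / 2))"])
  show "(\<lambda>y. sin v / (cosh (u - y) - cos v)) \<in> borel_measurable borel"
    by (simp add: cosh_def)
  show "0 \<le> sin v / (cosh (u - y) - cos v)" for y
    using sin_gt_zero[OF v] cosh_minus_cos_pos[of v "u - y"] v by simp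
qed (use assms Poisson_antideriv[OF v] in auto)

text \<open>Domination is known only inside \<open>I\<close>, so both measures are first restricted
  to \<open>I\<close> by an indicator density.\<close>

lemma nn_integral_mono_local_measure:
  assumes sets: "sets M = sets N" and I: "I \<in> sets N"
    and le: "\<And>A. A \<in> sets N \<Longrightarrow> A \<subseteq> I \<Longrightarrow> emeasure M A \<le> emeasure N A"
    and f: "f \<in> borel_measurable N"
  shows "(\<integral>\<^sup>+x. f x * indicator I x \<partial>M) \<le> (\<integral>\<^sup>+x. f x * indicator I x \<partial>N)"
proof -
  have f': "f \<in> borel_measurable M" using f measurable_cong_sets[OF sets refl] by blast
  have IM: "I \<in> sets M" using I sets by simp
  have "density M (indicator I) \<le> density N (indicator I)"
  proof (subst le_measure)
    show "sets (density M (indicator I)) = sets (density N (indicator I))" using sets by simp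
    show "\<forall>A\<in>sets (density M (indicator I)). emeasure (density M (indicator I)) A \<le> emeasure (density N (indicator I)) A"
    proof
      fix A assume "A \<in> sets (density M (indicator I))"
      then have A: "A \<in> sets M" "A \<in> sets N" using sets by auto
      have "emeasure (density M (indicator I)) A = emeasure M (I \<inter> A)"
        using A IM by (subst emeasure_density) (auto simp flip: indicator_inter_arith)
      also have "\<dots> \<le> emeasure N (I \<inter> A)" using A I by (intro le) auto
      also have "\<dots> = emeasure (density N (indicator I)) A"
        using A I by (subst emeasure_density) (auto simp flip: indicator_inter_arith)
      finally show "emeasure (density M (indicator I)) A \<le> emeasure (density N (indicator I)) A" .
    qed
  qed
  then have "(\<integral>\<^sup>+x. f x \<partial>density M (indicator I)) \<le> (\<integral>\<^sup>+x. f x \<partial>density N (indicator I))"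
    using sets by (intro nn_integral_mono_measure) auto
  then show ?thesis
    using f f' I IM by (simp add: nn_integral_density mult.commute)
qed

context real_distribution
begin

lemma Im_coth_transform_nn_integral:
  assumes z: "0 < Im z" "Im z < pi"
  shows "ennreal (- Im (coth_transform M z)) = (\<integral>\<^sup>+y. ennreal (sin (Im z) / (cosh (Re z - y) - cos (Im z))) \<partial>M)"
proof -
  have "- Im (coth_transform M z) = (LINT y|M. sin (Im z) / (cosh (Re z - y) - cos (Im z)))"
    using Im_coth_transform[of z] z by simp
  also have "ennreal \<dots> = (\<integral>\<^sup>+y. ennreal (sin (Im z) / (cosh (Re z - y) - cos (Im z))) \<partial>M)"
  proof (rule nn_integral_eq_integral[symmetric])
    show "integrable M (\<lambda>y. sin (Im z) / (cosh (Re z - y) - cos (Im z)))"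
      using integrable_mult_right[OF integrable_Poisson[of "Im z" "Re z"], of "sin (Im z)"] z by simp
    show "AE y in M. 0 \<le> sin (Im z) / (cosh (Re z - y) - cos (Im z))"
      using sin_gt_zero[OF z] cosh_minus_cos_pos[of "Im z"] z by (intro AE_I2) (simp add: less_imp_le)
  qed
  finally show ?thesis .
qed

text \<open>Near \<open>x\<close> the measure is compared with \<open>m\<close> times Lebesgue
  measure, for which the kernel has mass at most \<open>2 * pi\<close>; away from \<open>x\<close>
  the kernel vanishes in the limit. Both bounds allow any direction of approach, as nothing is known
  about how the images of points on a vertical line approach the boundary.\<close>

lemma boundary_value_le:
  assumes Z: "Z \<longlonglongrightarrow> of_real x" "\<And>n. 0 < Im (Z n)" "\<And>n. Im (Z n) < pi"
    and L: "(\<lambda>n. - Im (coth_transform M (Z n))) \<longlonglongrightarrow> L"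
    and d: "0 < d" and m: "0 \<le> m"
    and le: "\<And>A. A \<in> sets borel \<Longrightarrow> A \<subseteq> {x - d..x + d} \<Longrightarrow> emeasure M A \<le> ennreal m * emeasure lborel A"
  shows "L \<le> 2 * pi * m"
proof -
  define u v where "u n = Re (Z n)" and "v n = Im (Z n)" for n
  have u: "u \<longlonglongrightarrow> x" using tendsto_Re[OF Z(1)] by (simp add: u_def[abs_def])
  have v0: "v \<longlonglongrightarrow> 0" using tendsto_Im[OF Z(1)] by (simp add: v_def[abs_def])
  have v: "0 < v n" "v n < pi" for n using Z by (simp_all add: v_def)
  define k where "k n y = sin (v n) / (cosh (u n - y) - cos (v n))" for n and y :: real
  have kpos: "0 \<le> k n y" for n y
    using sin_gt_zero[OF v] cosh_minus_cos_pos[of "v n" "u n - y"] v[of n] by (simp add: k_def less_imp_le)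
  have mk[measurable]: "k n \<in> borel_measurable borel" for n unfolding k_def by (simp add: cosh_def)
  \<comment> \<open>Bounds the kernel at distance at least \<open>d / 2\<close> from its centre
    \<open>u n\<close>.\<close>
  define E where "E n = sin (v n) / (cosh (d / 2) - 1)" for n
  have chd: "1 < cosh (d / 2)" using d cosh_real_strict_mono[of 0 "d / 2"] by simp
  have near: "(\<integral>\<^sup>+y. ennreal (k n y) * indicator {x - d..x + d} y \<partial>M) \<le> ennreal (2 * pi * m)" for n
  proof -
    define N where "N = density lborel (\<lambda>_::real. ennreal m)"
    have eN: "emeasure N A = ennreal m * emeasure lborel A" if "A \<in> sets borel" for A
      unfolding N_def using that by (subst emeasure_density) (auto simp: nn_integral_cmult_indicator)
    have "(\<integral>\<^sup>+y. ennreal (k n y) * indicator {x - d..x + d} y \<partial>M) \<le>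
        (\<integral>\<^sup>+y. ennreal (k n y) * indicator {x - d..x + d} y \<partial>N)"
      using le by (intro nn_integral_mono_local_measure) (auto simp: N_def eN[unfolded N_def])
    also have "\<dots> = ennreal m * (\<integral>\<^sup>+y. ennreal (k n y) * indicator {x - d..x + d} y \<partial>lborel)"
      unfolding N_def by (subst nn_integral_density) (auto simp: nn_integral_cmult)
    also have "\<dots> \<le> ennreal m * ennreal (2 * pi)"
    proof (rule mult_left_mono)
      show "(\<integral>\<^sup>+y. ennreal (k n y) * indicator {x - d..x + d} y \<partial>lborel) \<le> ennreal (2 * pi)"
    proof -
      define A B where "A = arctan (cot (v n / 2) * tanh ((x + d - u n) / 2))"
        and "B = arctan (cot (v n / 2) * tanh ((x - d - u n) / 2))"
      have "2 * A - 2 * B \<le> 2 * pi"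
        using arctan_ubound arctan_lbound unfolding A_def B_def by (smt (verit) field_sum_of_halves)
      then have "ennreal (2 * A - 2 * B) \<le> ennreal (2 * pi)" by (rule ennreal_leI)
      moreover have "x - d \<le> x + d" using d by simp
      ultimately show ?thesis unfolding k_def Poisson_nn_integral[OF v \<open>x - d \<le> x + d\<close>] A_def B_def by simp
    qed
    qed simp
    also have "\<dots> = ennreal (2 * pi * m)" using m by (simp add: ennreal_mult[symmetric] mult.commute)
    finally show ?thesis .
  qed
  have far: "(\<integral>\<^sup>+y. ennreal (k n y) * indicator (- {x - d..x + d}) y \<partial>M) \<le> ennreal (E n)"
    if n: "\<bar>u n - x\<bar> < d / 2" for n
  proof -
    have "(\<integral>\<^sup>+y. ennreal (k n y) * indicator (- {x - d..x + d}) y \<partial>M) \<le> (\<integral>\<^sup>+y. ennreal (E n) \<partial>M)"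
    proof (rule nn_integral_mono)
      fix y
      show "ennreal (k n y) * indicator (- {x - d..x + d}) y \<le> ennreal (E n)"
      proof (cases "y \<in> {x - d..x + d}")
        case False
        then have "y < x - d \<or> x + d < y" by auto
        then have "d / 2 \<le> \<bar>u n - y\<bar>" using n by linarith
        then have "cosh (d / 2) \<le> cosh (u n - y)"
          using cosh_real_nonneg_le_iff[of "d / 2" "\<bar>u n - y\<bar>"] d by simp
        then have "cosh (d / 2) - 1 \<le> cosh (u n - y) - cos (v n)"
          using cos_le_one[of "v n"] by linarith
        then have "k n y \<le> E n"
          unfolding k_def E_def using chd sin_gt_zero[OF v, of n]
          by (intro divide_left_mono mult_pos_pos) auto
        then show ?thesis using False by (simp add: ennreal_leI)
      qed simp
    qed
    also have "\<dots> = ennreal (E n)" using emeasure_space_1 by (simp del: space_eq_univ)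
    finally show ?thesis .
  qed
  have bound: "- Im (coth_transform M (Z n)) \<le> 2 * pi * m + E n" if n: "\<bar>u n - x\<bar> < d / 2" for n
  proof -
    have En: "0 \<le> E n" using chd sin_gt_zero[OF v, of n] by (simp add: E_def)
    have "ennreal (- Im (coth_transform M (Z n))) = (\<integral>\<^sup>+y. ennreal (k n y) \<partial>M)"
      using Im_coth_transform_nn_integral[of "Z n"] Z by (simp add: k_def u_def v_def)
    also have "\<dots> = (\<integral>\<^sup>+y. ennreal (k n y) * indicator {x - d..x + d} y + ennreal (k n y) * indicator (- {x - d..x + d}) y \<partial>M)"
      by (intro nn_integral_cong) (auto simp: indicator_def)
    also have "\<dots> = (\<integral>\<^sup>+y. ennreal (k n y) * indicator {x - d..x + d} y \<partial>M) +
        (\<integral>\<^sup>+y. ennreal (k n y) * indicator (- {x - d..x + d}) y \<partial>M)"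
      by (intro nn_integral_add) auto
    also have "\<dots> \<le> ennreal (2 * pi * m) + ennreal (E n)" by (intro add_mono near far n)
    also have "\<dots> = ennreal (2 * pi * m + E n)" using m En by (intro ennreal_plus[symmetric]) auto
    finally show ?thesis using m En by (subst (asm) ennreal_le_iff) auto
  qed
  have "E \<longlonglongrightarrow> sin 0 / (cosh (d / 2) - 1)"
    unfolding E_def using chd by (intro tendsto_intros v0) auto
  then have "(\<lambda>n. 2 * pi * m + E n) \<longlonglongrightarrow> 2 * pi * m + 0" by (intro tendsto_intros) simp
  moreover have "\<forall>\<^sub>F n in sequentially. - Im (coth_transform M (Z n)) \<le> 2 * pi * m + E n"
  proof -
    have "\<forall>\<^sub>F n in sequentially. dist (u n) x < d / 2" using u d by (intro tendstoD) auto
    then show ?thesis by eventually_elim (use bound in \<open>simp add: dist_real_def\<close>)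
  qed
  ultimately show ?thesis using L by (intro tendsto_le[OF _ _ L]) auto
qed

text \<open>The kernel mass \<open>P n\<close> of the fixed interval tends to all of
  \<open>2 * pi\<close>; the mass of the measure outside the interval is discarded by
  positivity.\<close>

lemma boundary_value_ge:
  assumes Z: "Z \<longlonglongrightarrow> of_real x" "\<And>n. 0 < Im (Z n)" "\<And>n. Im (Z n) < pi"
    and L: "(\<lambda>n. - Im (coth_transform M (Z n))) \<longlonglongrightarrow> L"
    and d: "0 < d" and m: "0 \<le> m"
    and ge: "\<And>A. A \<in> sets borel \<Longrightarrow> A \<subseteq> {x - d..x + d} \<Longrightarrow> ennreal m * emeasure lborel A \<le> emeasure M A"
  shows "2 * pi * m \<le> L"
proof -
  define u v where "u n = Re (Z n)" and "v n = Im (Z n)" for n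
  have u: "u \<longlonglongrightarrow> x" using tendsto_Re[OF Z(1)] by (simp add: u_def[abs_def])
  have v0: "v \<longlonglongrightarrow> 0" using tendsto_Im[OF Z(1)] by (simp add: v_def[abs_def])
  have v: "0 < v n" "v n < pi" for n using Z by (simp_all add: v_def)
  define k where "k n y = sin (v n) / (cosh (u n - y) - cos (v n))" for n and y :: real
  have mk[measurable]: "k n \<in> borel_measurable borel" for n unfolding k_def by (simp add: cosh_def)
  define P where "P n = 2 * arctan (cot (v n / 2) * tanh ((x + d - u n) / 2)) - 2 * arctan (cot (v n / 2) * tanh ((x - d - u n) / 2))" for n
  have cotpos: "0 < cot (v n / 2)" for n
    unfolding cot_def using v[of n] by (intro divide_pos_pos cos_gt_zero sin_gt_zero) auto
  have P0: "0 \<le> P n" for n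
    unfolding P_def using d cotpos[of n] by (simp add: arctan_le_iff)
  have bound: "m * P n \<le> - Im (coth_transform M (Z n))" for n
  proof -
    define N where "N = density lborel (\<lambda>_::real. ennreal m)"
    have eN: "emeasure N A = ennreal m * emeasure lborel A" if "A \<in> sets borel" for A
      unfolding N_def using that by (subst emeasure_density) (auto simp: nn_integral_cmult_indicator)
    have "ennreal (m * P n) = ennreal m * (\<integral>\<^sup>+y. ennreal (k n y) * indicator {x - d..x + d} y \<partial>lborel)"
      unfolding k_def P_def using d m P0[of n, unfolded P_def]
      by (subst Poisson_nn_integral[OF v]) (auto simp: ennreal_mult)
    also have "\<dots> = (\<integral>\<^sup>+y. ennreal (k n y) * indicator {x - d..x + d} y \<partial>N)"
      unfolding N_def by (subst nn_integral_density) (auto simp: nn_integral_cmult)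
    also have "\<dots> \<le> (\<integral>\<^sup>+y. ennreal (k n y) * indicator {x - d..x + d} y \<partial>M)"
      using ge by (intro nn_integral_mono_local_measure) (auto simp: N_def eN[unfolded N_def])
    also have "\<dots> \<le> (\<integral>\<^sup>+y. ennreal (k n y) \<partial>M)"
      by (intro nn_integral_mono) (auto simp: indicator_def)
    also have "\<dots> = ennreal (- Im (coth_transform M (Z n)))"
      using Im_coth_transform_nn_integral[of "Z n"] Z by (simp add: k_def u_def v_def)
    finally show ?thesis
      using Im_coth_transform_neg[of "Z n"] Z by (subst (asm) ennreal_le_iff) (auto simp: less_imp_le)
  qed
  have cot_lim: "filterlim (\<lambda>n. cot (v n / 2)) at_top sequentially"
  proof -
    have sin_lim: "filterlim (\<lambda>n. sin (v n / 2)) (at_right 0) sequentially"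
      unfolding filterlim_at
    proof (intro conjI always_eventually allI)
      show "(\<lambda>n. sin (v n / 2)) \<longlonglongrightarrow> 0"
        using tendsto_sin[OF tendsto_divide[OF v0 tendsto_const[of 2]]] by simp
      show "sin (v n / 2) \<in> {0<..}" "sin (v n / 2) \<noteq> 0" for n
        using sin_gt_zero[of "v n / 2"] v[of n] by auto
    qed
    have cos_lim: "(\<lambda>n. cos (v n / 2)) \<longlonglongrightarrow> 1"
      using tendsto_cos[OF tendsto_divide[OF v0 tendsto_const[of 2]]] by simp
    have "filterlim (\<lambda>n. cos (v n / 2) * inverse (sin (v n / 2))) at_top sequentially"
      by (rule filterlim_tendsto_pos_mult_at_top[OF cos_lim zero_less_one
            filterlim_compose[OF filterlim_inverse_at_top_right sin_lim]])
    then show ?thesis by (simp only: cot_def divide_inverse)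
  qed
  have at1: "(\<lambda>n. arctan (cot (v n / 2) * r n)) \<longlonglongrightarrow> pi / 2" if r: "r \<longlonglongrightarrow> c" "0 < c" for r c
  proof -
    have "filterlim (\<lambda>n. r n * cot (v n / 2)) at_top sequentially"
      by (rule filterlim_tendsto_pos_mult_at_top[OF r cot_lim])
    then have "(\<lambda>n. arctan (r n * cot (v n / 2))) \<longlonglongrightarrow> pi / 2"
      by (rule filterlim_compose[OF tendsto_arctan_at_top])
    then show ?thesis by (simp add: mult.commute)
  qed
  have t: "(\<lambda>n. tanh ((x + d - u n) / 2)) \<longlonglongrightarrow> tanh ((x + d - x) / 2)"
    "(\<lambda>n. - tanh ((x - d - u n) / 2)) \<longlonglongrightarrow> - tanh ((x - d - x) / 2)"
    by (intro tendsto_minus tendsto_tanh tendsto_divide tendsto_diff tendsto_const u; simp)+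
  have "(\<lambda>n. arctan (cot (v n / 2) * tanh ((x + d - u n) / 2))) \<longlonglongrightarrow> pi / 2"
    by (rule at1[OF t(1)]) (use d in simp)
  moreover have "(\<lambda>n. arctan (cot (v n / 2) * - tanh ((x - d - u n) / 2))) \<longlonglongrightarrow> pi / 2"
    by (rule at1[OF t(2)]) (use d in simp)
  ultimately have "(\<lambda>n. m * (2 * arctan (cot (v n / 2) * tanh ((x + d - u n) / 2)) +
      2 * arctan (cot (v n / 2) * - tanh ((x - d - u n) / 2)))) \<longlonglongrightarrow> m * (2 * (pi / 2) + 2 * (pi / 2))"
    by (intro tendsto_intros)
  then have "(\<lambda>n. m * P n) \<longlonglongrightarrow> 2 * pi * m" by (simp add: P_def arctan_minus algebra_simps)
  then show ?thesis using bound by (intro tendsto_le[OF _ L]) auto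
qed

end

section \<open>Boundary values of the subordinated measure\<close>

context real_distribution
begin

text \<open>The hypothesis \<open>line\<close> identifies two holomorphic functions on
  \<open>Im z = pi\<close> only; the identity theorem extends this to the strip and so makes it
  usable near the real boundary.\<close>

lemma coth_transform_subordinated:
  assumes t: "0 < t" and \<mu>: "real_distribution \<mu>"
    and line: "\<And>b. tanh_transform \<mu> (b + t / 2 * tanh_transform M b) = tanh_transform M b"
    and w: "w \<in> strip" "\<Phi> t w \<in> strip"
  shows "coth_transform \<mu> (\<Phi> t w) = coth_transform M w"
proof -
  obtain \<omega> where \<omega>: "\<omega> holomorphic_on strip"
    "\<And>z. z \<in> strip \<Longrightarrow> \<omega> z \<in> strip" "\<And>z. z \<in> strip \<Longrightarrow> \<Phi> t (\<omega> z) = z"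
    "\<And>w. w \<in> strip \<Longrightarrow> \<Phi> t w \<in> strip \<Longrightarrow> \<omega> (\<Phi> t w) = w"
    by (rule subordination_function[OF t]) blast
  interpret \<mu>: real_distribution \<mu> by (rule \<mu>)
  define f where "f z = coth_transform \<mu> z - (coth_transform M \<circ> \<omega>) z" for z
  have f_hol: "f holomorphic_on strip"
    unfolding f_def using \<omega>(2)
    by (intro holomorphic_intros \<mu>.holomorphic_coth_transform
        holomorphic_on_compose_gen[OF \<omega>(1) holomorphic_coth_transform]) auto
  have f0: "f z = 0" if z: "z \<in> {z. Im z = pi}" for z
  proof -
    have zs: "z \<in> strip" using z by simp
    define b where "b = Re (\<omega> z)"
    have "Im (\<omega> z) = pi"
      using Im_subordination_map_less_pi(2)[OF t, of "\<omega> z"] \<omega>(2,3)[OF zs] z by simp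
    then have wz: "\<omega> z = Complex b pi" by (simp add: b_def complex_eq_iff)
    then have ze: "z = Complex (b + t / 2 * tanh_transform M b) pi"
      using \<omega>(3)[OF zs] subordination_map_pi by metis
    have "coth_transform \<mu> z = of_real (tanh_transform M b)"
      unfolding ze \<mu>.coth_transform_pi line ..
    moreover have "coth_transform M (\<omega> z) = of_real (tanh_transform M b)"
      unfolding wz by (rule coth_transform_pi)
    ultimately show ?thesis by (simp add: f_def)
  qed
  have "f (\<Phi> t w) = 0"
  proof (rule analytic_continuation[OF f_hol open_strip convex_connected[OF convex_strip]])
    show "{z. Im z = pi} \<subseteq> strip" by auto
    show "Complex 0 pi \<in> strip" by simp
    show "Complex 0 pi islimpt {z. Im z = pi}"
    proof (rule connected_imp_perfect)
      have "{z. Im z = pi} = {z. pi \<le> Im z} \<inter> {z. Im z \<le> pi}" by auto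
      then show "connected {z. Im z = pi}"
        by (simp only:) (intro convex_connected convex_Int convex_halfspace_Im_ge convex_halfspace_Im_le)
      show "{z. Im z = pi} \<noteq> {x}" for x
      proof
        assume eq: "{z. Im z = pi} = {x}"
        have "Complex 0 pi \<in> {x}" "Complex 1 pi \<in> {x}" unfolding eq[symmetric] by auto
        then have "Complex 0 pi = Complex 1 pi" by simp
        then show False by simp
      qed
    qed simp
  qed (use f0 w in auto)
  then show ?thesis using \<omega>(4)[OF w] by (simp add: f_def)
qed

text \<open>Descending vertically to the boundary of \<open>{w. 0 < Im (\<Phi> w)}\<close> above \<open>s\<close>, at height \<open>v\<close>, the image
  under \<open>\<Phi>\<close> approaches a real point \<open>x\<close>, at which \<open>\<mu>\<close> has density \<open>v / (pi * t)\<close>.\<close>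

lemma boundary_approach:
  assumes t: "0 < t" and \<mu>: "real_distribution \<mu>"
    and line: "\<And>b. tanh_transform \<mu> (b + t / 2 * tanh_transform M b) = tanh_transform M b"
  obtains Z v x where "Z \<longlonglongrightarrow> complex_of_real x" "\<And>n. 0 < Im (Z n)" "\<And>n. Im (Z n) < pi"
    "(\<lambda>n. - Im (coth_transform \<mu> (Z n))) \<longlonglongrightarrow> 2 * v / t" "\<bar>x - s\<bar> \<le> sqrt (t + t\<^sup>2 / 4)" "0 \<le> v"
    "\<And>v0. 0 < v0 \<Longrightarrow> v0 < pi \<Longrightarrow> Im (\<Phi> t (Complex s v0)) < 0 \<Longrightarrow> v0 < v"
    "\<And>v0. 0 < v0 \<Longrightarrow> v0 < pi \<Longrightarrow> 0 < Im (\<Phi> t (Complex s v0)) \<Longrightarrow> v \<le> v0"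
proof -
  define e where "e n = 1 / (real n + 1)" for n
  have e: "0 < e n" "e n < pi" for n
  proof -
    have "e n \<le> 1" by (simp add: e_def)
    then show "e n < pi" using pi_gt3 by linarith
  qed (simp add: e_def)
  have e0: "e \<longlonglongrightarrow> 0" unfolding e_def by real_asymp
  define r where "r = sqrt (t + t\<^sup>2 / 4)"
  define W where "W n = Complex s (level t (e n) s)" for n
  have W: "0 < Im (W n)" "Im (W n) < pi" "Im (\<Phi> t (W n)) = e n" for n
    using level[OF e t, where s = s] by (auto simp: W_def)
  \<comment> \<open>Packs the real part of the image and the height of the preimage into one bounded
    complex sequence, so that one subsequence serves both.\<close>
  define p where "p n = Complex (Re (\<Phi> t (W n))) (Im (W n))" for n
  have pb: "\<bar>Re (p n) - s\<bar> \<le> r" for n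
    using Re_subordination_map_bound[OF W(1,2) t, of n] W(3)[of n] e[of n] by (simp add: p_def r_def W_def)
  have "bounded (range p)"
    unfolding bounded_iff
  proof (intro exI[of _ "(\<bar>s\<bar> + r) + pi"] ballI)
    fix z assume "z \<in> range p"
    then obtain n where n: "z = p n" by auto
    have "cmod (p n) \<le> \<bar>Re (p n)\<bar> + \<bar>Im (p n)\<bar>" by (rule cmod_le)
    also have "\<dots> \<le> (\<bar>s\<bar> + r) + pi" using pb[of n] W[of n] by (intro add_mono) (auto simp: p_def)
    finally show "cmod z \<le> (\<bar>s\<bar> + r) + pi" using n by simp
  qed
  then obtain l h where h: "strict_mono (h :: nat \<Rightarrow> nat)" and l: "(p \<circ> h) \<longlonglongrightarrow> l"
    using bounded_imp_convergent_subsequence by blast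
  define Z where "Z n = \<Phi> t (W (h n))" for n
  define x v where "x = Re l" and "v = Im l"
  have ReZ: "(\<lambda>n. Re (Z n)) \<longlonglongrightarrow> x" and ImW: "(\<lambda>n. Im (W (h n))) \<longlonglongrightarrow> v"
    using tendsto_Re[OF l] tendsto_Im[OF l] by (simp_all add: p_def comp_def Z_def x_def v_def)
  have eh: "(\<lambda>n. e (h n)) \<longlonglongrightarrow> 0" using LIMSEQ_subseq_LIMSEQ[OF e0 h] by (simp add: comp_def)
  have ImZ: "Im (Z n) = e (h n)" for n by (simp add: Z_def W)
  show thesis
  proof (rule that[of Z x v])
    have "(\<lambda>n. Complex (Re (Z n)) (Im (Z n))) \<longlonglongrightarrow> Complex x 0"
      unfolding ImZ by (intro tendsto_Complex ReZ eh)
    then show "Z \<longlonglongrightarrow> complex_of_real x" by (simp add: complex_of_real_def)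
    show "0 < Im (Z n)" "Im (Z n) < pi" for n using e by (simp_all add: ImZ)
    have "- Im (coth_transform \<mu> (Z n)) = 2 / t * (Im (W (h n)) - e (h n))" for n
    proof -
      have "coth_transform \<mu> (Z n) = coth_transform M (W (h n))"
        unfolding Z_def using W[of "h n"] e[of "h n"] by (intro coth_transform_subordinated t \<mu> line) auto
      moreover have "e (h n) = Im (W (h n)) + t / 2 * Im (coth_transform M (W (h n)))"
        using W(3)[of "h n"] by (simp add: subordination_map_def)
      ultimately show ?thesis using t by (simp add: field_simps)
    qed
    moreover have "(\<lambda>n. 2 / t * (Im (W (h n)) - e (h n))) \<longlonglongrightarrow> 2 / t * (v - 0)"
      by (intro tendsto_intros ImW eh)
    ultimately show "(\<lambda>n. - Im (coth_transform \<mu> (Z n))) \<longlonglongrightarrow> 2 * v / t" by simp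
    have "(\<lambda>n. \<bar>Re (Z n) - s\<bar>) \<longlonglongrightarrow> \<bar>x - s\<bar>" by (intro tendsto_intros ReZ)
    then show "\<bar>x - s\<bar> \<le> sqrt (t + t\<^sup>2 / 4)"
      using pb by (intro tendsto_le[OF _ tendsto_const, of sequentially]) (auto simp: p_def Z_def r_def)
    show "0 \<le> v"
      by (rule tendsto_le[OF _ ImW tendsto_const]) (use W in \<open>auto intro!: always_eventually less_imp_le\<close>)
    show "v0 < v" if v0: "0 < v0" "v0 < pi" and neg: "Im (\<Phi> t (Complex s v0)) < 0" for v0
    proof -
      have gt: "v0 < Im (W n)" for n
      proof (rule ccontr)
        assume "\<not> v0 < Im (W n)"
        then have le: "Im (W n) \<le> v0" by simp
        have "0 < Im (\<Phi> t (Complex s (Im (W n))))"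
          using W(3)[of n] e[of n] by (simp add: W_def)
        moreover have "Im (W n) = v0 \<or> Im (W n) < v0" using le by auto
        ultimately show False
          using Im_subordination_map_strict_mono[of "Im (W n)" v0 t s] W[of n] v0 t neg by fastforce
      qed
      have "v0 \<le> v"
        by (rule tendsto_le[OF _ ImW tendsto_const]) (use gt in \<open>auto intro!: always_eventually less_imp_le\<close>)
      \<comment> \<open>Along the approach \<open>Im \<circ> \<Phi>\<close> tends to
        \<open>0\<close>, whereas \<open>v = v0\<close> would by continuity give a negative
        limit.\<close>
      moreover have "v \<noteq> v0"
      proof
        assume "v = v0"
        then have "(\<lambda>n. Im (\<Phi> t (Complex s (Im (W (h n)))))) \<longlonglongrightarrow> Im (\<Phi> t (Complex s v0))"
          using ImW v0 by (intro isCont_tendsto_compose[OF continuous_Im_subordination_map(2)]) auto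
        then have "(\<lambda>n. e (h n)) \<longlonglongrightarrow> Im (\<Phi> t (Complex s v0))"
          using W(3) by (simp add: W_def)
        then show False using eh LIMSEQ_unique neg by fastforce
      qed
      ultimately show ?thesis by simp
    qed
    show "v \<le> v0" if v0: "0 < v0" "v0 < pi" and pos: "0 < Im (\<Phi> t (Complex s v0))" for v0
    proof (rule tendsto_le[OF _ tendsto_const ImW])
      have "\<forall>\<^sub>F n in sequentially. e (h n) < Im (\<Phi> t (Complex s v0))"
        using eh pos by (rule order_tendstoD(2))
      then show "\<forall>\<^sub>F n in sequentially. Im (W (h n)) \<le> v0"
      proof eventually_elim
        case (elim n)
        show ?case
        proof (rule ccontr)
          assume "\<not> Im (W (h n)) \<le> v0"
          then have "Im (\<Phi> t (Complex s v0)) < Im (\<Phi> t (Complex s (Im (W (h n)))))"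
            using v0 pos W[of "h n"] t by (intro Im_subordination_map_strict_mono) auto
          then show False using elim W(3)[of "h n"] by (simp add: W_def)
        qed
      qed
    qed simp
  qed
qed

end

text \<open>The density may jump at the points \<open>x i\<close>, so the limits are compared
  through the values of \<open>f\<close> at the midpoints \<open>p\<close> and \<open>q\<close>,
  which bound \<open>f\<close> on whole neighbourhoods of the \<open>x i\<close> on the relevant
  side of the mode.\<close>

lemma unimodal_boundary_values:
  assumes uni: "unimodal_with_mode \<mu> a" and \<mu>: "real_distribution \<mu>"
    and Z: "\<And>i. Z i \<longlonglongrightarrow> complex_of_real (x i)" "\<And>i n. 0 < Im (Z i n)" "\<And>i n. Im (Z i n) < pi"
    and L: "\<And>i. (\<lambda>n. - Im (coth_transform \<mu> (Z i n))) \<longlonglongrightarrow> L i"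
    and x: "x 0 < x 1" "x 1 < x (2::nat)"
  shows "min (L 0) (L 2) \<le> L 1"
proof -
  interpret real_distribution \<mu> by (rule \<mu>)
  obtain c f where f0: "\<And>x. 0 \<le> f x" and up: "mono_on {..<a} f" and down: "antimono_on {a<..} f"
    and em: "\<And>A. A \<in> sets borel \<Longrightarrow> emeasure \<mu> A = c * indicator A a + (\<integral>\<^sup>+x\<in>A. ennreal (f x) \<partial>lborel)"
    using uni unfolding unimodal_with_mode_def by auto
  have up: "f p \<le> f q" if "p \<le> q" "q < a" for p q
    using monotone_onD[OF up, of p q] that by auto
  have down: "f q \<le> f p" if "a < p" "p \<le> q" for p q
    using monotone_onD[OF down, of p q] that by auto
  have upper: "L i \<le> 2 * pi * m" if d: "0 < d" and m: "0 \<le> m" and a: "a \<notin> {x i - d..x i + d}"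
    and fm: "\<And>y. y \<in> {x i - d..x i + d} \<Longrightarrow> f y \<le> m" for i d m
  proof (rule boundary_value_le[OF Z L d m])
    fix A :: "real set" assume A: "A \<in> sets borel" "A \<subseteq> {x i - d..x i + d}"
    have "emeasure \<mu> A = (\<integral>\<^sup>+x\<in>A. ennreal (f x) \<partial>lborel)" using em[OF A(1)] A(2) a by (auto simp: indicator_def)
    also have "\<dots> \<le> (\<integral>\<^sup>+x. ennreal m * indicator A x \<partial>lborel)"
      using fm A(2) by (intro nn_integral_mono) (auto simp: indicator_def ennreal_leI)
    also have "\<dots> = ennreal m * emeasure lborel A" using A(1) by (simp add: nn_integral_cmult_indicator)
    finally show "emeasure \<mu> A \<le> ennreal m * emeasure lborel A" .
  qed
  have lower: "2 * pi * m \<le> L i" if d: "0 < d" and m: "0 \<le> m"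
    and fm: "\<And>y. y \<in> {x i - d..x i + d} \<Longrightarrow> y \<noteq> a \<Longrightarrow> m \<le> f y" for i d m
  proof (rule boundary_value_ge[OF Z L d m])
    fix A :: "real set" assume A: "A \<in> sets borel" "A \<subseteq> {x i - d..x i + d}"
    have "ennreal m * emeasure lborel A = (\<integral>\<^sup>+x. ennreal m * indicator A x \<partial>lborel)"
      using A(1) by (simp add: nn_integral_cmult_indicator)
    also have "\<dots> \<le> (\<integral>\<^sup>+x\<in>A. ennreal (f x) \<partial>lborel)"
    proof (rule nn_integral_mono_AE)
      have "AE x in lborel. x \<noteq> a" by (rule AE_lborel_singleton)
      then show "AE x in lborel. ennreal m * indicator A x \<le> ennreal (f x) * indicator A x"
        by eventually_elim (use fm A(2) in \<open>auto simp: indicator_def ennreal_leI\<close>)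
    qed
    also have "\<dots> \<le> emeasure \<mu> A" unfolding em[OF A(1)] by (rule add_increasing) auto
    finally show "ennreal m * emeasure lborel A \<le> emeasure \<mu> A" .
  qed
  define p q where "p = (x 0 + x 1) / 2" and "q = (x 1 + x 2) / 2"
  have pq: "x 0 < p" "p < x 1" "x 1 < q" "q < x 2" using x by (auto simp: p_def q_def)
  consider "a < x 1" | "a = x 1" | "x 1 < a" by linarith
  then show ?thesis
  proof cases
    case 1
    have "L 2 \<le> 2 * pi * f q"
      by (rule upper[of "(x 2 - q) / 2"]) (use pq 1 f0 in \<open>auto intro!: down simp: field_simps\<close>)
    moreover have "2 * pi * f q \<le> L 1"
      by (rule lower[of "min (x 1 - a) (q - x 1) / 2"])
         (use pq 1 f0 in \<open>auto intro!: down simp: min_def field_simps split: if_splits\<close>)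
    ultimately show ?thesis by simp
  next
    case 2
    have "L 2 \<le> 2 * pi * f q"
      by (rule upper[of "(x 2 - q) / 2"]) (use pq 2 f0 in \<open>auto intro!: down simp: field_simps\<close>)
    moreover have "L 0 \<le> 2 * pi * f p"
      by (rule upper[of "(p - x 0) / 2"]) (use pq 2 f0 in \<open>auto intro!: up simp: field_simps\<close>)
    \<comment> \<open>At the mode \<open>f\<close> is uncontrolled, but one point is Lebesgue null
      and an atom there only enlarges the measure.\<close>
    moreover have "2 * pi * min (f p) (f q) \<le> L 1"
    proof (rule lower[of "min (x 1 - p) (q - x 1)"])
      fix y assume y: "y \<in> {x 1 - min (x 1 - p) (q - x 1)..x 1 + min (x 1 - p) (q - x 1)}" "y \<noteq> a"
      then have "p \<le> y" "y \<le> q" by (auto simp: min_def split: if_splits)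
      then show "min (f p) (f q) \<le> f y"
        using up[of p y] down[of y q] y(2) by (cases "y < a") (auto simp: min_le_iff_disj)
    qed (use pq f0 in auto)
    moreover have "2 * pi * min (f p) (f q) = min (2 * pi * f p) (2 * pi * f q)"
      by (auto simp: min_def)
    ultimately show ?thesis by linarith
  next
    case 3
    have "L 0 \<le> 2 * pi * f p"
      by (rule upper[of "(p - x 0) / 2"]) (use pq 3 f0 in \<open>auto intro!: up simp: field_simps\<close>)
    moreover have "2 * pi * f p \<le> L 1"
      by (rule lower[of "min (a - x 1) (x 1 - p) / 2"])
         (use pq 3 f0 in \<open>auto intro!: up simp: min_def field_simps split: if_splits\<close>)
    ultimately show ?thesis by simp
  qed
qed

text \<open>The boundary curve is above \<open>v\<close> over \<open>s0\<close> and
  \<open>s2\<close> and at most \<open>v\<close> over \<open>s1\<close>. The gaps exceed twice the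
  displacement bound, so the boundary points, and hence the dip in the density, come in the same
  order.\<close>

theorem (in real_distribution) subordinated_measure_not_unimodal:
  assumes t: "0 < t" and \<mu>: "real_distribution \<mu>"
    and line: "\<And>b. tanh_transform \<mu> (b + t / 2 * tanh_transform M b) = tanh_transform M b"
    and v: "0 < v" "v < pi"
    and s: "Im (\<Phi> t (Complex s0 v)) < 0"
      "0 < Im (\<Phi> t (Complex s1 v))"
      "Im (\<Phi> t (Complex s2 v)) < 0"
    and sep: "s0 + 2 * sqrt (t + t\<^sup>2 / 4) < s1" "s1 + 2 * sqrt (t + t\<^sup>2 / 4) < s2"
  shows "\<not> unimodal_with_mode \<mu> a"
proof
  assume uni: "unimodal_with_mode \<mu> a"
  obtain Z0 v0 x0 where 0: "Z0 \<longlonglongrightarrow> complex_of_real x0" "\<And>n. 0 < Im (Z0 n)" "\<And>n. Im (Z0 n) < pi"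
    "(\<lambda>n. - Im (coth_transform \<mu> (Z0 n))) \<longlonglongrightarrow> 2 * v0 / t" "\<bar>x0 - s0\<bar> \<le> sqrt (t + t\<^sup>2 / 4)" "v < v0"
    using boundary_approach[OF t \<mu> line, of s0] v s(1) by metis
  obtain Z1 v1 x1 where 1: "Z1 \<longlonglongrightarrow> complex_of_real x1" "\<And>n. 0 < Im (Z1 n)" "\<And>n. Im (Z1 n) < pi"
    "(\<lambda>n. - Im (coth_transform \<mu> (Z1 n))) \<longlonglongrightarrow> 2 * v1 / t" "\<bar>x1 - s1\<bar> \<le> sqrt (t + t\<^sup>2 / 4)" "v1 \<le> v"
    using boundary_approach[OF t \<mu> line, of s1] v s(2) by metis
  obtain Z2 v2 x2 where 2: "Z2 \<longlonglongrightarrow> complex_of_real x2" "\<And>n. 0 < Im (Z2 n)" "\<And>n. Im (Z2 n) < pi"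
    "(\<lambda>n. - Im (coth_transform \<mu> (Z2 n))) \<longlonglongrightarrow> 2 * v2 / t" "\<bar>x2 - s2\<bar> \<le> sqrt (t + t\<^sup>2 / 4)" "v < v2"
    using boundary_approach[OF t \<mu> line, of s2] v s(3) by metis
  define Z where "Z i = (if i = 0 then Z0 else if i = 1 then Z1 else Z2)" for i :: nat
  define x where "x i = (if i = 0 then x0 else if i = 1 then x1 else x2)" for i :: nat
  define L where "L i = (if i = 0 then 2 * v0 / t else if i = 1 then 2 * v1 / t else 2 * v2 / t)" for i :: nat
  have "min (L 0) (L 2) \<le> L 1"
  proof (rule unimodal_boundary_values[OF uni \<mu>, of Z x])
    show "x 0 < x 1" "x 1 < x 2" using 0(5) 1(5) 2(5) sep by (auto simp: x_def)
  qed (use 0 1 2 in \<open>auto simp: Z_def x_def L_def\<close>)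
  moreover have "L 1 < L 0" "L 1 < L 2" using 0(6) 1(6) 2(6) t by (auto simp: L_def divide_strict_right_mono)
  ultimately show False by (auto simp: min_def split: if_splits)
qed

section \<open>Brownian motion and the counterexample\<close>

lemma the_Sigma_transform:
  assumes "prob_measure_Rpos \<rho>" "\<And>z. z \<in> complex_of_real ` {..<0} \<Longrightarrow> Sigma_transform \<rho> z = h z"
  shows "(THE \<rho>. prob_measure_Rpos \<rho> \<and> (\<forall>z\<in>complex_of_real ` {..<0}. Sigma_transform \<rho> z = h z)) = \<rho>"
  using assms by (intro the_equality) (auto intro: Sigma_transform_unique)

text \<open>This is the point mass at \<open>1\<close>, the unit of the convolution: the measure
  subordinated to the point mass at \<open>0\<close> in the logarithmic variable is therefore
  Brownian motion itself.\<close>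

lemma Sigma_transform_return_one:
  assumes z: "z \<in> complex_of_real ` {..<0}"
  shows "Sigma_transform (distr (return borel 0) borel exp) z = 1"
proof -
  have rd: "real_distribution (return borel 0)"
    by (simp add: real_distribution_def real_distribution_axioms_def prob_space_return)
  obtain r where r: "r < 0" "z = of_real r" using z by auto
  obtain a where a: "r = (tanh_transform (return borel 0) a - 1) / (tanh_transform (return borel 0) a + 1)"
    using neg_real_eq_Cayley[OF rd r(1)] by blast
  have g: "tanh_transform (return borel 0) a = 2 / (1 + exp (- a)) - 1"
    unfolding tanh_transform_def by (subst integral_return) (auto simp: tanh_half_eq)
  have "1 + exp (- a) \<noteq> 0" using exp_gt_zero[of "- a"] by linarith
  then have ra: "r = - exp (- a)" unfolding a g by (simp add: field_simps)
  have "eta_inverse (distr (return borel 0) borel exp) z = of_real (- exp (- a))"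
    using eta_inverse_neg[OF prob_measure_Rpos_exp(1)[OF rd], of a]
    unfolding prob_measure_Rpos_exp(2)[OF rd] a[symmetric] r(2) .
  then show ?thesis using r(1) by (simp add: Sigma_transform_def r(2) ra)
qed

lemma free_mult_BM:
  assumes t: "0 < t"
  shows "prob_measure_Rpos (free_mult_BM t)"
    and "\<And>z. z \<in> complex_of_real ` {..<0} \<Longrightarrow>
      Sigma_transform (free_mult_BM t) z = exp (of_real t / 2 * ((z + 1) / (z - 1)))"
proof -
  interpret D: real_distribution "return borel 0"
    by (simp add: real_distribution_def real_distribution_axioms_def prob_space_return)
  have "AE y in return borel (0::real). \<bar>y\<bar> \<le> 0" by (subst AE_return) auto
  then obtain \<mu> where \<mu>: "real_distribution \<mu>"
    and line: "\<And>b. tanh_transform \<mu> (b + t / 2 * tanh_transform (return borel 0) b) = tanh_transform (return borel 0) b"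
    using D.subordinated_measure_exists[OF t] by blast
  note e = prob_measure_Rpos_exp[OF \<mu>] prob_measure_Rpos_exp[OF D.real_distribution_axioms]
  have S: "Sigma_transform (distr \<mu> borel exp) z = exp (of_real t / 2 * ((z + 1) / (z - 1)))"
    if z: "z \<in> complex_of_real ` {..<0}" for z
  proof -
    have "Sigma_transform (distr \<mu> borel exp) z = exp (of_real t / 2 * ((z + 1) / (z - 1))) *
        Sigma_transform (distr (return borel 0) borel exp) z"
      by (rule Sigma_transform_subordinated[OF e(1) e(3) _ z]) (unfold e(2) e(4), rule line)
    then show ?thesis using Sigma_transform_return_one[OF z] by simp
  qed
  have "free_mult_BM t = distr \<mu> borel exp"
    unfolding free_mult_BM_def by (rule the_Sigma_transform[OF e(1) S])
  then show "prob_measure_Rpos (free_mult_BM t)" "\<And>z. z \<in> complex_of_real ` {..<0} \<Longrightarrow>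
      Sigma_transform (free_mult_BM t) z = exp (of_real t / 2 * ((z + 1) / (z - 1)))"
    using e(1) S by simp_all
qed

lemma free_mult_conv_BM:
  assumes t: "0 < t" and \<nu>: "real_distribution \<nu>" and \<mu>: "real_distribution \<mu>"
    and line: "\<And>b. tanh_transform \<mu> (b + t / 2 * tanh_transform \<nu> b) = tanh_transform \<nu> b"
  shows "free_mult_conv (free_mult_BM t) (distr \<nu> borel exp) = distr \<mu> borel exp"
proof -
  note e = prob_measure_Rpos_exp[OF \<mu>] prob_measure_Rpos_exp[OF \<nu>]
  have "Sigma_transform (distr \<mu> borel exp) z =
      Sigma_transform (free_mult_BM t) z * Sigma_transform (distr \<nu> borel exp) z"
    if z: "z \<in> complex_of_real ` {..<0}" for z
    unfolding free_mult_BM(2)[OF t z]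
    by (rule Sigma_transform_subordinated[OF e(1) e(3) _ z]) (unfold e(2) e(4), rule line)
  then show ?thesis
    unfolding free_mult_conv_def by (rule the_Sigma_transform[OF e(1)])
qed

text \<open>One probability space for the test laws at all scales \<open>r\<close>, so that
  \<open>r\<close> appears only in the integrand and dominated convergence applies.\<close>

definition unit_uniform :: "real measure" where
  "unit_uniform = density lborel (\<lambda>u. ennreal (indicator {0..1} u))"

text \<open>Viewed as a random variable on \<open>[0, 1]\<close>: an atom at \<open>0\<close> followed by a long flat piece. The numbers
  make the convolution with the kernel \<open>1 / (x\<^sup>2 + 1/100)\<close> exceed \<open>1\<close> at \<open>0\<close> and at the midpoint \<open>245/16\<close> of
  the flat piece, and stay below \<open>1\<close> at \<open>4\<close>.\<close>

definition spike :: "real \<Rightarrow> real" where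
  "spike u = max 0 ((u - 1 / 50) * (125 / 4))"

definition spike_law :: "real \<Rightarrow> real measure" where
  "spike_law r = distr unit_uniform borel (\<lambda>u. r * spike u)"

interpretation unit_uniform: real_distribution unit_uniform
proof -
  have "prob_space unit_uniform"
    unfolding unit_uniform_def
    by (intro prob_spaceI) (simp add: emeasure_density ennreal_indicator)
  then show "real_distribution unit_uniform"
    by (simp add: real_distribution_def real_distribution_axioms_def unit_uniform_def)
qed

lemma AE_unit_uniform: "AE u in unit_uniform. 0 \<le> u \<and> u \<le> 1"
  unfolding unit_uniform_def by (subst AE_density) (auto simp: indicator_def)

lemma spike_bounds: "0 \<le> spike u" "u \<le> 1 \<Longrightarrow> spike u \<le> 245 / 8"
proof -
  show "0 \<le> spike u" by (simp add: spike_def)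
  assume "u \<le> 1"
  then have "(u - 1 / 50) * (125 / 4) \<le> 245 / 8" by (simp add: field_simps)
  then show "spike u \<le> 245 / 8" unfolding spike_def by (rule max.boundedI[rotated]) simp
qed

lemma borel_measurable_spike [measurable]: "spike \<in> borel_measurable borel"
  unfolding spike_def by measurable

lemma real_distribution_spike_law: "real_distribution (spike_law r)"
  unfolding spike_law_def by (rule unit_uniform.real_distribution_distr) simp

lemma spike_law_bounded:
  assumes "0 \<le> r"
  shows "AE y in spike_law r. \<bar>y\<bar> \<le> r * (245 / 8)"
proof -
  have "AE u in unit_uniform. \<bar>r * spike u\<bar> \<le> r * (245 / 8)"
    using AE_unit_uniform
  proof eventually_elim
    case (elim u)
    have "r * spike u \<le> r * (245 / 8)" using assms elim by (intro mult_left_mono spike_bounds) auto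
    moreover have "0 \<le> r * spike u" using assms by (intro mult_nonneg_nonneg spike_bounds)
    ultimately show ?case by linarith
  qed
  then show ?thesis unfolding spike_law_def by (subst AE_distr_iff) auto
qed

lemma unimodal_spike_law:
  assumes r: "0 < r"
  shows "unimodal_with_mode (spike_law r) 0"
  unfolding unimodal_with_mode_def
proof (intro conjI exI ballI allI)
  define f where "f y = 4 / (125 * r) * indicator {0..r * (245 / 8)} y" for y :: real
  show "sets (spike_law r) = sets borel" by (simp add: spike_law_def)
  show "0 \<le> f y" for y using r by (simp add: f_def)
  show "mono_on {..<0} f" by (intro monotone_onI) (auto simp: f_def indicator_def)
  show "antimono_on {0<..} f" using r by (intro monotone_onI) (auto simp: f_def indicator_def)
  fix A :: "real set" assume A: "A \<in> sets borel"
  \<comment> \<open>The affine argument is \<open>r * spike u\<close> continued linearly to all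
    \<open>u\<close>; intersecting with \<open>{0..r * (245 / 8)}\<close> confines \<open>u\<close>
    to \<open>[1/50, 1]\<close>.\<close>
  let ?J = "\<integral>\<^sup>+u. indicator (A \<inter> {0..r * (245 / 8)}) (- (r * 125 / 200) + r * (125 / 4) * u) \<partial>lborel"
  have "emeasure (spike_law r) A = (\<integral>\<^sup>+y. indicator A y \<partial>spike_law r)"
    using A by (simp add: spike_law_def)
  also have "\<dots> = (\<integral>\<^sup>+u. indicator A (r * spike u) \<partial>unit_uniform)"
    unfolding spike_law_def using A by (intro nn_integral_distr) auto
  also have "\<dots> = (\<integral>\<^sup>+u. ennreal (indicator {0..1} u) * indicator A (r * spike u) \<partial>lborel)"
    unfolding unit_uniform_def using A by (subst nn_integral_density) auto
  also have "\<dots> = (\<integral>\<^sup>+u. indicator A 0 * indicator {0..<1/50} u +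
      indicator (A \<inter> {0..r * (245 / 8)}) (- (r * 125 / 200) + r * (125 / 4) * u) \<partial>lborel)"
  proof (rule nn_integral_cong)
    fix u :: real
    consider "u < 0" | "0 \<le> u" "u < 1 / 50" | "1 / 50 \<le> u" "u \<le> 1" | "1 < u" by linarith
    then show "ennreal (indicator {0..1} u) * indicator A (r * spike u) =
      indicator A 0 * indicator {0..<1/50} u +
      indicator (A \<inter> {0..r * (245 / 8)}) (- (r * 125 / 200) + r * (125 / 4) * u)"
    proof cases
      case 1
      have "- (r * 125 / 200) + r * (125 / 4) * u < 0"
        using 1 r mult_pos_neg[OF r 1] by simp
      then show ?thesis using 1 by (auto simp: indicator_def)
    next
      case 2
      have "r * (125 / 4) * u < r * (125 / 4) * (1 / 50)" using 2 r by (intro mult_strict_left_mono) auto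
      then have "- (r * 125 / 200) + r * (125 / 4) * u < 0" by simp
      moreover have "spike u = 0" using 2 by (simp add: spike_def)
      ultimately show ?thesis using 2 by (auto simp: indicator_def)
    next
      case 3
      have e: "r * spike u = - (r * 125 / 200) + r * (125 / 4) * u"
      proof -
        have sp: "spike u = (u - 1 / 50) * (125 / 4)" using 3 by (simp add: spike_def)
        have "(u - 1 / 50) * (125 / 4) = - (125 / 200) + 125 / 4 * u" by simp
        then have sp': "spike u = - (125 / 200) + 125 / 4 * u" using sp by (simp only:)
        show ?thesis unfolding sp' distrib_left by simp
      qed
      have "0 \<le> r * spike u" "r * spike u \<le> r * (245 / 8)"
        using spike_bounds(1)[of u] spike_bounds(2)[OF 3(2)] r by (auto intro: mult_left_mono)
      then show ?thesis using 3 unfolding e by (auto simp: indicator_def)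
    next
      case 4
      have "r * (125 / 4) * 1 < r * (125 / 4) * u" using 4 r by (intro mult_strict_left_mono) auto
      then have "r * (245 / 8) < - (r * 125 / 200) + r * (125 / 4) * u" by simp
      then show ?thesis using 4 by (auto simp: indicator_def)
    qed
  qed
  also have "\<dots> = (\<integral>\<^sup>+u. indicator A 0 * indicator {0..<1/50} (u::real) \<partial>lborel) +
      ?J"
    using A by (intro nn_integral_add) auto
  also have "(\<integral>\<^sup>+u. indicator A 0 * indicator {0..<1/50} (u::real) \<partial>lborel) = ennreal (1 / 50) * indicator A 0"
    by (simp add: nn_integral_cmult_indicator mult.commute)
  also have "?J =
      (\<integral>\<^sup>+y\<in>A. ennreal (f y) \<partial>lborel)"
  proof -
    have "(\<integral>\<^sup>+y\<in>A. ennreal (f y) \<partial>lborel) = (\<integral>\<^sup>+y. ennreal (4 / (125 * r)) * indicator (A \<inter> {0..r * (245 / 8)}) y \<partial>lborel)"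
      using r by (intro nn_integral_cong) (auto simp: f_def indicator_def)
    also have "\<dots> = ennreal (4 / (125 * r)) * (\<integral>\<^sup>+y. indicator (A \<inter> {0..r * (245 / 8)}) y \<partial>lborel)"
      using A by (intro nn_integral_cmult) auto
    also have "(\<integral>\<^sup>+y. indicator (A \<inter> {0..r * (245 / 8)}) y \<partial>lborel) = \<bar>r * (125 / 4)\<bar> *
        ?J"
      using A r by (intro nn_integral_real_affine) auto
    also have "ennreal (4 / (125 * r)) * (\<bar>r * (125 / 4)\<bar> *
        ?J) =
        ?J"
    proof -
      have "ennreal (4 / (125 * r)) * ennreal \<bar>r * (125 / 4)\<bar> = ennreal (4 / (125 * r) * (r * (125 / 4)))"
        using r by (simp add: ennreal_mult[symmetric])
      also have "4 / (125 * r) * (r * (125 / 4)) = 1" using r by simp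
      finally show ?thesis by (simp add: mult.assoc[symmetric])
    qed
    finally show ?thesis by simp
  qed
  finally show "emeasure (spike_law r) A = ennreal (1 / 50) * indicator A 0 + (\<integral>\<^sup>+y\<in>A. ennreal (f y) \<partial>lborel)" .
qed

lemma integral_unit_uniform:
  fixes f :: "real \<Rightarrow> real"
  assumes "continuous_on UNIV f" and "(f has_integral I) {0..1}"
  shows "(LINT u|unit_uniform. f u) = I"
proof -
  have m: "f \<in> borel_measurable borel" using assms(1) by (rule borel_measurable_continuous_onI)
  have "(LINT u|unit_uniform. f u) = (LINT u:{0..1}|lborel. f u)"
    unfolding unit_uniform_def set_lebesgue_integral_def using m by (intro integral_density) auto
  also have "\<dots> = integral {0..1} f"
    using assms(1) by (intro set_borel_integral_eq_integral borel_integrable_atLeastAtMost' continuous_on_subset[OF assms(1)]) auto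
  also have "\<dots> = I" using assms(2) by (rule integral_unique)
  finally show ?thesis .
qed

lemma Cauchy_kernel_spike:
  assumes V: "0 < V"
  shows "(LINT u|unit_uniform. 1 / ((S - spike u)\<^sup>2 + V\<^sup>2)) =
    1 / 50 / (S\<^sup>2 + V\<^sup>2) + 4 / 125 / V * (arctan (S / V) + arctan ((245 / 8 - S) / V))"
proof (rule integral_unit_uniform)
  have pos: "0 < x\<^sup>2 + V\<^sup>2" for x using V by (simp add: add_nonneg_pos)
  show "continuous_on UNIV (\<lambda>u. 1 / ((S - spike u)\<^sup>2 + V\<^sup>2))"
    unfolding spike_def using pos by (intro continuous_intros) (auto simp: less_imp_neq[THEN not_sym])
  have 1: "((\<lambda>u. 1 / ((S - spike u)\<^sup>2 + V\<^sup>2)) has_integral 1 / 50 / (S\<^sup>2 + V\<^sup>2)) {0..1 / 50}"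
  proof (rule has_integral_eq)
    show "((\<lambda>u. 1 / (S\<^sup>2 + V\<^sup>2)) has_integral 1 / 50 / (S\<^sup>2 + V\<^sup>2)) {0..1 / 50::real}"
      using has_integral_const_real[of "1 / (S\<^sup>2 + V\<^sup>2)" 0 "1 / 50"] by simp
  qed (auto simp: spike_def)
  define F where "F u = 4 / 125 / V * arctan (((u - 1 / 50) * (125 / 4) - S) / V)" for u
  have 2: "((\<lambda>u. 1 / ((S - spike u)\<^sup>2 + V\<^sup>2)) has_integral F 1 - F (1 / 50)) {1 / 50..1}"
  proof (rule fundamental_theorem_of_calculus)
    fix u :: real assume u: "u \<in> {1 / 50..1}"
    define w where "w = (u - 1 / 50) * (125 / 4) - S"
    have "(F has_real_derivative 4 / 125 / V * (inverse (1 + (w / V)\<^sup>2) * (125 / 4 / V))) (at u within {1 / 50..1})"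
      unfolding F_def w_def using V by (auto intro!: derivative_eq_intros)
    also have "4 / 125 / V * (inverse (1 + (w / V)\<^sup>2) * (125 / 4 / V)) = 1 / (w\<^sup>2 + V\<^sup>2)"
    proof -
      have "1 + (w / V)\<^sup>2 = (w\<^sup>2 + V\<^sup>2) / V\<^sup>2" using V by (simp add: power_divide add_divide_distrib)
      moreover have "4 / 125 / V * (inverse (D / V\<^sup>2) * (125 / 4 / V)) = 1 / D" if "0 < D" for D
        using V that by (simp add: field_simps power2_eq_square)
      ultimately show ?thesis using pos[of w] by (simp only:)
    qed
    also have "w\<^sup>2 = (S - spike u)\<^sup>2" using u by (simp add: w_def spike_def power2_commute)
    finally show "(F has_vector_derivative 1 / ((S - spike u)\<^sup>2 + V\<^sup>2)) (at u within {1 / 50..1})"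
      by (simp add: has_real_derivative_iff_has_vector_derivative)
  qed simp
  have "F 1 - F (1 / 50) = 4 / 125 / V * (arctan (S / V) + arctan ((245 / 8 - S) / V))"
    by (simp add: F_def arctan_minus algebra_simps)
  then show "((\<lambda>u. 1 / ((S - spike u)\<^sup>2 + V\<^sup>2)) has_integral 1 / 50 / (S\<^sup>2 + V\<^sup>2) +
      4 / 125 / V * (arctan (S / V) + arctan ((245 / 8 - S) / V))) {0..1}"
    using has_integral_combine[OF _ _ 1 2] by simp
qed

section \<open>Numerical values of the limiting convolution\<close>

lemma arctan_ge_div: "0 \<le> x \<Longrightarrow> x / (1 + x\<^sup>2) \<le> arctan (x::real)"
proof -
  assume x: "0 \<le> x"
  have "arctan 0 - 0 / (1 + x\<^sup>2) \<le> arctan x - x / (1 + x\<^sup>2)"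
  proof (rule DERIV_nonneg_imp_nondecreasing[OF x])
    fix y assume y: "0 \<le> y" "y \<le> x"
    have "1 + x\<^sup>2 > 0" by (simp add: add_pos_nonneg)
    then have "((\<lambda>y. arctan y - y / (1 + x\<^sup>2)) has_real_derivative inverse (1 + y\<^sup>2) - 1 / (1 + x\<^sup>2)) (at y)"
      by (auto intro!: derivative_eq_intros)
    moreover have "1 / (1 + x\<^sup>2) \<le> inverse (1 + y\<^sup>2)"
      unfolding inverse_eq_divide using y by (intro divide_left_mono add_left_mono power_mono mult_pos_pos) (auto simp: add_pos_nonneg)
    ultimately show "\<exists>d. ((\<lambda>y. arctan y - y / (1 + x\<^sup>2)) has_real_derivative d) (at y) \<and> 0 \<le> d"
      by (intro exI[of _ "inverse (1 + y\<^sup>2) - 1 / (1 + x\<^sup>2)"]) auto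
  qed
  then show ?thesis by simp
qed

text \<open>At \<open>V = 1 / 10\<close> an endless flat piece of density \<open>4 / 125\<close>
  would contribute \<open>8 / 25 * pi\<close>, about \<open>1.0053\<close>. At \<open>4\<close> the
  near end costs about \<open>8 / 25 / 40 = 0.008\<close>, more than the excess, and the atom
  restores only \<open>2 / 1601\<close>. At the midpoint both ends together cost about
  \<open>0.0042\<close>, less than the excess. At \<open>0\<close> the atom alone gives
  \<open>2\<close>.\<close>

lemma Cauchy_kernel_spike_values:
  shows "1 < (LINT u|unit_uniform. 1 / ((0 - spike u)\<^sup>2 + (1 / 10)\<^sup>2))"
    and "(LINT u|unit_uniform. 1 / ((4 - spike u)\<^sup>2 + (1 / 10)\<^sup>2)) < 1"
    and "1 < (LINT u|unit_uniform. 1 / ((245 / 16 - spike u)\<^sup>2 + (1 / 10)\<^sup>2))"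
proof -
  note I = Cauchy_kernel_spike[of "1 / 10"]
  have "0 < arctan (1225 / 4 :: real)" by simp
  then show "1 < (LINT u|unit_uniform. 1 / ((0 - spike u)\<^sup>2 + (1 / 10)\<^sup>2))"
    by (subst I) (auto simp: power2_eq_square intro: add_pos_pos)
  have "arctan 40 = pi / 2 - arctan (1 / 40)"
    using arctan_inverse[of "1 / 40"] by (simp add: inverse_eq_divide)
  \<comment> \<open>A rounded-down value; a loss above roughly \<open>0.0205\<close> keeps the total
    below \<open>1\<close>.\<close>
  moreover have "103 / 5000 \<le> arctan (1 / 40 :: real)"
    using arctan_ge_div[of "1 / 40"] by (simp add: power2_eq_square)
  moreover have "arctan (1065 / 4) < pi / 2" by (rule arctan_ubound)
  ultimately have "arctan 40 + arctan (1065 / 4) < pi - 103 / 5000" by linarith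
  \<comment> \<open>The right side is \<open>3.14159266 - 103 / 5000\<close>.\<close>
  then have *: "arctan 40 + arctan (1065 / 4) < 156049633 / 50000000" using pi_approx by simp
  have "2 / 1601 + (8 * a + 8 * b) / 25 < 1" if "a + b < 156049633 / 50000000" for a b :: real
  proof -
    have "(8 * a + 8 * b) / 25 = 8 / 25 * (a + b)" by simp
    also have "\<dots> < 8 / 25 * (156049633 / 50000000)" using that by (intro mult_strict_left_mono) auto
    finally have "2 / 1601 + (8 * a + 8 * b) / 25 < 2 / 1601 + 8 / 25 * (156049633 / 50000000)" by simp
    also have "\<dots> < 1" by simp
    finally show ?thesis .
  qed
  then have "2 / 1601 + (8 * arctan 40 + 8 * arctan (1065 / 4)) / 25 < (1::real)" using * .
  then show "(LINT u|unit_uniform. 1 / ((4 - spike u)\<^sup>2 + (1 / 10)\<^sup>2)) < 1"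
    by (subst I) (auto simp: power2_eq_square)
  have "arctan (1225 / 8) = pi / 2 - arctan (8 / 1225)"
    using arctan_inverse[of "8 / 1225"] by (simp add: inverse_eq_divide)
  moreover have "arctan (8 / 1225) \<le> 8 / (1225 :: real)" by (rule arctan_le_self) simp
  \<comment> \<open>The threshold is \<open>25 / 8 = 3.125\<close>, where \<open>8 / 25\<close>
    times the sum of arctangents equals \<open>1\<close>.\<close>
  ultimately have "3.1265 < 2 * arctan (1225 / 8)" using pi_approx by simp
  then show "1 < (LINT u|unit_uniform. 1 / ((245 / 16 - spike u)\<^sup>2 + (1 / 10)\<^sup>2))"
    by (subst I) (auto simp: power2_eq_square)
qed

text \<open>The factor \<open>r\<^sup>2 / 2\<close> is \<open>t / 2\<close> at time
  \<open>t = r\<^sup>2\<close>; with it the kernel tends to the Cauchy kernel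
  \<open>1 / (y\<^sup>2 + V\<^sup>2)\<close>.\<close>

definition scaled_kernel :: "real \<Rightarrow> real \<Rightarrow> real \<Rightarrow> real" where
  "scaled_kernel r V y = (r\<^sup>2 / 2) / (cosh (r * y) - cos (r * V))"

text \<open>The half-angle formulas for \<open>1 - cos\<close> and \<open>cosh - 1\<close> reduce
  both limits to derivatives of \<open>sin\<close> and \<open>sinh\<close> at \<open>0\<close>. The
  first limit also supplies the dominating constant for the integral.\<close>

lemma scaled_kernel_limits:
  fixes V d :: real
  assumes V: "0 < V"
  shows "((\<lambda>r. (1 - cos (r * V)) / (r\<^sup>2 / 2)) \<longlongrightarrow> V\<^sup>2) (at_right 0)"
    and "((\<lambda>r. scaled_kernel r V d) \<longlongrightarrow> 1 / (d\<^sup>2 + V\<^sup>2)) (at_right 0)"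
proof -
  have sn: "((\<lambda>r. sin (r * V / 2) / r) \<longlongrightarrow> V / 2) (at 0)"
  proof -
    have "((\<lambda>r. sin (r * V / 2)) has_real_derivative V / 2) (at 0)"
      by (auto intro!: derivative_eq_intros)
    then show ?thesis by (simp add: DERIV_def)
  qed
  have sh: "((\<lambda>r. sinh (r * d / 2) / r) \<longlongrightarrow> d / 2) (at 0)"
  proof -
    have "((\<lambda>r. sinh (r * d / 2)) has_real_derivative d / 2) (at 0)"
      by (auto intro!: derivative_eq_intros)
    then show ?thesis by (simp add: DERIV_def)
  qed
  have c: "(1 - cos (r * V)) / (r\<^sup>2 / 2) = 4 * (sin (r * V / 2) / r)\<^sup>2" for r
    using cos_double_sin[of "r * V / 2"] by (simp add: power_divide)
  have h: "(cosh (r * d) - 1) / (r\<^sup>2 / 2) = 4 * (sinh (r * d / 2) / r)\<^sup>2" for r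
    using cosh_double_cosh[of "r * d / 2"] by (simp add: power_divide cosh_square_eq)
  have "((\<lambda>r. 4 * (sin (r * V / 2) / r)\<^sup>2) \<longlongrightarrow> 4 * (V / 2)\<^sup>2) (at 0)"
    by (intro tendsto_intros sn)
  then have lc: "((\<lambda>r. (1 - cos (r * V)) / (r\<^sup>2 / 2)) \<longlongrightarrow> V\<^sup>2) (at 0)"
    unfolding c by (simp add: power_divide)
  then show "((\<lambda>r. (1 - cos (r * V)) / (r\<^sup>2 / 2)) \<longlongrightarrow> V\<^sup>2) (at_right 0)"
    by (rule tendsto_within_subset) auto
  have "((\<lambda>r. 4 * (sinh (r * d / 2) / r)\<^sup>2) \<longlongrightarrow> 4 * (d / 2)\<^sup>2) (at 0)"
    by (intro tendsto_intros sh)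
  then have lh: "((\<lambda>r. (cosh (r * d) - 1) / (r\<^sup>2 / 2)) \<longlongrightarrow> d\<^sup>2) (at 0)"
    unfolding h by (simp add: power_divide)
  have "0 < d\<^sup>2 + V\<^sup>2" using V by (simp add: add_nonneg_pos)
  then have "((\<lambda>r. 1 / ((cosh (r * d) - 1) / (r\<^sup>2 / 2) + (1 - cos (r * V)) / (r\<^sup>2 / 2))) \<longlongrightarrow> 1 / (d\<^sup>2 + V\<^sup>2)) (at 0)"
    by (intro tendsto_intros lh lc) auto
  moreover have "1 / ((cosh (r * d) - 1) / (r\<^sup>2 / 2) + (1 - cos (r * V)) / (r\<^sup>2 / 2)) = scaled_kernel r V d" for r
    by (simp add: scaled_kernel_def flip: add_divide_distrib)
  ultimately show "((\<lambda>r. scaled_kernel r V d) \<longlongrightarrow> 1 / (d\<^sup>2 + V\<^sup>2)) (at_right 0)"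
    by (simp only:) (rule tendsto_within_subset, auto)
qed

text \<open>As \<open>cosh \<ge> 1\<close>, the kernel is at most
  \<open>(r\<^sup>2 / 2) / (1 - cos (r * V))\<close>, which tends to \<open>1 / V\<^sup>2\<close>
  and so is eventually below \<open>2 / V\<^sup>2\<close>, for all \<open>u\<close> at once.\<close>

lemma scaled_kernel_integral_limit:
  assumes V: "0 < V"
  shows "((\<lambda>r. LINT u|unit_uniform. scaled_kernel r V (S - spike u)) \<longlongrightarrow>
    (LINT u|unit_uniform. 1 / ((S - spike u)\<^sup>2 + V\<^sup>2))) (at_right 0)"
  unfolding tendsto_at_iff_sequentially
proof (intro allI impI, unfold comp_def)
  fix X :: "nat \<Rightarrow> real" assume X: "\<forall>i. X i \<in> {0<..} - {0}" and X0: "X \<longlonglongrightarrow> 0"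
  have XR: "(\<lambda>i. g (X i)) \<longlonglongrightarrow> L" if "(g \<longlongrightarrow> L) (at_right 0)" for g :: "real \<Rightarrow> real" and L
    using that X X0 unfolding tendsto_at_iff_sequentially comp_def by blast
  have "\<forall>\<^sub>F i in sequentially. V\<^sup>2 / 2 < (1 - cos (X i * V)) / ((X i)\<^sup>2 / 2)"
    using XR[OF scaled_kernel_limits(1)[OF V]] V by (intro order_tendstoD(1)) auto
  then obtain N where N: "\<And>i. i \<ge> N \<Longrightarrow> V\<^sup>2 / 2 < (1 - cos (X i * V)) / ((X i)\<^sup>2 / 2)"
    unfolding eventually_sequentially by blast
  have "(\<lambda>i. LINT u|unit_uniform. scaled_kernel (X (i + N)) V (S - spike u)) \<longlonglongrightarrow>
    (LINT u|unit_uniform. 1 / ((S - spike u)\<^sup>2 + V\<^sup>2))"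
  proof (rule integral_dominated_convergence[where w = "\<lambda>_. 2 / V\<^sup>2"])
    show "AE u in unit_uniform. (\<lambda>i. scaled_kernel (X (i + N)) V (S - spike u)) \<longlonglongrightarrow> 1 / ((S - spike u)\<^sup>2 + V\<^sup>2)"
      using LIMSEQ_ignore_initial_segment[OF XR[OF scaled_kernel_limits(2)[OF V]]] by (intro AE_I2)
    show "AE u in unit_uniform. norm (scaled_kernel (X (i + N)) V (S - spike u)) \<le> 2 / V\<^sup>2" for i
    proof (rule AE_I2)
      fix u
      define r where "r = X (i + N)"
      have r: "0 < r" using X by (simp add: r_def)
      have "V\<^sup>2 / 2 * (r\<^sup>2 / 2) < 1 - cos (r * V)"
        using N[of "i + N"] r by (simp add: r_def[symmetric] pos_less_divide_eq)
      also have "\<dots> \<le> cosh (r * (S - spike u)) - cos (r * V)" by (rule cosh_minus_cos_ge)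
      finally have D: "V\<^sup>2 / 2 * (r\<^sup>2 / 2) < cosh (r * (S - spike u)) - cos (r * V)" .
      have p: "0 < V\<^sup>2 / 2 * (r\<^sup>2 / 2)" using V r by simp
      have "scaled_kernel r V (S - spike u) \<le> (r\<^sup>2 / 2) / (V\<^sup>2 / 2 * (r\<^sup>2 / 2))"
        unfolding scaled_kernel_def using D p by (intro divide_left_mono mult_pos_pos) auto
      also have "\<dots> = 2 / V\<^sup>2" using r by (simp add: field_simps)
      finally have "scaled_kernel r V (S - spike u) \<le> 2 / V\<^sup>2" .
      moreover have "0 \<le> scaled_kernel r V (S - spike u)"
        unfolding scaled_kernel_def using D p by (intro divide_nonneg_pos) auto
      ultimately show "norm (scaled_kernel (X (i + N)) V (S - spike u)) \<le> 2 / V\<^sup>2" by (simp add: r_def)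
    qed
    show "(\<lambda>u. scaled_kernel (X (i + N)) V (S - spike u)) \<in> borel_measurable unit_uniform" for i
      unfolding scaled_kernel_def cosh_def by measurable
    show "(\<lambda>u. 1 / ((S - spike u)\<^sup>2 + V\<^sup>2)) \<in> borel_measurable unit_uniform" by measurable
  qed simp
  then show "(\<lambda>i. LINT u|unit_uniform. scaled_kernel (X i) V (S - spike u)) \<longlonglongrightarrow>
    (LINT u|unit_uniform. 1 / ((S - spike u)\<^sup>2 + V\<^sup>2))"
    by (rule LIMSEQ_offset)
qed

text \<open>The quantity compared with \<open>1\<close> in the overview, at
  \<open>t = r\<^sup>2\<close>, height \<open>r / 10\<close> and point \<open>r * S\<close>. A value
  above \<open>1\<close> means that the point lies below the boundary curve.\<close>

definition spike_level :: "real \<Rightarrow> real \<Rightarrow> real" where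
  "spike_level S r = sin (r * (1 / 10)) / (r * (1 / 10)) * (LINT u|unit_uniform. scaled_kernel r (1 / 10) (S - spike u))"

lemma spike_level_limit:
  "(spike_level S \<longlongrightarrow> (LINT u|unit_uniform. 1 / ((S - spike u)\<^sup>2 + (1 / 10)\<^sup>2))) (at_right 0)"
proof -
  have "((\<lambda>r::real. sin (r * (1 / 10)) / (r * (1 / 10))) \<longlongrightarrow> 1) (at_right 0)" by real_asymp
  from tendsto_mult[OF this scaled_kernel_integral_limit[of "1 / 10" S]]
  show ?thesis unfolding spike_level_def[abs_def] by simp
qed

lemma Im_subordination_map_spike_law:
  assumes r: "0 < r" "r / 10 < pi"
  shows "Im (subordination_map (spike_law r) (r\<^sup>2) (Complex (r * S) (r / 10))) = r / 10 * (1 - spike_level S r)"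
proof -
  interpret real_distribution "spike_law r" by (rule real_distribution_spike_law)
  have "(LINT y|spike_law r. 1 / (cosh (r * S - y) - cos (r / 10))) =
      (LINT u|unit_uniform. 1 / (cosh (r * S - r * spike u) - cos (r / 10)))"
    unfolding spike_law_def by (intro integral_distr) (auto simp: cosh_def)
  also have "\<dots> = (LINT u|unit_uniform. 2 / r\<^sup>2 * scaled_kernel r (1 / 10) (S - spike u))"
  proof (intro Bochner_Integration.integral_cong refl)
    fix u
    have "r * (S - spike u) = r * S - r * spike u" by (rule right_diff_distrib)
    moreover have "2 / r\<^sup>2 * ((r\<^sup>2 / 2) / D) = 1 / D" for D using r by simp
    ultimately show "1 / (cosh (r * S - r * spike u) - cos (r / 10)) = 2 / r\<^sup>2 * scaled_kernel r (1 / 10) (S - spike u)"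
      by (simp only: scaled_kernel_def times_divide_eq_right mult_1_right)
  qed
  also have "\<dots> = 2 / r\<^sup>2 * (LINT u|unit_uniform. scaled_kernel r (1 / 10) (S - spike u))"
    by (rule integral_mult_right_zero)
  finally have P: "(LINT y|spike_law r. 1 / (cosh (r * S - y) - cos (r / 10))) =
      2 / r\<^sup>2 * (LINT u|unit_uniform. scaled_kernel r (1 / 10) (S - spike u))" .
  have "Im (subordination_map (spike_law r) (r\<^sup>2) (Complex (r * S) (r / 10))) =
      r / 10 - r\<^sup>2 / 2 * (sin (r / 10) * (2 / r\<^sup>2 * (LINT u|unit_uniform. scaled_kernel r (1 / 10) (S - spike u))))"
    using Im_coth_transform'[of "Complex (r * S) (r / 10)"] r P by (simp add: subordination_map_def)
  also have "\<dots> = r / 10 * (1 - spike_level S r)"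
    using r by (simp add: spike_level_def field_simps)
  finally show ?thesis .
qed

lemma not_strongly_log_unimodal_free_mult_BM:
  assumes r: "0 < r" "r \<le> 1"
    and spike: "1 < spike_level 0 r" "spike_level 4 r < 1" "1 < spike_level (245 / 16) r"
  shows "\<not> free_mult_strongly_log_unimodal (free_mult_BM (r\<^sup>2))"
proof
  assume strong: "free_mult_strongly_log_unimodal (free_mult_BM (r\<^sup>2))"
  interpret real_distribution "spike_law r" by (rule real_distribution_spike_law)
  have t: "0 < r\<^sup>2" using r by simp
  have rpi: "r / 10 < pi" using r pi_gt3 by simp
  obtain \<mu> where \<mu>: "real_distribution \<mu>"
    and line: "\<And>b. tanh_transform \<mu> (b + r\<^sup>2 / 2 * tanh_transform (spike_law r) b) = tanh_transform (spike_law r) b"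
    using subordinated_measure_exists[OF t spike_law_bounded] r by fastforce
  define \<nu> where "\<nu> = distr (spike_law r) borel exp"
  have \<nu>: "prob_measure_Rpos \<nu>" "distr \<nu> borel ln = spike_law r"
    unfolding \<nu>_def using prob_measure_Rpos_exp real_distribution_axioms by blast+
  have "log_unimodal \<nu>"
    unfolding log_unimodal_def log_unimodal_with_mode_def \<nu>(2)
    using unimodal_spike_law[OF r(1)] by (intro exI[of _ 1]) simp
  then have "log_unimodal (free_mult_conv (free_mult_BM (r\<^sup>2)) \<nu>)"
    using strong \<nu>(1) unfolding free_mult_strongly_log_unimodal_def by blast
  then have "log_unimodal (distr \<mu> borel exp)"
    unfolding \<nu>_def using free_mult_conv_BM[OF t real_distribution_axioms \<mu> line] by simp
  then obtain a where "unimodal_with_mode \<mu> a"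
    unfolding log_unimodal_def log_unimodal_with_mode_def prob_measure_Rpos_exp(2)[OF \<mu>] by blast
  moreover have "\<not> unimodal_with_mode \<mu> a"
  proof (rule subordinated_measure_not_unimodal[OF t \<mu> line, where v = "r / 10"
        and ?s0.0 = "r * 0" and ?s1.0 = "r * 4" and ?s2.0 = "r * (245 / 16)"])
    \<comment> \<open>For \<open>r \<le> 1\<close> the displacement is less than
      \<open>2 * r\<close>, so even the smaller gap, from \<open>0\<close> to \<open>r * 4\<close>,
      exceeds twice the displacement.\<close>
    have sq: "2 * sqrt (r\<^sup>2 + (r\<^sup>2)\<^sup>2 / 4) < 4 * r"
    proof -
      have "(r\<^sup>2)\<^sup>2 \<le> r\<^sup>2 * 1" unfolding power2_eq_square[of "r\<^sup>2"]
        using r by (intro mult_left_mono power_le_one) auto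
      moreover have "(2 * r)\<^sup>2 = 4 * r\<^sup>2" by (simp add: power_mult_distrib)
      ultimately have "r\<^sup>2 + (r\<^sup>2)\<^sup>2 / 4 < (2 * r)\<^sup>2" using t by linarith
      then have "sqrt (r\<^sup>2 + (r\<^sup>2)\<^sup>2 / 4) < 2 * r" using r by (intro real_less_lsqrt) auto
      then show ?thesis by simp
    qed
    show "r * 0 + 2 * sqrt (r\<^sup>2 + (r\<^sup>2)\<^sup>2 / 4) < r * 4" using sq by simp
    show "r * 4 + 2 * sqrt (r\<^sup>2 + (r\<^sup>2)\<^sup>2 / 4) < r * (245 / 16)" using sq r by simp
  qed (use r rpi spike in \<open>simp_all only: Im_subordination_map_spike_law[OF r(1) rpi], simp_all add: mult_pos_neg\<close>)
  ultimately show False by blast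
qed

theorem theorem4p9:
  "\<exists>t\<^sub>0::real. t\<^sub>0 > 0 \<and> (\<forall>t\<in>{0<..t\<^sub>0}. \<not> free_mult_strongly_log_unimodal (free_mult_BM t))"
proof -
  have "\<forall>\<^sub>F r in at_right 0. 1 < spike_level 0 r" "\<forall>\<^sub>F r in at_right 0. spike_level 4 r < 1"
    "\<forall>\<^sub>F r in at_right 0. 1 < spike_level (245 / 16) r"
    using Cauchy_kernel_spike_values by (intro order_tendstoD[OF spike_level_limit]; simp)+
  then have "\<forall>\<^sub>F r in at_right 0. 1 < spike_level 0 r \<and> spike_level 4 r < 1 \<and> 1 < spike_level (245 / 16) r"
    by eventually_elim auto
  then obtain b where b: "0 < b"
    and level: "\<And>r. 0 < r \<Longrightarrow> r < b \<Longrightarrow> 1 < spike_level 0 r \<and> spike_level 4 r < 1 \<and> 1 < spike_level (245 / 16) r"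
    unfolding eventually_at_right_field by auto
  \<comment> \<open>The bound \<open>1\<close> serves the displacement estimate,
    \<open>b / 2\<close> the level inequalities; \<open>c\<close> bounds \<open>sqrt t\<close>, so
    the final time is its square.\<close>
  define c where "c = min 1 (b / 2)"
  have c: "0 < c" "c \<le> 1" "c < b" using b by (auto simp: c_def min_def)
  have "\<not> free_mult_strongly_log_unimodal (free_mult_BM t)" if t: "t \<in> {0<..c\<^sup>2}" for t
  proof -
    have "sqrt t \<le> c" using t c by (intro real_le_lsqrt) auto
    moreover have "t \<le> 1" using t c power_le_one[of c 2] by auto
    ultimately have "\<not> free_mult_strongly_log_unimodal (free_mult_BM ((sqrt t)\<^sup>2))"
      using t c level[of "sqrt t"] by (intro not_strongly_log_unimodal_free_mult_BM) auto
    then show ?thesis using t by simp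
  qed
  then show ?thesis using c by (intro exI[of _ "c\<^sup>2"]) auto
qed

end
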